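(* Let $m,d\in\mathbb{N}$, let $\bm{r}=(r_1,\dots,r_m)^{\top}\in\mathbb{N}^m$ be a vector of positive integers with $r_1+\dots+r_m=d$, let $\alpha_j\le\beta_j$ be real numbers for $j=1,\dots,m$, and let $\bm{x}_0\in\mathbb{R}^d$. Let $\mathcal{R}(\{\bm{x}_0\},t)\subset\mathbb{R}^d$ be the forward reach set at time $t$ of the integrator dynamics with relative degree vector $\bm{r}$, initial condition $\bm{x}_0$, and box-valued input set $\mathcal{U}=[\alpha_1,\beta_1]\times\dots\times[\alpha_m,\beta_m]$ (see context). Then $\mathcal{R}(\{\bm{x}_0\},t)$ is a semialgebraic set for every time $t\ge 0$.
   Context: The integrator dynamics in Brunovsky normal form is $\dot{\bm{x}}=\bm{A}\bm{x}+\bm{B}\bm{u}$ with $\bm{x}\in\mathbb{R}^d$, $\bm{u}\in\mathbb{R}^m$, $\bm{A}=\mathrm{blkdiag}(\bm{A}_1,\dots,\bm{A}_m)$, $\bm{B}=\mathrm{blkdiag}(\bm{b}_1,\dots,\bm{b}_m)$ (block diagonal). Here $\bm{A}_j$ is the $r_j\times r_j$ matrix with ones on the superdiagonal and zeros elsewhere, and $\bm{b}_j=\bm{e}_{r_j}\in\mathbb{R}^{r_j}$ is the last standard basis vector. The forward reach set $\mathcal{R}(\{\bm{x}_0\},t)$ is the set of all states $\bm{x}(t)$ reachable at time $t$ from $\bm{x}(0)=\bm{x}_0$ using measurable inputs $\bm{u}:[0,t]\to\mathcal{U}$; equivalently $\mathcal{R}(\{\bm{x}_0\},t)=\exp(t\bm{A})\bm{x}_0+\int_0^t\exp(s\bm{A})\bm{B}\,\mathcal{U}\,\mathrm{d}s$,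 where the integral is the set-valued Aumann integral and the sum is a Minkowski sum. A set in $\mathbb{R}^d$ is basic semialgebraic if it can be written as a finite conjunction of polynomial inequalities and equalities with polynomials in $\mathbb{R}[x_1,\dots,x_d]$; a semialgebraic set is a finite union of basic semialgebraic sets. *)

theory Defs
  imports
    "HOL-Analysis.Analysis"
    "HOL-Library.Poly_Mapping"
    "Jordan_Normal_Form.Matrix"
begin

unbundle no vec_syntax

text \<open>
  Vectors and matrices are those of \<^theory>\<open>Jordan_Normal_Form.Matrix\<close>: \<open>\<real>\<^sup>d\<close> is
  \<^term>\<open>carrier_vec d :: real Matrix.vec set\<close>, and coordinates and blocks are numbered from 0.
\<close>

text \<open>
  A monomial maps each variable to its exponent, and a polynomial maps each monomial to its
  coefficient. Variable \<open>i\<close> stands for coordinate \<open>i\<close>.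
\<close>

type_synonym monom = "nat \<Rightarrow>\<^sub>0 nat"
type_synonym real_mpoly = "monom \<Rightarrow>\<^sub>0 real"

definition mpolys :: "nat \<Rightarrow> real_mpoly set" where
  "mpolys d = {p. \<forall>k \<in> Poly_Mapping.keys p. Poly_Mapping.keys k \<subseteq> {..<d}}"

definition mpoly_eval :: "real_mpoly \<Rightarrow> real Matrix.vec \<Rightarrow> real" where
  "mpoly_eval p x =
     (\<Sum>k\<in>Poly_Mapping.keys p. Poly_Mapping.lookup p k *
        (\<Prod>i\<in>Poly_Mapping.keys k. x $ i ^ Poly_Mapping.lookup k i))"

definition basic_semialgebraic :: "nat \<Rightarrow> real Matrix.vec set \<Rightarrow> bool" where
  "basic_semialgebraic d S \<longleftrightarrow>
     (\<exists>E F G. finite E \<and> finite F \<and> finite G \<and>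
        E \<subseteq> mpolys d \<and> F \<subseteq> mpolys d \<and> G \<subseteq> mpolys d \<and>
        S = {x \<in> carrier_vec d.
               (\<forall>p\<in>E. mpoly_eval p x = 0) \<and>
               (\<forall>p\<in>F. mpoly_eval p x \<ge> 0) \<and>
               (\<forall>p\<in>G. mpoly_eval p x > 0)})"

definition semialgebraic :: "nat \<Rightarrow> real Matrix.vec set \<Rightarrow> bool" where
  "semialgebraic d S \<longleftrightarrow>
     (\<exists>\<C>. finite \<C> \<and> (\<forall>C\<in>\<C>. basic_semialgebraic d C) \<and> S = \<Union>\<C>)"

definition admissible_input :: "real Matrix.vec set \<Rightarrow> nat \<Rightarrow> real \<Rightarrow> (real \<Rightarrow> real Matrix.vec) \<Rightarrow> bool"
  where
  "admissible_input U m t u \<longleftrightarrow>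
     (\<forall>s\<in>{0..t}. u s \<in> U) \<and>
     (\<forall>j<m. (\<lambda>s. u s $ j) \<in> borel_measurable (lebesgue_on {0..t}))"

text \<open>
  Since inputs are only measurable, \<open>x' = A x + B u\<close> is understood in the sense of
  Caratheodory, that is, as the associated integral equation.
\<close>

definition trajectory ::
  "real Matrix.mat \<Rightarrow> real Matrix.mat \<Rightarrow> (real \<Rightarrow> real Matrix.vec) \<Rightarrow> real Matrix.vec \<Rightarrow> real \<Rightarrow>
   (real \<Rightarrow> real Matrix.vec) \<Rightarrow> bool" where
  "trajectory A B u x0 t x \<longleftrightarrow>
     (\<forall>s\<in>{0..t}. x s \<in> carrier_vec (dim_row A)) \<and>
     (\<forall>i<dim_row A.
        set_integrable lebesgue {0..t} (\<lambda>\<tau>. (A *\<^sub>v x \<tau> + B *\<^sub>v u \<tau>) $ i) \<and>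
        (\<forall>s\<in>{0..t}. x s $ i =
           x0 $ i + (LINT \<tau>:{0..s}|lebesgue. (A *\<^sub>v x \<tau> + B *\<^sub>v u \<tau>) $ i)))"

definition reach_set ::
  "real Matrix.mat \<Rightarrow> real Matrix.mat \<Rightarrow> real Matrix.vec set \<Rightarrow> real Matrix.vec \<Rightarrow> real \<Rightarrow>
   real Matrix.vec set" where
  "reach_set A B U x0 t =
     {x t | x u. admissible_input U (dim_col B) t u \<and> trajectory A B u x0 t x}"

definition chain_matrix :: "nat \<Rightarrow> real Matrix.mat" where
  "chain_matrix n = Matrix.mat n n (\<lambda>(i, k). if k = Suc i then 1 else 0)"

definition chain_input :: "nat \<Rightarrow> real Matrix.mat" where
  "chain_input n = mat_of_cols n [unit_vec n (n - 1)]"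

definition brunovsky_A :: "nat \<Rightarrow> (nat \<Rightarrow> nat) \<Rightarrow> real Matrix.mat" where
  "brunovsky_A m r = diag_block_mat (List.map (\<lambda>j. chain_matrix (r j)) [0..<m])"

definition brunovsky_B :: "nat \<Rightarrow> (nat \<Rightarrow> nat) \<Rightarrow> real Matrix.mat" where
  "brunovsky_B m r = diag_block_mat (List.map (\<lambda>j. chain_input (r j)) [0..<m])"

definition box_inputs :: "nat \<Rightarrow> (nat \<Rightarrow> real) \<Rightarrow> (nat \<Rightarrow> real) \<Rightarrow> real Matrix.vec set" where
  "box_inputs m \<alpha> \<beta> = {v \<in> carrier_vec m. \<forall>j<m. v $ j \<in> {\<alpha> j..\<beta> j}}"

definition integrator_reach_set ::
  "nat \<Rightarrow> (nat \<Rightarrow> nat) \<Rightarrow> (nat \<Rightarrow> real) \<Rightarrow> (nat \<Rightarrow> real) \<Rightarrow> real Matrix.vec \<Rightarrow> real \<Rightarrow>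
   real Matrix.vec set" where
  "integrator_reach_set m r \<alpha> \<beta> x0 t =
     reach_set (brunovsky_A m r) (brunovsky_B m r) (box_inputs m \<alpha> \<beta>) x0 t"

end

theory Submission
  imports Defs
begin

text \<open>
  The reach set is a product over the \<open>m\<close> integrator chains. By iterated integration, the state of a
  chain of length \<open>n\<close> at time \<open>t\<close> is, up to an affine change of coordinates, the vector of the
  moments \<open>\<integral> (t - x)\<^sup>k u(x) dx\<close>, \<open>k < n\<close>, of its input \<open>u\<close>, so each factor is the convex set \<open>K\<close> of
  moment vectors of measurable functions with values in \<open>[\<alpha>, \<beta>]\<close>. A linear functional \<open>p \<noteq> 0\<close> on
  moments is integration against a nonzero polynomial of degree less than \<open>n\<close>; its maximiser over
  \<open>K\<close> comes from an essentially unique bang-bang input with at most \<open>n - 1\<close> switches. Weak separation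
  of convex sets now shows that \<open>c \<in> K\<close> iff for every \<open>p \<noteq> 0\<close> some such bang-bang moment vector
  \<open>b\<close> satisfies \<open>p \<cdot> c < p \<cdot> b\<close> or \<open>c = b\<close>. As \<open>b\<close> is polynomial in the switching times, this is a
  first-order formula over the reals, and quantifier elimination makes \<open>K\<close> semialgebraic.

  Quantifier elimination is proved without an algorithm: for every finite family of polynomials in
  \<open>y\<close> there are finitely many polynomials in the parameters whose signs decide which joint sign
  conditions of the family are attained, in order, along the \<open>y\<close>-axis. The induction replaces a
  polynomial of maximal degree by its derivative and its pseudo-remainders.
\<close>

section \<open>Transferring signs between two families of real polynomials\<close>

text \<open>Since closedness of \<open>K\<close> is not established, separation is only weak and
  \<open>c\<close> may sit on the separating hyperplane. Uniqueness of the maximiser repairs this: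
  equality in the supporting inequality holds only at \<open>b\<close>, so the alternative
  \<open>c = b\<close> covers exactly the boundary case; and as \<open>b\<close> itself lies in
  \<open>K\<close>, neither alternative is open to a weakly separated \<open>c\<close> outside
  \<open>K\<close>. Allowing repeated switching times fixes the number of real unknowns, which
  first-order quantifiers require.

  A condition counts as eliminated once the signs of finitely many polynomials decide it.
  Eliminating \<open>y\<close> then means transporting a witness from one parameter value to another
  with the same signs. Such a transport needs corresponding cells on the two real lines, hence the
  paired separators; the cells of a new polynomial are recovered from those of its derivative,
  between whose roots it is strictly monotone.\<close>

text \<open>\<open>\<beta>\<close> pairs the separators of one real line with those of another; \<open>sgn_rel \<beta>\<close> then relates
  the points of corresponding cells.\<close>

definition sgn_rel :: "(real \<times> real) set \<Rightarrow> real \<Rightarrow> real \<Rightarrow> bool" where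
  "sgn_rel \<beta> y y' \<longleftrightarrow> (\<forall>(z, z') \<in> \<beta>. sgn (y - z) = sgn (y' - z'))"

definition roots_of :: "real poly set \<Rightarrow> real set" where
  "roots_of Q = {y. \<exists>q\<in>Q. q \<noteq> 0 \<and> poly q y = 0}"

text \<open>Totality in both directions makes this a back-and-forth relation. It forces the pairing
  to be a strictly increasing bijection: the partner of a separator \<open>z\<close> can only be its
  \<open>z'\<close>, which must then compare alike with all other separators.\<close>

definition matches :: "(real \<times> real) set \<Rightarrow> (real poly \<times> real poly) set \<Rightarrow> bool" where
  "matches \<beta> G \<longleftrightarrow> finite \<beta> \<and> fst ` \<beta> = roots_of (fst ` G) \<and> snd ` \<beta> = roots_of (snd ` G) \<and>
     (\<forall>y. \<exists>y'. sgn_rel \<beta> y y') \<and> (\<forall>y'. \<exists>y. sgn_rel \<beta> y y') \<and>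
     (\<forall>y y' q q'. sgn_rel \<beta> y y' \<longrightarrow> (q, q') \<in> G \<longrightarrow> sgn (poly q y) = sgn (poly q' y'))"

lemma sgn_rel_converse: "sgn_rel (\<beta>\<inverse>) y' y = sgn_rel \<beta> y y'"
proof -
  have "sgn (y' - z') = sgn (y - z) \<longleftrightarrow> sgn (y - z) = sgn (y' - z')" for z z' by (rule eq_commute)
  then show ?thesis unfolding sgn_rel_def by (simp add: split_beta) (metis (lifting) converse_iff prod.collapse fst_conv snd_conv)
qed

lemma sgn_relD: "sgn_rel \<beta> y y' \<Longrightarrow> (z, z') \<in> \<beta> \<Longrightarrow> sgn (y - z) = sgn (y' - z')"
  unfolding sgn_rel_def by auto

lemma sgn_diff_real: "sgn (a - b :: real) = (if a < b then -1 else if a = b then 0 else 1)"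
  by (auto simp: sgn_if)

lemma sgn_rel_cmp:
  assumes "sgn_rel \<beta> y y'" "(z, z') \<in> \<beta>"
  shows "y < z \<longleftrightarrow> y' < z'" "y = z \<longleftrightarrow> y' = z'" "z < y \<longleftrightarrow> z' < y'"
  using sgn_relD[OF assms] by (auto simp: sgn_diff_real split: if_splits)

lemma sgn_relI:
  assumes "\<And>z z'. (z, z') \<in> \<beta> \<Longrightarrow> (y < z \<longleftrightarrow> y' < z') \<and> (z < y \<longleftrightarrow> z' < y')"
  shows "sgn_rel \<beta> y y'"
proof -
  have "sgn (y - z) = sgn (y' - z')" if "(z, z') \<in> \<beta>" for z z'
    using assms[OF that] by (cases "y < z"; cases "z < y") (simp_all add: sgn_diff_real)
  then show ?thesis unfolding sgn_rel_def by auto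
qed

text \<open>By the intermediate value theorem a change between opposite signs forces a root strictly
  between the two points, and a root at just one of them already separates it from the other;
  \<open>Z\<close> contains all such roots.\<close>

lemma sgn_poly_cell:
  fixes q :: "real poly"
  assumes "\<And>z. z \<in> Z \<Longrightarrow> sgn (a - z) = sgn (b - z)"
    and "q \<noteq> 0 \<Longrightarrow> {z. poly q z = 0} \<subseteq> Z"
  shows "sgn (poly q a) = sgn (poly q b)"
proof (rule ccontr)
  assume ne: "sgn (poly q a) \<noteq> sgn (poly q b)"
  have "\<exists>z. poly q z = 0 \<and> sgn (a - z) \<noteq> sgn (b - z)" if "a < b" "sgn (poly q a) \<noteq> sgn (poly q b)" for a b
  proof (cases "poly q a = 0 \<or> poly q b = 0")
    case True
    then show ?thesis using \<open>a < b\<close> by (metis sgn_diff_real order_less_irrefl zero_neq_neg_one zero_neq_one)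
  next
    case False
    then have "poly q a * poly q b < 0"
      using that by (auto simp: sgn_if mult_less_0_iff split: if_splits)
    then obtain x where "a < x" "x < b" "poly q x = 0" using poly_IVT[OF \<open>a < b\<close>] by blast
    then show ?thesis by (intro exI[of _ x]) (simp add: sgn_diff_real)
  qed
  then have "\<exists>z. poly q z = 0 \<and> sgn (a - z) \<noteq> sgn (b - z)"
    using ne by (metis linorder_neqE)
  moreover have "q \<noteq> 0" using ne by auto
  ultimately show False using assms by blast
qed

section \<open>Pairings of separators and their restriction\<close>

lemma roots_of_image:
  "y \<in> roots_of (fst ` G) \<longleftrightarrow> (\<exists>q q'. (q, q') \<in> G \<and> q \<noteq> 0 \<and> poly q y = 0)"
  "y \<in> roots_of (snd ` G) \<longleftrightarrow> (\<exists>q q'. (q, q') \<in> G \<and> q' \<noteq> 0 \<and> poly q' y = 0)"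
  unfolding roots_of_def by (simp_all add: image_iff split_beta) (metis prod.collapse fst_conv snd_conv)+

lemma matches_self:
  assumes "matches \<beta> G" "(z, z') \<in> \<beta>"
  shows "sgn_rel \<beta> z z'"
proof -
  obtain y' where y': "sgn_rel \<beta> z y'" using assms unfolding matches_def by blast
  then have "y' = z'" using sgn_rel_cmp(2)[OF y' assms(2)] by simp
  then show ?thesis using y' by simp
qed

text \<open>Dropping polynomials drops separators, so cells merge. The thinned pairing stays total
  because it imposes fewer conditions, and signs stay constant on a merged cell because no root of a
  kept polynomial separates its points.\<close>

lemma matches_subset:
  assumes M: "matches \<beta> G" and sub: "G0 \<subseteq> G"
  shows "\<exists>\<beta>0\<subseteq>\<beta>. matches \<beta>0 G0"
proof -
  define Z where "Z = roots_of (fst ` G0)"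
  define Z' where "Z' = roots_of (snd ` G0)"
  define \<beta>0 where "\<beta>0 = {(z, z') \<in> \<beta>. z \<in> Z}"
  have fin: "finite \<beta>" and dom: "fst ` \<beta> = roots_of (fst ` G)" and ran: "snd ` \<beta> = roots_of (snd ` G)"
    and T1: "\<And>y. \<exists>y'. sgn_rel \<beta> y y'" and T2: "\<And>y'. \<exists>y. sgn_rel \<beta> y y'"
    and S: "\<And>y y' q q'. sgn_rel \<beta> y y' \<Longrightarrow> (q, q') \<in> G \<Longrightarrow> sgn (poly q y) = sgn (poly q' y')"
    using M unfolding matches_def by blast+
  \<comment> \<open>\<open>roots_of\<close> skips zero polynomials, so the two root sets correspond
    only if zero polynomials do; these are the ones of sign 0 everywhere.\<close>
  have zero: "q = 0 \<longleftrightarrow> q' = 0" if "(q, q') \<in> G" for q q'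
  proof
    assume "q = 0"
    then have "sgn (poly q' y') = 0" for y' using T2[of y'] S[OF _ that] by fastforce
    then show "q' = 0" using poly_all_0_iff_0 by (auto simp: sgn_zero_iff)
  next
    assume "q' = 0"
    then have "sgn (poly q y) = 0" for y using T1[of y] S[OF _ that] by fastforce
    then show "q = 0" using poly_all_0_iff_0 by (auto simp: sgn_zero_iff)
  qed
  have ZZ: "z \<in> Z \<longleftrightarrow> z' \<in> Z'" if "(z, z') \<in> \<beta>" for z z'
  proof -
    have "poly q z = 0 \<longleftrightarrow> poly q' z' = 0" if "(q, q') \<in> G" for q q'
      using S[OF matches_self[OF M \<open>(z, z') \<in> \<beta>\<close>] that] by (metis sgn_0_0 sgn_0)
    then show ?thesis unfolding Z_def Z'_def roots_of_image using sub zero by blast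
  qed
  have Zsub: "Z \<subseteq> fst ` \<beta>" "Z' \<subseteq> snd ` \<beta>"
    unfolding dom ran Z_def Z'_def roots_of_def using sub by blast+
  have dom0: "fst ` \<beta>0 = Z" using Zsub unfolding \<beta>0_def by force
  have ran0: "snd ` \<beta>0 = Z'"
  proof -
    have "z' \<in> snd ` \<beta>0" if "z' \<in> Z'" for z'
    proof -
      have "z' \<in> snd ` \<beta>" using Zsub(2) that by blast
      then obtain z where "(z, z') \<in> \<beta>" by auto
      then have "(z, z') \<in> \<beta>0" using ZZ that unfolding \<beta>0_def by blast
      then show ?thesis by (rule rev_image_eqI) simp
    qed
    moreover have "z' \<in> Z'" if "(z, z') \<in> \<beta>0" for z z' using that ZZ unfolding \<beta>0_def by blast
    ultimately show ?thesis by auto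
  qed
  have le: "sgn_rel \<beta> y y' \<Longrightarrow> sgn_rel \<beta>0 y y'" for y y'
    unfolding sgn_rel_def \<beta>0_def by auto
  have S0: "sgn (poly q y) = sgn (poly q' y')" if r: "sgn_rel \<beta>0 y y'" and q: "(q, q') \<in> G0" for y y' q q'
  proof -
    \<comment> \<open>\<open>y'\<close> need not be a partner of \<open>y\<close> for the finer
      \<open>\<beta>\<close>, so the sign is carried over by such a partner \<open>y1\<close> and
      then moved to \<open>y'\<close> inside the merged cell.\<close>
    obtain y1 where y1: "sgn_rel \<beta> y y1" using T1 by blast
    have "sgn (poly q' y') = sgn (poly q' y1)"
    proof (rule sgn_poly_cell[where Z = Z'])
      fix z' assume "z' \<in> Z'"
      then obtain z where z: "(z, z') \<in> \<beta>0" unfolding ran0[symmetric] by auto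
      show "sgn (y' - z') = sgn (y1 - z')" using sgn_relD[OF r z] sgn_relD[OF le[OF y1] z] by simp
    next
      show "q' \<noteq> 0 \<Longrightarrow> {z. poly q' z = 0} \<subseteq> Z'" unfolding Z'_def roots_of_def using q by auto (metis (lifting) image_eqI snd_conv)
    qed
    then show ?thesis using S[OF y1] q sub by auto
  qed
  have "finite \<beta>0" using fin unfolding \<beta>0_def by (auto intro: finite_subset)
  moreover have "\<exists>y'. sgn_rel \<beta>0 y y'" "\<exists>y. sgn_rel \<beta>0 y y'" for y y' using T1 T2 le by blast+
  ultimately have "matches \<beta>0 G0"
    unfolding matches_def dom0 ran0 Z_def Z'_def using S0 by blast
  moreover have "\<beta>0 \<subseteq> \<beta>" unfolding \<beta>0_def by auto
  ultimately show ?thesis by blast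
qed

text \<open>The roots of \<open>p\<close> and \<open>p'\<close> are to become new separators.\<close>

locale sign_refinement =
  fixes \<beta> :: "(real \<times> real) set" and p p' :: "real poly"
  assumes fin: "finite \<beta>"
    and tot1: "\<And>y. \<exists>y'. sgn_rel \<beta> y y'" and tot2: "\<And>y'. \<exists>y. sgn_rel \<beta> y y'"
    and crit: "{z. poly (pderiv p) z = 0} \<subseteq> fst ` \<beta>"
    and crit': "{z. poly (pderiv p') z = 0} \<subseteq> snd ` \<beta>"
    and sep: "\<And>z z'. (z, z') \<in> \<beta> \<Longrightarrow> sgn (poly p z) = sgn (poly p' z')"
    and co: "\<And>i. sgn (coeff p i) = sgn (coeff p' i)"
begin

text \<open>The hypotheses treat both real lines alike, so a transfer proved from left to right also
  holds from right to left.\<close>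

lemma converse: "sign_refinement (\<beta>\<inverse>) p' p"
proof -
  have "fst ` (R\<inverse>) = snd ` R" "snd ` (R\<inverse>) = fst ` R" for R :: "(real \<times> real) set"
    by (simp_all add: fst_eq_Domain snd_eq_Range)
  then show ?thesis
    by unfold_locales (use fin tot1 tot2 crit crit' sep co in \<open>auto simp: sgn_rel_converse\<close>)
qed

lemma uminus: "sign_refinement \<beta> (- p) (- p')"
  by unfold_locales (use fin tot1 tot2 crit crit' sep co in \<open>auto simp: pderiv_minus sgn_minus\<close>)

lemma sgn_rel_self: "(z, z') \<in> \<beta> \<Longrightarrow> sgn_rel \<beta> z z'"
proof -
  assume z: "(z, z') \<in> \<beta>"
  obtain y' where y': "sgn_rel \<beta> z y'" using tot1 by blast
  then have "y' = z'" using sgn_rel_cmp(2)[OF y' z] by simp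
  then show ?thesis using y' by simp
qed

end

lemma coeff_pcompose_neg: "coeff (pcompose p [:0, -1:]) i = (-1) ^ i * coeff p (i :: nat)" for p :: "real poly"
proof (induction p arbitrary: i)
  case 0
  then show ?case by simp
next
  case (pCons a p)
  show ?case
    by (cases i) (simp_all add: pcompose_pCons pCons.IH)
qed

lemma sgn_rel_reflect:
  "sgn_rel ((\<lambda>(z, z'). (- z, - z')) ` \<beta>) y y' = sgn_rel \<beta> (- y) (- y')"
proof -
  have "sgn (y - - z) = sgn (y' - - z') \<longleftrightarrow> sgn (- y - z) = sgn (- y' - z')" for z z' :: real
    by (auto simp: sgn_diff_real split: if_splits)
  then show ?thesis unfolding sgn_rel_def by (auto simp: split_beta)
qed

text \<open>Reflection exchanges increasing with decreasing and swaps the two neighbours of a point,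
  which halves the case analyses below. Odd coefficients change sign for both polynomials at
  once.\<close>

lemma (in sign_refinement) reflect:
  "sign_refinement ((\<lambda>(z, z'). (- z, - z')) ` \<beta>) (pcompose p [:0, -1:]) (pcompose p' [:0, -1:])"
proof -
  note rel = sgn_rel_reflect
  have d: "poly (pderiv (pcompose q [:0, -1:])) z = - poly (pderiv q) (- z)" for q :: "real poly" and z
    by (simp add: pderiv_pcompose poly_pcompose pderiv_pCons)
  have im: "fst ` (\<lambda>(z, z'). (- z, - z')) ` \<beta> = uminus ` fst ` \<beta>"
    "snd ` (\<lambda>(z, z'). (- z, - z')) ` \<beta> = uminus ` snd ` \<beta>"
    by (force simp: image_image split_beta)+
  show ?thesis
  proof unfold_locales
    show "\<exists>y'. sgn_rel ((\<lambda>(z, z'). (- z, - z')) ` \<beta>) y y'" for y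
      using tot1[of "- y"] unfolding rel by (metis minus_minus)
    show "\<exists>y. sgn_rel ((\<lambda>(z, z'). (- z, - z')) ` \<beta>) y y'" for y'
      using tot2[of "- y'"] unfolding rel by (metis minus_minus)
    show "{z. poly (pderiv (p \<circ>\<^sub>p [:0, - 1:])) z = 0} \<subseteq> fst ` (\<lambda>(z, z'). (- z, - z')) ` \<beta>"
    proof
      fix z assume "z \<in> {z. poly (pderiv (p \<circ>\<^sub>p [:0, - 1:])) z = 0}"
      then have "- z \<in> fst ` \<beta>" using crit d by auto
      then show "z \<in> fst ` (\<lambda>(z, z'). (- z, - z')) ` \<beta>" unfolding im by (metis imageI minus_minus)
    qed
    show "{z. poly (pderiv (p' \<circ>\<^sub>p [:0, - 1:])) z = 0} \<subseteq> snd ` (\<lambda>(z, z'). (- z, - z')) ` \<beta>"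
    proof
      fix z assume "z \<in> {z. poly (pderiv (p' \<circ>\<^sub>p [:0, - 1:])) z = 0}"
      then have "- z \<in> snd ` \<beta>" using crit' d by auto
      then show "z \<in> snd ` (\<lambda>(z, z'). (- z, - z')) ` \<beta>" unfolding im by (metis imageI minus_minus)
    qed
  qed (use fin sep co in \<open>auto simp: poly_pcompose coeff_pcompose_neg sgn_mult\<close>)
qed

lemma poly_eventually_sgn_at_top:
  fixes p :: "real poly"
  shows "\<forall>\<^sub>F x in at_top. sgn (poly p x) = sgn (lead_coeff p)"
proof -
  have pos: "\<forall>\<^sub>F x in at_top. sgn (poly p x) = sgn (lead_coeff p)" if "lead_coeff p > 0" for p :: "real poly"
  proof -
    obtain n where "\<forall>x\<ge>n. lead_coeff p \<le> poly p x" using poly_pinfty_gt_lc \<open>lead_coeff p > 0\<close> by blast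
    then have "\<forall>x\<ge>n. sgn (poly p x) = sgn (lead_coeff p)" using that by (force simp: sgn_if)
    then show ?thesis unfolding eventually_at_top_linorder by blast
  qed
  consider "lead_coeff p > 0" | "lead_coeff p < 0" | "p = 0" by (metis leading_coeff_0_iff linorder_neqE)
  then show ?thesis
  proof cases
    case 2
    then show ?thesis using pos[of "- p"] by (simp add: sgn_minus)
  qed (use pos in auto)
qed

text \<open>Equal coefficient signs give equal degrees, so the behaviour at infinity transfers; it
  replaces the missing separator on unbounded cells.\<close>

lemma (in sign_refinement) lead: "sgn (lead_coeff p) = sgn (lead_coeff p')"
proof -
  have "coeff p i = 0 \<longleftrightarrow> coeff p' i = 0" for i using co[of i] by (metis sgn_0_0 sgn_0)
  then have "degree p = degree p'" unfolding Polynomial.degree_def by simp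
  then show ?thesis using co by simp
qed

lemma ex_right_of:
  fixes Z :: "real set"
  assumes "finite Z"
  shows "\<exists>x>l. \<forall>z\<in>Z. l < z \<longrightarrow> x < z"
  using assms
proof (induction Z)
  case empty
  then show ?case by (simp add: gt_ex)
next
  case (insert a Z)
  then obtain x where x: "l < x" "\<forall>z\<in>Z. l < z \<longrightarrow> x < z" by blast
  show ?case
  proof (cases "l < a")
    case True
    then obtain x' where "l < x'" "x' < min x a" using dense[of l "min x a"] x by auto
    then show ?thesis using x by fastforce
  next
    case False
    then show ?thesis using x by blast
  qed
qed

text \<open>Moving right from \<open>y\<close>, \<open>p\<close> keeps decreasing until the next
  separator, or for ever, because the roots of its derivative are separators. So it is negative at
  that end of the cell, where its sign is known to transfer; a point close to the corresponding end
  serves as \<open>y'\<close>.\<close>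

lemma (in sign_refinement) neg_upto_right:
  assumes neg: "poly p y < 0" and y: "y \<notin> fst ` \<beta>" and dec: "poly (pderiv p) y < 0"
  shows "\<exists>y'. sgn_rel \<beta> y y' \<and> poly p' y' < 0"
proof -
  let ?Z = "{z \<in> fst ` \<beta>. y < z}"
  have decr: "poly p x \<le> poly p y" if "y \<le> x" and nz: "\<And>z. z \<in> fst ` \<beta> \<Longrightarrow> \<not> (y < z \<and> z < x)" for x
  proof (rule ccontr)
    assume less: "\<not> poly p x \<le> poly p y"
    then have "y < x" using that(1) by (cases "x = y") auto
    then obtain c where c: "y < c" "c < x" "poly p x - poly p y = (x - y) * poly (pderiv p) c"
      using poly_MVT by blast
    then have "poly (pderiv p) c > 0" using less \<open>y < x\<close> by (smt (verit) mult_le_0_iff zero_less_mult_iff)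
    then obtain d where "y < d" "d < c" "poly (pderiv p) d = 0" using poly_IVT_pos[OF c(1) dec] by blast
    then show False using crit nz[of d] c by auto
  qed
  have finZ: "finite ?Z" using fin by auto
  show ?thesis
  proof (cases "?Z = {}")
    \<comment> \<open>The cell is unbounded: the negative sign near infinity is carried by the
      leading coefficients.\<close>
    case True
    then have "\<forall>x\<ge>y. poly p x < 0" using decr neg by fastforce
    then have "\<forall>\<^sub>F x in at_top. poly p x < 0" unfolding eventually_at_top_linorder by blast
    with poly_eventually_sgn_at_top[of p] have "\<forall>\<^sub>F x::real in at_top. sgn (lead_coeff p) = -1"
      by eventually_elim simp
    then have "sgn (lead_coeff p') = -1" using lead by simp
    with poly_eventually_sgn_at_top[of p'] have "\<forall>\<^sub>F x in at_top. poly p' x < 0"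
      by (simp add: sgn_if split: if_splits)  (auto elim!: eventually_mono split: if_splits)
    moreover have "\<forall>\<^sub>F x in at_top. \<forall>z'\<in>snd ` \<beta>. z' < x"
      using fin eventually_gt_at_top by (auto intro!: eventually_ball_finite)
    ultimately have "\<forall>\<^sub>F x in at_top. poly p' x < 0 \<and> (\<forall>z'\<in>snd ` \<beta>. z' < x)" by eventually_elim simp
    then obtain y' where y': "poly p' y' < 0" "\<forall>z'\<in>snd ` \<beta>. z' < y'"
      unfolding eventually_at_top_linorder by blast
    have "sgn_rel \<beta> y y'"
    proof (rule sgn_relI)
      fix z z' assume "(z, z') \<in> \<beta>"
      then have "z \<in> fst ` \<beta>" "z' \<in> snd ` \<beta>" by force+
      then show "(y < z \<longleftrightarrow> y' < z') \<and> (z < y \<longleftrightarrow> z' < y')" using True y y'(2) by force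
    qed
    then show ?thesis using y' by blast
  next
    case False
    \<comment> \<open>\<open>u\<close> ends the cell of \<open>y\<close>. Continuity extends the
      negative sign of \<open>p'\<close> at \<open>u'\<close> to the left, into the cell that
      corresponds to that of \<open>y\<close>.\<close>
    define u where "u = Min ?Z"
    have u: "u \<in> fst ` \<beta>" "y < u" "\<And>z. z \<in> fst ` \<beta> \<Longrightarrow> y < z \<Longrightarrow> u \<le> z"
      using Min_in[OF finZ False] Min_le[OF finZ] unfolding u_def by auto
    then obtain u' where u': "(u, u') \<in> \<beta>" by auto
    have "poly p u \<le> poly p y" using decr[of u] u by fastforce
    then have "poly p' u' < 0" using sep[OF u'] neg by (auto simp: sgn_if split: if_splits)
    have "isCont (poly p') u'" by simp
    then have "\<forall>\<^sub>F x in at u'. poly p' x < 0"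
      using \<open>poly p' u' < 0\<close> unfolding isCont_def by (rule order_tendstoD)
    then have 1: "\<forall>\<^sub>F x in at_left u'. poly p' x < 0" by (simp add: eventually_at_split)
    have 2: "\<forall>\<^sub>F x in at_left u'. \<forall>z\<in>snd ` \<beta>. z < u' \<longrightarrow> z < x"
    proof (rule eventually_ball_finite)
      show "finite (snd ` \<beta>)" using fin by simp
      show "\<forall>z\<in>snd ` \<beta>. \<forall>\<^sub>F x in at_left u'. z < u' \<longrightarrow> z < x"
      proof
        fix z
        show "\<forall>\<^sub>F x in at_left u'. z < u' \<longrightarrow> z < x"
          using eventually_at_left_real[of z u'] by (cases "z < u'") (auto elim!: eventually_mono)
      qed
    qed
    have 3: "\<forall>\<^sub>F x in at_left u'. x < u'" by (auto simp: eventually_at_filter)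
    have "\<forall>\<^sub>F x in at_left u'. poly p' x < 0 \<and> (\<forall>z\<in>snd ` \<beta>. z < u' \<longrightarrow> z < x) \<and> x < u'"
      using 1 2 3 by eventually_elim auto
    then obtain y' where y': "poly p' y' < 0" "\<And>z. z \<in> snd ` \<beta> \<Longrightarrow> z < u' \<Longrightarrow> z < y'" "y' < u'"
      using eventually_happens'[OF trivial_limit_at_left_real] by (metis (no_types, lifting))
    have "sgn_rel \<beta> y y'"
    proof (rule sgn_relI)
      fix z z' assume z: "(z, z') \<in> \<beta>"
      then have zz: "z \<in> fst ` \<beta>" "z' \<in> snd ` \<beta>" by force+
      have iff: "u \<le> z \<longleftrightarrow> u' \<le> z'"
        using sgn_rel_cmp[OF sgn_rel_self[OF u'] z] by linarith
      show "(y < z \<longleftrightarrow> y' < z') \<and> (z < y \<longleftrightarrow> z' < y')"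
      proof (cases "u \<le> z")
        case True
        then show ?thesis using iff u y' by auto
      next
        case False
        then have "z < y" using u(3)[OF zz(1)] y zz(1) by force
        moreover have "z' < y'" using False iff y'(2)[OF zz(2)] by simp
        ultimately show ?thesis by auto
      qed
    qed
    then show ?thesis using y' by blast
  qed
qed

text \<open>Off the separators the derivative does not vanish; if it is positive, \<open>p\<close>
  stays negative to the left instead, which reflection reduces to the decreasing case.\<close>

lemma (in sign_refinement) neg_witness:
  assumes neg: "poly p y < 0" and y: "y \<notin> fst ` \<beta>"
  shows "\<exists>y'. sgn_rel \<beta> y y' \<and> poly p' y' < 0"
proof -
  have "poly (pderiv p) y \<noteq> 0" using crit y by blast
  then consider "poly (pderiv p) y < 0" | "poly (pderiv p) y > 0" by linarith
  then show ?thesis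
  proof cases
    case 1
    then show ?thesis using neg_upto_right assms by blast
  next
    case 2
    let ?\<beta> = "(\<lambda>(z, z'). (- z, - z')) ` \<beta>"
    have "\<exists>y'. sgn_rel ?\<beta> (- y) y' \<and> poly (pcompose p' [:0, -1:]) y' < 0"
    proof (rule sign_refinement.neg_upto_right[OF reflect])
      show "- y \<notin> fst ` ?\<beta>" using y by force
    qed (use 2 neg in \<open>simp_all add: pderiv_pcompose poly_pcompose pderiv_pCons\<close>)
    then obtain y' where y': "sgn_rel ?\<beta> (- y) y'" "poly p' (- y') < 0" by (auto simp: poly_pcompose)
    have "sgn_rel \<beta> y (- y')"
    proof (rule sgn_relI)
      fix z z' assume "(z, z') \<in> \<beta>"
      then have "(- z, - z') \<in> ?\<beta>" by force
      from sgn_rel_cmp[OF y'(1) this] show "(y < z \<longleftrightarrow> - y' < z') \<and> (z < y \<longleftrightarrow> z' < - y')" by auto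
    qed
    then show ?thesis using y' by blast
  qed
qed

lemma (in sign_refinement) pos_witness:
  assumes "poly p y > 0" and y: "y \<notin> fst ` \<beta>"
  shows "\<exists>y'. sgn_rel \<beta> y y' \<and> poly p' y' > 0"
  using sign_refinement.neg_witness[OF uminus, of y] assms by simp

text \<open>The mean value theorem gives the sign of the derivative at one inner point; having no
  root inside, the derivative has that sign at \<open>c\<close> too.\<close>

lemma strict_between:
  fixes p :: "real poly"
  assumes "a < b" and nz: "\<And>x. a < x \<Longrightarrow> x < b \<Longrightarrow> poly (pderiv p) x \<noteq> 0" and c: "a < c" "c < b"
  shows "sgn (poly p b - poly p a) = sgn (poly (pderiv p) c)"
proof -
  obtain x where x: "a < x" "x < b" "poly p b - poly p a = (b - a) * poly (pderiv p) x"
    using poly_MVT[OF assms(1)] by blast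
  have "sgn (poly (pderiv p) x) = sgn (poly (pderiv p) c)"
  proof (rule ccontr)
    assume "sgn (poly (pderiv p) x) \<noteq> sgn (poly (pderiv p) c)"
    moreover have "poly (pderiv p) x \<noteq> 0" "poly (pderiv p) c \<noteq> 0" using nz x c by auto
    ultimately have neg: "poly (pderiv p) x * poly (pderiv p) c < 0"
      by (auto simp: sgn_if mult_less_0_iff split: if_splits)
    have "\<exists>w. min x c < w \<and> w < max x c \<and> poly (pderiv p) w = 0"
    proof (cases "x < c")
      case True
      then show ?thesis using poly_IVT[OF True neg] by (auto simp: min_def max_def)
    next
      case False
      then have "c < x" using neg by (cases "c = x") (auto simp: mult_less_0_iff)
      moreover have "poly (pderiv p) c * poly (pderiv p) x < 0" using neg by (simp add: mult.commute)
      ultimately show ?thesis using poly_IVT[of c x "pderiv p"] by (auto simp: min_def max_def)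
    qed
    then obtain w where "min x c < w" "w < max x c" "poly (pderiv p) w = 0" by blast
    moreover have "a < w" "w < b" using calculation x c by auto
    ultimately show False using nz by blast
  qed
  then show ?thesis using x \<open>a < b\<close> by (simp add: sgn_mult)
qed

text \<open>The hard case is a root \<open>y\<close> of \<open>p\<close> inside an open cell. There
  \<open>p\<close> is strictly monotone, so it takes both signs next to \<open>y\<close>; both are
  transferred to the corresponding cell, and \<open>p'\<close> has a root between the two
  images.\<close>

lemma (in sign_refinement) total_sgn:
  "\<exists>y'. sgn_rel \<beta> y y' \<and> sgn (poly p' y') = sgn (poly p y)"
proof (cases "y \<in> fst ` \<beta>")
  case True
  then obtain z' where "(y, z') \<in> \<beta>" by auto
  then show ?thesis using sgn_rel_self sep by force
next
  case y: False
  consider "poly p y < 0" | "poly p y > 0" | "poly p y = 0" by linarith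
  then show ?thesis
  proof cases
    case 1
    then show ?thesis using neg_witness[OF 1 y] by (metis sgn_neg)
  next
    case 2
    then show ?thesis using pos_witness[OF 2 y] by (metis sgn_pos)
  next
    case 3
    have "finite (fst ` \<beta>)" "finite (uminus ` fst ` \<beta>)" using fin by simp_all
    then obtain y2 x1 where y2': "y < y2" "\<forall>z\<in>fst ` \<beta>. y < z \<longrightarrow> y2 < z"
      and x1': "- y < x1" "\<forall>z\<in>uminus ` fst ` \<beta>. - y < z \<longrightarrow> x1 < z"
      using ex_right_of[of "fst ` \<beta>" y] ex_right_of[of "uminus ` fst ` \<beta>" "- y"] by auto
    have y2: "y < y2" "\<And>z. z \<in> fst ` \<beta> \<Longrightarrow> y < z \<Longrightarrow> y2 < z" using y2' by blast+
    have x1: "- y < x1" "\<And>z. z \<in> uminus ` fst ` \<beta> \<Longrightarrow> - y < z \<Longrightarrow> x1 < z" using x1' by blast+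
    \<comment> \<open>Reflecting the separators turns the search for a point just left of
      \<open>y\<close> into one for a point just right of \<open>- y\<close>; so \<open>y1\<close>
      and \<open>y2\<close> enclose \<open>y\<close> within its cell.\<close>
    define y1 where "y1 = - x1"
    have y1: "y1 < y" "\<And>z. z \<in> fst ` \<beta> \<Longrightarrow> z < y \<Longrightarrow> z < y1"
      using x1 unfolding y1_def by force+
    have cell: "z < y1 \<and> z < y \<and> z < y2 \<or> y1 < z \<and> y < z \<and> y2 < z" if "z \<in> fst ` \<beta>" for z
      using y1 y2 y that by (smt (verit))
    have nz: "poly (pderiv p) x \<noteq> 0" if "y1 \<le> x" "x \<le> y2" for x
    proof
      assume "poly (pderiv p) x = 0"
      then have "x \<in> fst ` \<beta>" using crit by blast
      then show False using cell[of x] that by auto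
    qed
    have rel: "sgn_rel \<beta> y w" if "sgn_rel \<beta> y1 w \<or> sgn_rel \<beta> y2 w" for w
    proof (rule sgn_relI)
      fix z z' assume z: "(z, z') \<in> \<beta>"
      then have "z \<in> fst ` \<beta>" by force
      then show "(y < z \<longleftrightarrow> w < z') \<and> (z < y \<longleftrightarrow> z' < w)"
        using cell that sgn_rel_cmp[OF _ z] by (smt (verit))
    qed
    let ?s = "sgn (poly (pderiv p) y)"
    have "?s \<noteq> 0" using nz[of y] y1 y2 by (simp add: sgn_zero_iff)
    obtain c where c: "y1 < c" "c < y" using dense y1(1) by blast
    obtain c2 where c2: "y < c2" "c2 < y2" using dense y2(1) by blast
    have sg: "sgn (poly (pderiv p) x) = ?s" if "y1 \<le> x" "x \<le> y2" for x
    proof (rule sgn_poly_cell[where Z = "fst ` \<beta>"])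
      fix z assume "z \<in> fst ` \<beta>"
      then show "sgn (x - z) = sgn (y - z)" using cell[of z] that by (auto simp: sgn_diff_real)
    qed (use crit in blast)
    have "sgn (poly (pderiv p) c) = ?s" "sgn (poly (pderiv p) c2) = ?s"
      by (rule sg; use c c2 y1(1) y2(1) in linarith)+
    moreover have "sgn (poly p y - poly p y1) = sgn (poly (pderiv p) c)"
      by (rule strict_between[OF y1(1) _ c]) (use nz y2(1) in auto)
    moreover have "sgn (poly p y2 - poly p y) = sgn (poly (pderiv p) c2)"
      by (rule strict_between[OF y2(1) _ c2]) (use nz y1(1) in auto)
    ultimately have "sgn (- poly p y1) = ?s" "sgn (poly p y2) = ?s"
      using 3 by simp_all
    then have "sgn (poly p y1 * poly p y2) = - (?s * ?s)" by (metis sgn_mult sgn_minus minus_mult_left minus_minus)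
    moreover have "?s * ?s = 1" using \<open>?s \<noteq> 0\<close> by (auto simp: sgn_if)
    ultimately have "poly p y1 * poly p y2 < 0"
      by (simp add: sgn_1_neg)
    moreover have "y1 \<notin> fst ` \<beta>" "y2 \<notin> fst ` \<beta>" using cell y1 y2 by blast+
    ultimately obtain w1 w2 where w: "sgn_rel \<beta> y w1" "poly p' w1 < 0" "sgn_rel \<beta> y w2" "poly p' w2 > 0"
      using neg_witness[of y1] neg_witness[of y2] pos_witness[of y1] pos_witness[of y2] rel
      unfolding mult_less_0_iff by blast
    \<comment> \<open>Which of \<open>w1\<close> and \<open>w2\<close> is smaller depends on whether
      \<open>p'\<close> decreases or increases on the cell.\<close>
    have "\<exists>w. min w1 w2 < w \<and> w < max w1 w2 \<and> poly p' w = 0"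
      using poly_IVT_pos[of w1 w2 p'] poly_IVT_neg[of w2 w1 p'] w
      by (cases w1 w2 rule: linorder_cases) (auto simp: min_def max_def)
    then obtain w0 where w0: "min w1 w2 < w0" "w0 < max w1 w2" "poly p' w0 = 0" by blast
    have "sgn_rel \<beta> y w0"
    proof (rule sgn_relI)
      fix z z' assume z: "(z, z') \<in> \<beta>"
      show "(y < z \<longleftrightarrow> w0 < z') \<and> (z < y \<longleftrightarrow> z' < w0)"
        using sgn_rel_cmp[OF w(1) z] sgn_rel_cmp[OF w(3) z] w0(1,2) by linarith
    qed
    then show ?thesis using 3 w0 by auto
  qed
qed


section \<open>Extending a pairing by the roots of a new polynomial\<close>

definition (in sign_refinement) ext where
  "ext = \<beta> \<union> {(z, z'). sgn_rel \<beta> z z' \<and> poly p z = 0 \<and> poly p' z' = 0}"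

text \<open>A separator in \<open>[y, z]\<close> orders the points on both lines. Otherwise
  \<open>y\<close> and \<open>z\<close> share an open cell, where \<open>p\<close> is strictly
  monotone with at most one root; the side of the root on which \<open>y\<close> lies is read off
  from the signs of \<open>p\<close> and its derivative, and these agree on both lines.\<close>

lemma (in sign_refinement) root_less_transfer:
  assumes "sgn_rel \<beta> z z'" "poly p z = 0" "poly p' z' = 0"
    and r: "sgn_rel \<beta> y y'" "sgn (poly p' y') = sgn (poly p y)"
    and der: "\<And>y y'. sgn_rel \<beta> y y' \<Longrightarrow> sgn (poly (pderiv p) y) = sgn (poly (pderiv p') y')"
    and lt: "y < z"
  shows "y' < z'"
proof (cases "\<exists>w\<in>fst ` \<beta>. y \<le> w \<and> w \<le> z")
  case True
  then obtain w w' where w: "(w, w') \<in> \<beta>" "y \<le> w" "w \<le> z" by auto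
  then have "y' \<le> w'" "w' \<le> z'" "y' \<noteq> w' \<or> w' \<noteq> z'"
    using sgn_rel_cmp[OF r(1) w(1)] sgn_rel_cmp[OF assms(1) w(1)] lt by linarith+
  then show ?thesis by linarith
next
  case False
  have no': "\<not> (min y' z' \<le> w' \<and> w' \<le> max y' z')" if w': "w' \<in> snd ` \<beta>" for w'
  proof -
    obtain w where w: "(w, w') \<in> \<beta>" using w' by auto
    then have "w \<in> fst ` \<beta>" by force
    then have "w < y \<or> z < w" using False by (meson not_le)
    then show ?thesis using sgn_rel_cmp[OF r(1) w] sgn_rel_cmp[OF assms(1) w] lt by auto
  qed
  obtain c where c: "y < c" "c < z" using dense lt by blast
  have nz: "poly (pderiv p) x \<noteq> 0" if "y \<le> x" "x \<le> z" for x
    using False subsetD[OF crit, of x] that by auto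
  have nz': "poly (pderiv p') x \<noteq> 0" if "min y' z' \<le> x" "x \<le> max y' z'" for x
    using no'[of x] subsetD[OF crit', of x] that by auto
  have s: "sgn (- poly p y) = sgn (poly (pderiv p) z)"
  proof -
    have "sgn (poly p z - poly p y) = sgn (poly (pderiv p) c)"
      by (rule strict_between[OF lt _ c]) (use nz in auto)
    moreover have "sgn (poly (pderiv p) c) = sgn (poly (pderiv p) z)"
    proof (rule sgn_poly_cell[where Z = "{x. poly (pderiv p) x = 0}"])
      fix x assume "x \<in> {x. poly (pderiv p) x = 0}"
      then have "x < y \<or> z < x" using nz[of x] not_le by blast
      then show "sgn (c - x) = sgn (z - x)" using c by (auto simp: sgn_diff_real)
    qed simp
    ultimately show ?thesis using assms(2) by simp
  qed
  show ?thesis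
  proof (rule ccontr)
    assume "\<not> y' < z'"
    moreover have "y' \<noteq> z'"
    proof
      assume "y' = z'"
      then have "sgn (poly p y) = 0" using r(2) assms(3) by simp
      then have "sgn (poly (pderiv p) z) = 0" using s by (simp add: sgn_zero_iff)
      then show False using nz[of z] lt by (simp add: sgn_zero_iff)
    qed
    ultimately have gt: "z' < y'" by simp
    obtain c where c: "z' < c" "c < y'" using dense gt by blast
    have "sgn (poly p' y' - poly p' z') = sgn (poly (pderiv p') c)"
      by (rule strict_between[OF gt _ c]) (use nz' gt in auto)
    moreover have "sgn (poly (pderiv p') c) = sgn (poly (pderiv p') z')"
    proof (rule sgn_poly_cell[where Z = "{x. poly (pderiv p') x = 0}"])
      fix x assume "x \<in> {x. poly (pderiv p') x = 0}"
      then have "x < z' \<or> y' < x" using nz'[of x] gt by force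
      then show "sgn (c - x) = sgn (z' - x)" using c by (auto simp: sgn_diff_real)
    qed simp
    ultimately have "sgn (poly p y) = sgn (poly (pderiv p) z)"
      using assms(3) r(2) der[OF assms(1)] by simp
    then have "sgn (poly (pderiv p) z) = 0" using s by (simp add: sgn_minus)
    then show False using nz[of z] lt by (simp add: sgn_zero_iff)
  qed
qed

text \<open>Reflection adds the case \<open>z < y\<close>, and the converse refinement the reverse
  implications; together they fix all three signs.\<close>

lemma (in sign_refinement) sgn_diff_root_eq:
  assumes "sgn_rel \<beta> z z'" "poly p z = 0" "poly p' z' = 0"
    and r: "sgn_rel \<beta> y y'" "sgn (poly p' y') = sgn (poly p y)"
    and der: "\<And>y y'. sgn_rel \<beta> y y' \<Longrightarrow> sgn (poly (pderiv p) y) = sgn (poly (pderiv p') y')"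
  shows "sgn (y - z) = sgn (y' - z')"
proof -
  have d: "poly (pderiv (pcompose q [:0, -1:])) z = - poly (pderiv q) (- z)" for q :: "real poly" and z
    by (simp add: pderiv_pcompose poly_pcompose pderiv_pCons)
  have "y < z \<Longrightarrow> y' < z'" using root_less_transfer[OF assms] .
  moreover have "- y < - z \<Longrightarrow> - y' < - z'"
    by (rule sign_refinement.root_less_transfer[OF reflect])
      (use assms in \<open>simp_all only: sgn_rel_reflect d poly_pcompose sgn_minus der minus_minus poly_pCons poly_0, simp_all\<close>)
  moreover interpret c: sign_refinement "\<beta>\<inverse>" p' p by (rule converse)
  have "y' < z' \<Longrightarrow> y < z"
    by (rule c.root_less_transfer) (use assms der in \<open>simp_all add: sgn_rel_converse\<close>)
  moreover have "- y' < - z' \<Longrightarrow> - y < - z"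
    by (rule sign_refinement.root_less_transfer[OF c.reflect])
      (use assms in \<open>simp_all only: sgn_rel_reflect sgn_rel_converse d poly_pcompose sgn_minus der minus_minus poly_pCons poly_0, simp_all\<close>)
  ultimately have "y < z \<longleftrightarrow> y' < z'" "z < y \<longleftrightarrow> z' < y'" by auto
  then show ?thesis by (cases "y < z"; cases "z < y") (simp_all add: sgn_diff_real)
qed

text \<open>The new separators are those of \<open>ext\<close>. A partner in the same old cell with
  the same sign of \<open>p\<close> automatically lies in the same new cell, which is how totality
  survives the refinement. The sign hypothesis at old separators is what pseudo-remainders will
  supply.\<close>

lemma matches_insert:
  assumes M: "matches \<beta> G" and pG: "(pderiv p, pderiv p') \<in> G"
    and sep: "\<And>z z'. (z, z') \<in> \<beta> \<Longrightarrow> sgn (poly p z) = sgn (poly p' z')"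
    and co: "\<And>i. sgn (coeff p i) = sgn (coeff p' i)"
  shows "\<exists>\<beta>'. matches \<beta>' (insert (p, p') G)"
proof -
  have fin: "finite \<beta>" and dom: "fst ` \<beta> = roots_of (fst ` G)" and ran: "snd ` \<beta> = roots_of (snd ` G)"
    and T1: "\<And>y. \<exists>y'. sgn_rel \<beta> y y'" and T2: "\<And>y'. \<exists>y. sgn_rel \<beta> y y'"
    and S: "\<And>y y' q q'. sgn_rel \<beta> y y' \<Longrightarrow> (q, q') \<in> G \<Longrightarrow> sgn (poly q y) = sgn (poly q' y')"
    using M unfolding matches_def by blast+
  have co0: "coeff p i = 0 \<longleftrightarrow> coeff p' i = 0" for i using co[of i] by (metis sgn_zero_iff)
  have deg: "degree p = degree p'" unfolding Polynomial.degree_def by (simp add: co0)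
  have ins: "roots_of (insert q Q) = (if q = 0 then {} else {z. poly q z = 0}) \<union> roots_of Q" for q Q
    unfolding roots_of_def by auto
  show ?thesis
  \<comment> \<open>A constant \<open>p\<close> has zero derivative, whose roots
    \<open>roots_of\<close> does not record, so the refinement locale would not apply; but it brings
    no new separators.\<close>
  proof (cases "degree p = 0")
    case True
    then obtain c where c: "p = [:c:]" by (rule degree_eq_zeroE)
    obtain c' where c': "p' = [:c':]" using True deg by (metis degree_eq_zeroE)
    have "sgn c = sgn c'" using co[of 0] by (simp add: c c')
    moreover have "roots_of (insert p Q) = roots_of Q" "roots_of (insert p' Q) = roots_of Q" for Q
      unfolding ins by (auto simp: c c')
    ultimately have "matches \<beta> (insert (p, p') G)"
      using M unfolding matches_def by (auto simp: c c')
    then show ?thesis by blast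
  next
    case False
    then have d0: "pderiv p \<noteq> 0" "pderiv p' \<noteq> 0" using deg by (auto simp: pderiv_eq_0_iff)
    then have p0: "p \<noteq> 0" "p' \<noteq> 0" by auto
    interpret sign_refinement \<beta> p p'
    proof
      show "{z. poly (pderiv p) z = 0} \<subseteq> fst ` \<beta>" "{z. poly (pderiv p') z = 0} \<subseteq> snd ` \<beta>"
        using d0 pG unfolding dom ran subset_eq mem_Collect_eq Ball_def roots_of_image by blast+
    qed (use fin T1 T2 sep co in auto)
    have rr: "sgn_rel ext y y'" if r: "sgn_rel \<beta> y y'" "sgn (poly p' y') = sgn (poly p y)" for y y'
    proof -
      have "sgn (y - z) = sgn (y' - z')" if "(z, z') \<in> ext" for z z'
        using that sgn_relD[OF r(1)] sgn_diff_root_eq[OF _ _ _ r S[OF _ pG]] unfolding ext_def by blast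
      then show ?thesis unfolding sgn_rel_def by blast
    qed
    have le: "sgn_rel \<beta> y y'" if "sgn_rel ext y y'" for y y'
      using that unfolding sgn_rel_def ext_def by blast
    have tot: "\<exists>y'. sgn_rel ext y y' \<and> sgn (poly p' y') = sgn (poly p y)" for y
      using total_sgn rr by blast
    have tot': "\<exists>y. sgn_rel ext y y' \<and> sgn (poly p' y') = sgn (poly p y)" for y'
      using sign_refinement.total_sgn[OF converse, of y'] rr by (metis sgn_rel_converse)
    have "finite ({z. poly p z = 0} \<times> {z. poly p' z = 0})"
      by (intro finite_cartesian_product poly_roots_finite p0)
    then have "finite ext" unfolding ext_def using fin by (auto intro: rev_finite_subset)
    moreover have domx: "fst ` ext = fst ` \<beta> \<union> {z. poly p z = 0}"
    proof -
      have "z \<in> fst ` ext" if "poly p z = 0" for z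
      proof -
        obtain z' where "sgn_rel \<beta> z z'" "sgn (poly p' z') = sgn (poly p z)" using total_sgn by blast
        then have "(z, z') \<in> ext" using that unfolding ext_def by (simp add: sgn_zero_iff)
        then show ?thesis by (rule rev_image_eqI) simp
      qed
      then show ?thesis unfolding ext_def by (auto simp: image_Un)
    qed
    moreover have ranx: "snd ` ext = snd ` \<beta> \<union> {z. poly p' z = 0}"
    proof -
      have "z' \<in> snd ` ext" if "poly p' z' = 0" for z'
      proof -
        obtain z where "sgn_rel \<beta> z z'" "sgn (poly p' z') = sgn (poly p z)"
          using tot' le by blast
        then have "(z, z') \<in> ext" using that unfolding ext_def by (simp add: sgn_zero_iff)
        then show ?thesis by (rule rev_image_eqI) simp
      qed
      then show ?thesis unfolding ext_def by (auto simp: image_Un)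
    qed
    \<comment> \<open>All roots of \<open>p'\<close> are now separators, so its sign is constant on
      each new cell and may be read at the partner \<open>y1\<close>.\<close>
    moreover have Sp: "sgn (poly p y) = sgn (poly p' y')" if r: "sgn_rel ext y y'" for y y'
    proof -
      obtain y1 where y1: "sgn_rel ext y y1" "sgn (poly p' y1) = sgn (poly p y)" using tot by blast
      have "sgn (poly p' y1) = sgn (poly p' y')"
      proof (rule sgn_poly_cell[where Z = "snd ` ext"])
        fix z' assume "z' \<in> snd ` ext"
        then obtain z where z: "(z, z') \<in> ext" by auto
        show "sgn (y1 - z') = sgn (y' - z')" using sgn_relD[OF r z] sgn_relD[OF y1(1) z] by simp
      qed (simp add: ranx)
      then show ?thesis using y1 by simp
    qed
    ultimately have "matches ext (insert (p, p') G)"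
      unfolding matches_def
    proof (intro conjI allI impI)
      show "fst ` ext = roots_of (fst ` insert (p, p') G)"
        unfolding domx dom image_insert fst_conv ins using p0(1) by (simp add: Un_commute)
      show "snd ` ext = roots_of (snd ` insert (p, p') G)"
        unfolding ranx ran image_insert snd_conv ins using p0(2) by (simp add: Un_commute)
      show "\<exists>y'. sgn_rel ext y y'" for y using tot by blast
      show "\<exists>y. sgn_rel ext y y'" for y' using tot' by blast
      show "sgn (poly q y) = sgn (poly q' y')"
        if "sgn_rel ext y y'" "(q, q') \<in> insert (p, p') G" for y y' q q'
        using that Sp S[OF le[OF that(1)]] by blast
    qed
    then show ?thesis by blast
  qed
qed

section \<open>Quantifier elimination\<close>

type_synonym env = "nat \<Rightarrow> real"

text \<open>Polynomials are taken as functions, so that substitution and singling out one variable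
  are structural inductions without normal forms.\<close>

inductive_set polyfuns :: "(env \<Rightarrow> real) set" where
  const: "(\<lambda>_. c) \<in> polyfuns"
| var: "(\<lambda>e. e i) \<in> polyfuns"
| add: "f \<in> polyfuns \<Longrightarrow> g \<in> polyfuns \<Longrightarrow> (\<lambda>e. f e + g e) \<in> polyfuns"
| mult: "f \<in> polyfuns \<Longrightarrow> g \<in> polyfuns \<Longrightarrow> (\<lambda>e. f e * g e) \<in> polyfuns"

lemma polyfuns_uminus: "f \<in> polyfuns \<Longrightarrow> (\<lambda>e. - f e) \<in> polyfuns"
  using polyfuns.mult[OF polyfuns.const[of "-1"]] by simp

lemma polyfuns_diff: "f \<in> polyfuns \<Longrightarrow> g \<in> polyfuns \<Longrightarrow> (\<lambda>e. f e - g e) \<in> polyfuns"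
  using polyfuns.add[OF _ polyfuns_uminus] by simp

lemma polyfuns_sum: "(\<And>i. i \<in> I \<Longrightarrow> f i \<in> polyfuns) \<Longrightarrow> (\<lambda>e. \<Sum>i\<in>I. f i e) \<in> polyfuns"
  by (induction I rule: infinite_finite_induct) (auto intro: polyfuns.intros)

lemma polyfuns_power: "f \<in> polyfuns \<Longrightarrow> (\<lambda>e. f e ^ k) \<in> polyfuns"
  by (induction k) (auto intro: polyfuns.intros)

lemmas polyfuns_intros = polyfuns.intros polyfuns_uminus polyfuns_diff polyfuns_sum polyfuns_power

text \<open>\<open>n\<close> bounds the number of coefficients for all parameters at once, so
  \<open>n = 0\<close> means zero; the actual degree of \<open>P e\<close> may drop with
  \<open>e\<close>.\<close>

definition poly_family :: "nat \<Rightarrow> (env \<Rightarrow> real poly) \<Rightarrow> bool" where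
  "poly_family n P \<longleftrightarrow> (\<forall>i. (\<lambda>e. coeff (P e) i) \<in> polyfuns) \<and> (\<forall>e. \<forall>i\<ge>n. coeff (P e) i = 0)"

lemma poly_family_coeff: "poly_family n P \<Longrightarrow> (\<lambda>e. coeff (P e) i) \<in> polyfuns"
  unfolding poly_family_def by blast

lemma poly_family_mono: "poly_family n P \<Longrightarrow> n \<le> m \<Longrightarrow> poly_family m P"
  unfolding poly_family_def by auto

lemma poly_family_pderiv:
  assumes "poly_family n P"
  shows "poly_family (n - 1) (\<lambda>e. pderiv (P e))"
proof -
  have "(\<lambda>e. coeff (pderiv (P e)) i) \<in> polyfuns" for i
    unfolding coeff_pderiv by (intro polyfuns_intros poly_family_coeff[OF assms])
  then show ?thesis using assms unfolding poly_family_def coeff_pderiv by auto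
qed

lemma poly_family_cutoff:
  assumes "poly_family n P"
  shows "poly_family k (\<lambda>e. poly_cutoff k (P e))"
proof -
  have "(\<lambda>e. coeff (poly_cutoff k (P e)) i) \<in> polyfuns" for i
    using poly_family_coeff[OF assms] polyfuns.const unfolding coeff_poly_cutoff by (cases "i < k") simp_all
  then show ?thesis unfolding poly_family_def by (simp add: coeff_poly_cutoff)
qed

text \<open>Multiplying by coefficient \<open>k\<close> of \<open>Q\<close> instead of dividing by
  it keeps all coefficients polynomial in the parameters. The subtracted multiples of
  \<open>Q\<close> vanish at its roots, so the quotient is not recorded.\<close>

lemma pseudo_remainder:
  assumes "poly_family n P" "poly_family (Suc k) Q"
  shows "\<exists>S. poly_family k S \<and> (\<exists>N. \<forall>e y. poly (Q e) y = 0 \<longrightarrow> coeff (Q e) k ^ N * poly (P e) y = poly (S e) y)"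
  using assms(1)
proof (induction n arbitrary: P)
  case 0
  have "poly_family k P" by (rule poly_family_mono[OF 0]) simp
  then show ?case by (intro exI[of _ P] conjI exI[of _ 0]) auto
next
  case (Suc n)
  show ?case
  proof (cases "Suc n \<le> k")
    case True
    then have "poly_family k P" using poly_family_mono Suc.prems by blast
    then show ?thesis by (intro exI[of _ P] conjI exI[of _ 0]) auto
  next
    case False
    \<comment> \<open>The shift by \<open>n - k\<close> moves coefficient \<open>k\<close> of
      \<open>Q\<close> to position \<open>n\<close>, where both products cancel.\<close>
    define P1 where "P1 = (\<lambda>e. Polynomial.smult (coeff (Q e) k) (P e) - monom (coeff (P e) n) (n - k) * Q e)"
    have c: "coeff (P1 e) i = coeff (Q e) k * coeff (P e) i -
        (if i < n - k then 0 else coeff (P e) n * coeff (Q e) (i - (n - k)))" for e i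
      unfolding P1_def by (simp add: coeff_monom_mult)
    have "(\<lambda>e. coeff (P1 e) i) \<in> polyfuns" for i
      unfolding c
      by (cases "i < n - k") (auto intro!: polyfuns_intros poly_family_coeff[OF Suc.prems] poly_family_coeff[OF assms(2)])
    moreover have "coeff (P1 e) i = 0" if "i \<ge> n" for e i
    proof (cases "i = n")
      case True
      then show ?thesis using False unfolding c by simp
    next
      case i: False
      then have "coeff (P e) i = 0" "coeff (Q e) (i - (n - k)) = 0"
        using Suc.prems assms(2) False that unfolding poly_family_def by simp_all
      then show ?thesis unfolding c by simp
    qed
    ultimately have "poly_family n P1" unfolding poly_family_def by blast
    then obtain S N where S: "poly_family k S"
      "\<And>e y. poly (Q e) y = 0 \<Longrightarrow> coeff (Q e) k ^ N * poly (P1 e) y = poly (S e) y"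
      using Suc.IH by blast
    have "coeff (Q e) k ^ Suc N * poly (P e) y = poly (S e) y" if "poly (Q e) y = 0" for e y
      using S(2)[OF that] that unfolding P1_def by (simp add: algebra_simps)
    then show ?thesis using S(1) by blast
  qed
qed

section \<open>Root arrangements decided by finitely many parameter signs\<close>

definition same_signs :: "(env \<Rightarrow> real) set \<Rightarrow> env \<Rightarrow> env \<Rightarrow> bool" where
  "same_signs D e e' \<longleftrightarrow> (\<forall>c\<in>D. sgn (c e) = sgn (c e'))"

definition tame :: "(env \<Rightarrow> real poly) set \<Rightarrow> bool" where
  "tame \<P> \<longleftrightarrow> (\<exists>D. finite D \<and> D \<subseteq> polyfuns \<and>
     (\<forall>e e'. same_signs D e e' \<longrightarrow> (\<exists>\<beta>. matches \<beta> ((\<lambda>P. (P e, P e')) ` \<P>))))"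

lemma matchesD: "matches \<beta> G \<Longrightarrow> sgn_rel \<beta> y y' \<Longrightarrow> (q, q') \<in> G \<Longrightarrow> sgn (poly q y) = sgn (poly q' y')"
  unfolding matches_def by simp

lemma matches_total: "matches \<beta> G \<Longrightarrow> \<exists>y'. sgn_rel \<beta> y y'"
  unfolding matches_def by simp

lemma tame_subset: "tame \<P> \<Longrightarrow> \<Q> \<subseteq> \<P> \<Longrightarrow> tame \<Q>"
  unfolding tame_def by (meson image_mono matches_subset)

text \<open>The Cohen--Hoermander step: at a root of \<open>Q\<close> the sign of \<open>P\<close> is that of its pseudo-remainder by the truncation
  of \<open>Q\<close> at its actual degree.\<close>

lemma tame_insert:
  assumes n: "poly_family n P" and \<Q>: "finite \<Q>" "\<And>Q. Q \<in> \<Q> \<Longrightarrow> poly_family (w Q) Q"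
    and pd: "(\<lambda>e. pderiv (P e)) \<in> \<Q>"
    and rem: "\<And>Q k. Q \<in> \<Q> \<Longrightarrow> k < w Q \<Longrightarrow> poly_family k (S Q k) \<and>
      (\<exists>N. \<forall>e y. poly (poly_cutoff (Suc k) (Q e)) y = 0 \<longrightarrow>
         coeff (Q e) k ^ N * poly (P e) y = poly (S Q k e) y)"
    and t: "tame (\<Q> \<union> {S Q k | Q k. Q \<in> \<Q> \<and> k < w Q})"
  shows "tame (insert P \<Q>)"
proof -
  obtain D0 where D0: "finite D0" "D0 \<subseteq> polyfuns"
    "\<And>e e'. same_signs D0 e e' \<Longrightarrow>
      \<exists>\<beta>. matches \<beta> ((\<lambda>P. (P e, P e')) ` (\<Q> \<union> {S Q k | Q k. Q \<in> \<Q> \<and> k < w Q}))"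
    using t unfolding tame_def by blast
  \<comment> \<open>Coefficient signs of \<open>P\<close> feed \<open>matches_insert\<close>; those
    of each \<open>Q\<close> force equal degrees at \<open>e\<close> and \<open>e'\<close>.\<close>
  define DP where "DP = (\<lambda>i. \<lambda>e. coeff (P e) i) ` {..<n}"
  define DQ where "DQ = (\<Union>Q\<in>\<Q>. (\<lambda>i. \<lambda>e. coeff (Q e) i) ` {..<w Q})"
  have D: "finite (D0 \<union> DP \<union> DQ)" "D0 \<union> DP \<union> DQ \<subseteq> polyfuns"
    using D0 \<Q> poly_family_coeff[OF n] poly_family_coeff[OF \<Q>(2)] unfolding DP_def DQ_def by auto
  have M: "\<exists>\<beta>. matches \<beta> ((\<lambda>P. (P e, P e')) ` insert P \<Q>)" if s: "same_signs (D0 \<union> DP \<union> DQ) e e'" for e e'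
  proof -
    let ?g = "\<lambda>P. (P e, P e')"
    have "same_signs D0 e e'" using s unfolding same_signs_def by blast
    then obtain \<beta>1 where b1: "matches \<beta>1 (?g ` (\<Q> \<union> {S Q k | Q k. Q \<in> \<Q> \<and> k < w Q}))"
      using D0(3) by blast
    \<comment> \<open>At the roots of the remainders the sign of \<open>P\<close> is not controlled,
      so only the roots of the \<open>Q\<close> are kept as separators. The larger
      \<open>\<beta>1\<close> is still used to transfer the signs of the remainders.\<close>
    then obtain \<beta> where b: "\<beta> \<subseteq> \<beta>1" "matches \<beta> (?g ` \<Q>)"
      using matches_subset[OF b1, of "?g ` \<Q>"] by blast
    have co: "sgn (coeff (P e) i) = sgn (coeff (P e') i)" for i
    proof (cases "i < n")
      case True
      then have "(\<lambda>e. coeff (P e) i) \<in> D0 \<union> DP \<union> DQ" unfolding DP_def by blast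
      from bspec[OF s[unfolded same_signs_def] this] show ?thesis .
    next
      case False
      then show ?thesis using n unfolding poly_family_def by simp
    qed
    have coQ: "sgn (coeff (Q e) i) = sgn (coeff (Q e') i)" if "Q \<in> \<Q>" for Q i
    proof (cases "i < w Q")
      case True
      then have "(\<lambda>e. coeff (Q e) i) \<in> D0 \<union> DP \<union> DQ" unfolding DQ_def using that by blast
      from bspec[OF s[unfolded same_signs_def] this] show ?thesis .
    next
      case False
      then show ?thesis using \<Q>(2)[OF that] unfolding poly_family_def by simp
    qed
    have sep: "sgn (poly (P e) z) = sgn (poly (P e') z')" if z: "(z, z') \<in> \<beta>" for z z'
    proof -
      have rel: "sgn_rel \<beta>1 z z'" using matches_self[OF b1] z b(1) by blast
      have "z \<in> fst ` \<beta>" using z by force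
      then have "z \<in> roots_of (fst ` ?g ` \<Q>)" using b(2) unfolding matches_def by blast
      then obtain Q where Q: "Q \<in> \<Q>" "Q e \<noteq> 0" "poly (Q e) z = 0"
        unfolding roots_of_def image_image fst_conv by blast
      let ?k = "degree (Q e)"
      have S1: "sgn (poly q z) = sgn (poly q' z')"
        if "(q, q') \<in> ?g ` (\<Q> \<union> {S Q k | Q k. Q \<in> \<Q> \<and> k < w Q})" for q q'
        using b1 rel that unfolding matches_def by blast
      have "sgn (poly (Q e) z) = sgn (poly (Q e') z')" by (rule S1) (use Q in auto)
      then have Q0: "poly (Q e') z' = 0" using Q(3) by (simp add: sgn_zero_iff)
      have "coeff (Q e) i = 0 \<longleftrightarrow> coeff (Q e') i = 0" for i
        using coQ[OF Q(1), of i] by (metis sgn_zero_iff)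
      then have deg: "degree (Q e') = ?k" unfolding Polynomial.degree_def by simp
      have "coeff (Q e) ?k \<noteq> 0" using Q(2) by simp
      then have k: "?k < w Q" using \<Q>(2)[OF Q(1)] unfolding poly_family_def by (meson not_le)
      \<comment> \<open>Truncation at the actual degree is the identity for both parameters; this
        selects the remainder whose leading factor is nonzero and can be cancelled.\<close>
      have cut: "poly_cutoff (Suc ?k) (Q e) = Q e" "poly_cutoff (Suc ?k) (Q e') = Q e'"
        using deg by (auto simp: poly_eq_iff coeff_poly_cutoff coeff_eq_0)
      obtain N where N: "\<And>e y. poly (poly_cutoff (Suc ?k) (Q e)) y = 0 \<Longrightarrow>
         coeff (Q e) ?k ^ N * poly (P e) y = poly (S Q ?k e) y"
        using rem[OF Q(1) k] by blast
      have "sgn (poly (S Q ?k e) z) = sgn (poly (S Q ?k e') z')"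
        by (rule S1) (use Q k in blast)
      moreover have "coeff (Q e) ?k ^ N * poly (P e) z = poly (S Q ?k e) z"
        "coeff (Q e') ?k ^ N * poly (P e') z' = poly (S Q ?k e') z'"
        using N[of e z] N[of e' z'] Q Q0 cut by simp_all
      ultimately have "sgn (coeff (Q e) ?k ^ N * poly (P e) z) = sgn (coeff (Q e') ?k ^ N * poly (P e') z')"
        by simp
      then have "sgn (coeff (Q e) ?k) ^ N * sgn (poly (P e) z) = sgn (coeff (Q e) ?k) ^ N * sgn (poly (P e') z')"
        by (simp add: sgn_mult coQ[OF Q(1)])
      moreover have "sgn (coeff (Q e) ?k) ^ N \<noteq> 0" using Q(2) by (simp add: sgn_zero_iff)
      ultimately show ?thesis by (metis mult_left_cancel)
    qed
    have "\<exists>\<beta>'. matches \<beta>' (insert (P e, P e') (?g ` \<Q>))"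
      by (rule matches_insert[OF b(2) imageI[OF pd] sep co])
    then show ?thesis by simp
  qed
  show ?thesis
    unfolding tame_def by (intro exI[of _ "D0 \<union> DP \<union> DQ"] conjI D allI impI M)
qed

text \<open>The family grows in each step, so the induction is on the multiset of degree bounds: one
  occurrence of the maximum \<open>n\<close> is traded for finitely many smaller bounds. Lists of
  pairs record the bounds with their multiplicities.\<close>

lemma tame_finite:
  assumes "finite \<P>" "\<And>P. P \<in> \<P> \<Longrightarrow> \<exists>n. poly_family n P"
  shows "tame \<P>"
proof -
  have main: "tame (snd ` set xs)" if "\<forall>(n, P)\<in>set xs. poly_family n P" for xs :: "(nat \<times> (env \<Rightarrow> real poly)) list"
    using that
  proof (induction "mset (map fst xs)" arbitrary: xs rule: wfp_induct_rule[OF wfp_less_multiset[OF wfp_on_less]])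
    case 1
    show ?case
    proof (cases "\<forall>x\<in>set xs. fst x = 0")
      \<comment> \<open>Bound 0 forces the zero polynomial, so no separators arise.\<close>
      case True
      have Z: "R e = 0" if "R \<in> snd ` set xs" for R e
      proof -
        obtain k where k: "(k, R) \<in> set xs" using \<open>R \<in> snd ` set xs\<close> by auto
        then have "k = 0" "poly_family k R" using True 1(2) by auto
        then show ?thesis unfolding poly_family_def by (simp add: poly_eq_iff)
      qed
      have M: "\<exists>\<beta>. matches \<beta> ((\<lambda>P. (P e, P e')) ` snd ` set xs)" for e e'
      proof -
        have "q = (0, 0)" if q: "q \<in> (\<lambda>P. (P e, P e')) ` snd ` set xs" for q
        proof -
          obtain R where "R \<in> snd ` set xs" "q = (R e, R e')" using q by blast
          then show ?thesis using Z by simp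
        qed
        then have sub: "(\<lambda>P. (P e, P e')) ` snd ` set xs \<subseteq> {(0, 0)}" by blast
        have "matches {} {(0, 0)}" unfolding matches_def roots_of_def sgn_rel_def by simp
        then show ?thesis using matches_subset[OF _ sub] by blast
      qed
      show ?thesis
        unfolding tame_def
      proof (rule exI[of _ "{}"], intro conjI allI impI)
        show "\<exists>\<beta>. matches \<beta> ((\<lambda>P. (P e, P e')) ` snd ` set xs)" for e e' using M by blast
      qed simp_all
    next
      case False
      then have ne: "xs \<noteq> []" by auto
      define n where "n = Max (fst ` set xs)"
      have "n \<in> fst ` set xs" using ne unfolding n_def by (intro Max_in) auto
      then obtain P where P: "(n, P) \<in> set xs" by auto
      have max: "fst x \<le> n" if "x \<in> set xs" for x using that unfolding n_def by simp
      obtain x where "x \<in> set xs" "fst x \<noteq> 0" using False by blast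
      then have "n > 0" using max[of x] by simp
      have famP: "poly_family n P" using 1(2) P by blast
      define xs' where "xs' = remove1 (n, P) xs"
      have ms: "mset xs = add_mset (n, P) (mset xs')" unfolding xs'_def using P by simp
      then have set: "set xs = insert (n, P) (set xs')" by (metis set_mset_add_mset_insert set_mset_mset)
      define ys where "ys = (n - 1, \<lambda>e. pderiv (P e)) # xs'"
      define S where "S Q k = (SOME S. poly_family k S \<and>
         (\<exists>N. \<forall>e y. poly (poly_cutoff (Suc k) (Q e)) y = 0 \<longrightarrow>
         coeff (Q e) k ^ N * poly (P e) y = poly (S e) y))" for Q k
      have S: "poly_family k (S Q k) \<and>
         (\<exists>N. \<forall>e y. poly (poly_cutoff (Suc k) (Q e)) y = 0 \<longrightarrow>
         coeff (Q e) k ^ N * poly (P e) y = poly (S Q k e) y)" if "poly_family m Q" for m Q k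
        unfolding S_def
        using pseudo_remainder[OF famP poly_family_cutoff[OF that], of k]
        unfolding coeff_poly_cutoff if_P[OF lessI] by (rule someI_ex)
      \<comment> \<open>Every bound \<open>m\<close> is at most \<open>n\<close>, so each remainder
        has a bound \<open>k < m \<le> n\<close>, as the multiset descent requires.\<close>
      define rs where "rs = concat (map (\<lambda>(m, Q). map (\<lambda>k. (k, S Q k)) [0..<m]) ys)"
      have ysfam: "poly_family m Q" "m \<le> n" if mQ: "(m, Q) \<in> set ys" for m Q
      proof -
        have "(m, Q) = (n - 1, \<lambda>e. pderiv (P e)) \<or> (m, Q) \<in> set xs"
          using mQ set unfolding ys_def by auto
        then have "poly_family m Q \<and> m \<le> n"
        proof (elim disjE)
          assume "(m, Q) = (n - 1, \<lambda>e. pderiv (P e))"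
          then show ?thesis using poly_family_pderiv[OF famP] by simp
        next
          assume mem: "(m, Q) \<in> set xs"
          show ?thesis using bspec[OF 1(2) mem] max[OF mem] by simp
        qed
        then show "poly_family m Q" "m \<le> n" by blast+
      qed
      have rsfam: "poly_family k R" "k < n" if kR: "(k, R) \<in> set rs" for k R
      proof -
        obtain m Q where "(m, Q) \<in> set ys" "k < m" "R = S Q k"
          using kR unfolding rs_def by auto
        then show "poly_family k R" "k < n" using ysfam S by fastforce+
      qed
      have "mset (map fst (ys @ rs)) < mset (map fst xs)"
      proof -
        have "mset (map fst xs) = mset (map fst xs') + {#n#}" using ms by simp
        moreover have "mset (map fst (ys @ rs)) = mset (map fst xs') + add_mset (n - 1) (mset (map fst rs))"
          unfolding ys_def by simp
        moreover have "\<forall>k\<in>#add_mset (n - 1) (mset (map fst rs)). k < n"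
          using \<open>n > 0\<close> rsfam by auto
        ultimately show ?thesis unfolding less_multiset_def
          by (metis (no_types, lifting) add_mset_not_empty empty_iff insert_iff one_step_implies_multp set_mset_add_mset_insert set_mset_empty)
      qed
      moreover have "\<forall>(n, P)\<in>set (ys @ rs). poly_family n P" using ysfam rsfam by auto
      ultimately have tm: "tame (snd ` set (ys @ rs))" using 1(1) by blast
      \<comment> \<open>A family may be listed with several bounds, whereas
        \<open>tame_insert\<close> expects a bound as a function of \<open>Q\<close>.\<close>
      define w where "w Q = Max {m. (m, Q) \<in> set ys}" for Q
      have w: "(w Q, Q) \<in> set ys" if "Q \<in> snd ` set ys" for Q
      proof -
        have "finite {m. (m, Q) \<in> set ys}"
          by (rule finite_subset[of _ "fst ` set ys"]) force+
        moreover have "{m. (m, Q) \<in> set ys} \<noteq> {}" using that by auto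
        ultimately have "w Q \<in> {m. (m, Q) \<in> set ys}" unfolding w_def by (rule Max_in)
        then show ?thesis by simp
      qed
      have "tame (insert P (snd ` set ys))"
      proof (rule tame_insert[OF famP, where w = w and S = S])
        show "poly_family (w Q) Q" if "Q \<in> snd ` set ys" for Q using ysfam w that by blast
        show "(\<lambda>e. pderiv (P e)) \<in> snd ` set ys" unfolding ys_def by simp
        show "tame (snd ` set ys \<union> {S Q k |Q k. Q \<in> snd ` set ys \<and> k < w Q})"
        proof (rule tame_subset[OF tm])
          have "S Q k \<in> snd ` set rs" if "Q \<in> snd ` set ys" "k < w Q" for Q k
          proof -
            have "(k, S Q k) \<in> set rs" unfolding rs_def using w[OF that(1)] that(2) by force
            then show ?thesis by force
          qed
          then show "snd ` set ys \<union> {S Q k |Q k. Q \<in> snd ` set ys \<and> k < w Q} \<subseteq> snd ` set (ys @ rs)"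
            by auto
        qed
      qed (use S ysfam w in blast)+
      then show ?thesis by (rule tame_subset) (auto simp: set ys_def)
    qed
  qed
  obtain Ps where Ps: "set Ps = \<P>" using assms(1) finite_list by blast
  obtain f where f: "\<And>P. P \<in> \<P> \<Longrightarrow> poly_family (f P) P" using assms(2) by metis
  have "tame (snd ` set (map (\<lambda>P. (f P, P)) Ps))" by (rule main) (use f Ps in auto)
  then show ?thesis using Ps by (simp add: image_image)
qed

text \<open>This semantic form of semialgebraicity makes closure under Boolean operations and polynomial
  substitution immediate; only projection requires work.\<close>

definition sgn_determined :: "(env \<Rightarrow> bool) \<Rightarrow> bool" where
  "sgn_determined \<phi> \<longleftrightarrow>
     (\<exists>D. finite D \<and> D \<subseteq> polyfuns \<and> (\<forall>e e'. same_signs D e e' \<longrightarrow> \<phi> e = \<phi> e'))"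

lemma same_signs_sym: "same_signs D e e' \<Longrightarrow> same_signs D e' e"
  unfolding same_signs_def by simp

lemma same_signs_mono: "same_signs D e e' \<Longrightarrow> C \<subseteq> D \<Longrightarrow> same_signs C e e'"
  unfolding same_signs_def by blast

lemma sgn_determinedI:
  assumes "finite D" "D \<subseteq> polyfuns" "\<And>e e'. same_signs D e e' \<Longrightarrow> \<phi> e \<Longrightarrow> \<phi> e'"
  shows "sgn_determined \<phi>"
  unfolding sgn_determined_def
proof (rule exI[of _ D], intro conjI allI impI)
  show "\<phi> e = \<phi> e'" if "same_signs D e e'" for e e'
    using assms(3)[OF that] assms(3)[OF same_signs_sym[OF that]] by blast
qed (use assms in simp_all)

lemma sgn_determinedE:
  assumes "sgn_determined \<phi>"
  obtains D where "finite D" "D \<subseteq> polyfuns" "\<forall>e e'. same_signs D e e' \<longrightarrow> \<phi> e = \<phi> e'"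
  using assms unfolding sgn_determined_def by (elim exE conjE) (rule that)

lemma polyfuns_subst:
  assumes "f \<in> polyfuns" "\<And>i. (\<lambda>e. \<theta> e i) \<in> polyfuns"
  shows "(\<lambda>e. f (\<theta> e)) \<in> polyfuns"
  using assms by induction (auto intro: polyfuns.intros)

lemma sgn_determined_subst:
  assumes "sgn_determined \<phi>" "\<And>i. (\<lambda>e. \<theta> e i) \<in> polyfuns"
  shows "sgn_determined (\<lambda>e. \<phi> (\<theta> e))"
proof -
  obtain D where D: "finite D" "D \<subseteq> polyfuns" "\<forall>e e'. same_signs D e e' \<longrightarrow> \<phi> e = \<phi> e'"
    by (rule sgn_determinedE[OF assms(1)]) (rule that)
  show ?thesis
  proof (rule sgn_determinedI)
    show "finite ((\<lambda>f e. f (\<theta> e)) ` D)" using D(1) by (rule finite_imageI)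
    show "(\<lambda>f e. f (\<theta> e)) ` D \<subseteq> polyfuns"
    proof (rule image_subsetI)
      fix f assume "f \<in> D"
      then have "f \<in> polyfuns" using D(2) by (rule rev_subsetD)
      then show "(\<lambda>e. f (\<theta> e)) \<in> polyfuns" using assms(2) by (rule polyfuns_subst)
    qed
    fix e e' assume "same_signs ((\<lambda>f e. f (\<theta> e)) ` D) e e'" and e: "\<phi> (\<theta> e)"
    then have "same_signs D (\<theta> e) (\<theta> e')" unfolding same_signs_def by simp
    from D(3)[rule_format, OF this] show "\<phi> (\<theta> e')" using e by simp
  qed
qed

lemma sgn_determined_not:
  assumes "sgn_determined \<phi>"
  shows "sgn_determined (\<lambda>e. \<not> \<phi> e)"
proof -
  obtain D where D: "finite D" "D \<subseteq> polyfuns" "\<forall>e e'. same_signs D e e' \<longrightarrow> \<phi> e = \<phi> e'"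
    by (rule sgn_determinedE[OF assms]) (rule that)
  show ?thesis
    by (rule sgn_determinedI[OF D(1,2)]) (drule D(3)[rule_format], simp)
qed

lemma sgn_determined_ball:
  assumes I: "finite I" and \<phi>: "\<And>i. i \<in> I \<Longrightarrow> sgn_determined (\<phi> i)"
  shows "sgn_determined (\<lambda>e. \<forall>i\<in>I. \<phi> i e)"
proof -
  have "\<forall>i\<in>I. \<exists>D. finite D \<and> D \<subseteq> polyfuns \<and> (\<forall>e e'. same_signs D e e' \<longrightarrow> \<phi> i e = \<phi> i e')"
    using \<phi> unfolding sgn_determined_def by blast
  then obtain D where D: "\<forall>i\<in>I. finite (D i) \<and> D i \<subseteq> polyfuns \<and> (\<forall>e e'. same_signs (D i) e e' \<longrightarrow> \<phi> i e = \<phi> i e')"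
    by (rule bchoice[THEN exE])
  show ?thesis
  proof (rule sgn_determinedI)
    show "finite (\<Union>i\<in>I. D i)" "(\<Union>i\<in>I. D i) \<subseteq> polyfuns" using I D by blast+
    fix e e' assume s: "same_signs (\<Union>i\<in>I. D i) e e'" and e: "\<forall>i\<in>I. \<phi> i e"
    show "\<forall>i\<in>I. \<phi> i e'"
    proof
      fix i assume i: "i \<in> I"
      have "same_signs (D i) e e'" by (rule same_signs_mono[OF s]) (use i in blast)
      then show "\<phi> i e'" using D e i by blast
    qed
  qed
qed

lemma sgn_determined_conj:
  assumes "sgn_determined \<phi>" "sgn_determined \<psi>"
  shows "sgn_determined (\<lambda>e. \<phi> e \<and> \<psi> e)"
proof -
  have "sgn_determined (\<lambda>e. \<forall>b\<in>UNIV. (if b then \<phi> else \<psi>) e)"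
    by (rule sgn_determined_ball) (use assms in auto)
  moreover have "(\<forall>b\<in>UNIV. (if b then \<phi> else \<psi>) e) \<longleftrightarrow> \<phi> e \<and> \<psi> e" for e
    by (auto split: if_splits)
  ultimately show ?thesis by simp
qed

lemma sgn_determined_disj:
  assumes "sgn_determined \<phi>" "sgn_determined \<psi>"
  shows "sgn_determined (\<lambda>e. \<phi> e \<or> \<psi> e)"
  using sgn_determined_not[OF sgn_determined_conj[OF assms[THEN sgn_determined_not]]] by simp

lemma sgn_determined_atom:
  assumes "f \<in> polyfuns" "g \<in> polyfuns"
  shows "sgn_determined (\<lambda>e. f e < g e)" "sgn_determined (\<lambda>e. f e = g e)" "sgn_determined (\<lambda>e. f e \<le> g e)"
proof -
  have "(\<lambda>e. f e - g e) \<in> polyfuns" by (rule polyfuns_diff[OF assms])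
  then have *: "sgn_determined (\<lambda>e. \<phi> (sgn (f e - g e)))" for \<phi>
    by (intro sgn_determinedI[of "{\<lambda>e. f e - g e}"]) (simp_all add: same_signs_def)
  have "f e < g e \<longleftrightarrow> sgn (f e - g e) = -1" "f e = g e \<longleftrightarrow> sgn (f e - g e) = 0"
    "f e \<le> g e \<longleftrightarrow> sgn (f e - g e) \<noteq> 1" for e
    by (simp_all add: sgn_diff_real)
  then show "sgn_determined (\<lambda>e. f e < g e)" "sgn_determined (\<lambda>e. f e = g e)" "sgn_determined (\<lambda>e. f e \<le> g e)"
    using *[of "\<lambda>s. s = -1"] *[of "\<lambda>s. s = 0"] *[of "\<lambda>s. s \<noteq> 1"] by simp_all
qed

section \<open>Projection along variables\<close>

lemma polyfuns_poly_family:
  assumes "f \<in> polyfuns"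
  shows "\<exists>n P. poly_family n P \<and> (\<forall>e y. f (e(k := y)) = poly (P e) y)"
  using assms
proof induction
  case (const c)
  have "poly_family 1 (\<lambda>e. [:c:])" unfolding poly_family_def by (auto simp: coeff_pCons split: nat.split intro: polyfuns_intros)
  then show ?case by (intro exI conjI) auto
next
  case (var i)
  show ?case
  proof (cases "i = k")
    case True
    have "poly_family 2 (\<lambda>e. [:0, 1:])" unfolding poly_family_def by (auto simp: coeff_pCons split: nat.split intro: polyfuns_intros)
    then show ?thesis using True by (intro exI conjI) auto
  next
    case False
    have "(\<lambda>e. coeff [:e i:] j) \<in> polyfuns" for j :: nat
      by (cases j) (auto intro: polyfuns_intros)
    then have "poly_family 1 (\<lambda>e. [:e i:])" unfolding poly_family_def by (auto simp: coeff_pCons split: nat.split)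
    then show ?thesis using False by (intro exI conjI) auto
  qed
next
  case (add f g)
  then obtain n P m Q where *: "poly_family n P" "\<And>e y. f (e(k := y)) = poly (P e) y"
    "poly_family m Q" "\<And>e y. g (e(k := y)) = poly (Q e) y" by blast
  have "poly_family (max n m) (\<lambda>e. P e + Q e)"
    using *(1,3) unfolding poly_family_def by (auto intro: polyfuns_intros)
  then show ?case
    by (intro exI conjI allI, assumption) (simp only: * poly_add)
next
  case (mult f g)
  then obtain n P m Q where *: "poly_family n P" "\<And>e y. f (e(k := y)) = poly (P e) y"
    "poly_family m Q" "\<And>e y. g (e(k := y)) = poly (Q e) y" by blast
  have "(\<lambda>e. coeff (P e * Q e) i) \<in> polyfuns" for i
    unfolding coeff_mult using *(1,3) unfolding poly_family_def by (intro polyfuns_intros) auto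
  moreover have "coeff (P e * Q e) i = 0" if "i \<ge> n + m" for e i
    unfolding coeff_mult
  proof (rule sum.neutral, rule ballI)
    fix j assume "j \<in> {..i}"
    then have "j \<ge> n \<or> i - j \<ge> m" using that by auto
    then show "coeff (P e) j * coeff (Q e) (i - j) = 0" using *(1,3) unfolding poly_family_def by auto
  qed
  ultimately have "poly_family (n + m) (\<lambda>e. P e * Q e)" unfolding poly_family_def by blast
  then show ?case
    by (intro exI conjI allI, assumption) (simp only: * poly_mult)
qed

text \<open>This is the Tarski-Seidenberg projection: a matching carries a witness \<open>y\<close>
  at \<open>e\<close> to a point \<open>y'\<close> at \<open>e'\<close> with the same signs of all
  polynomials in \<open>D\<close>, and \<open>\<phi>\<close> depends only on those signs.\<close>

lemma sgn_determined_ex: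
  assumes "sgn_determined \<phi>"
  shows "sgn_determined (\<lambda>e. \<exists>y. \<phi> (e(k := y)))"
proof -
  obtain D where D: "finite D" "D \<subseteq> polyfuns" "\<forall>e e'. same_signs D e e' \<longrightarrow> \<phi> e = \<phi> e'"
    by (rule sgn_determinedE[OF assms(1)]) (rule that)
  have "\<forall>f\<in>D. \<exists>P. (\<exists>n. poly_family n P) \<and> (\<forall>e y. f (e(k := y)) = poly (P e) y)"
  proof
    fix f assume "f \<in> D"
    then have "f \<in> polyfuns" using D(2) by (rule rev_subsetD)
    from polyfuns_poly_family[OF this, of k]
    show "\<exists>P. (\<exists>n. poly_family n P) \<and> (\<forall>e y. f (e(k := y)) = poly (P e) y)" by blast
  qed
  then obtain P where "\<forall>f\<in>D. (\<exists>n. poly_family n (P f)) \<and> (\<forall>e y. f (e(k := y)) = poly (P f e) y)"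
    by (rule bchoice[THEN exE])
  note P = bspec[OF this]
  have "tame (P ` D)"
  proof (rule tame_finite)
    show "finite (P ` D)" using D(1) by (rule finite_imageI)
    fix Q assume "Q \<in> P ` D"
    then obtain f where "f \<in> D" "Q = P f" by (rule imageE)
    then show "\<exists>n. poly_family n Q" using P[of f] by simp
  qed
  then obtain E where E: "finite E" "E \<subseteq> polyfuns"
    "\<forall>e e'. same_signs E e e' \<longrightarrow> (\<exists>\<beta>. matches \<beta> ((\<lambda>P. (P e, P e')) ` P ` D))"
    unfolding tame_def by (elim exE conjE) (rule that)
  have "\<exists>y'. \<phi> (e'(k := y'))" if s: "same_signs E e e'" and y: "\<phi> (e(k := y))" for e e' y
  proof -
    obtain \<beta> where b: "matches \<beta> ((\<lambda>P. (P e, P e')) ` P ` D)" using E(3)[rule_format, OF s] by blast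
    obtain y' where y': "sgn_rel \<beta> y y'" using matches_total[OF b] by (rule exE)
    have "same_signs D (e(k := y)) (e'(k := y'))"
      unfolding same_signs_def
    proof
      fix f assume f: "f \<in> D"
      then have "(P f e, P f e') \<in> (\<lambda>P. (P e, P e')) ` P ` D" by (intro image_eqI[of _ _ "P f"]) simp_all
      then have "sgn (poly (P f e) y) = sgn (poly (P f e') y')"
        using matchesD[OF b y'] by simp
      then show "sgn (f (e(k := y))) = sgn (f (e'(k := y')))" using P[OF f] by simp
    qed
    then have "\<phi> (e(k := y)) = \<phi> (e'(k := y'))" by (rule D(3)[rule_format])
    then show ?thesis by (intro exI[of _ y']) (simp only: y)
  qed
  then show ?thesis by (intro sgn_determinedI[OF E(1,2)]) (elim exE)
qed

text \<open>A block of variables is quantified as one function \<open>f\<close>, read only on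
  \<open>V\<close>; the induction splits off one variable and eliminates it by the one-variable
  case.\<close>

lemma sgn_determined_ex_finite:
  assumes "finite V" "sgn_determined \<phi>"
  shows "sgn_determined (\<lambda>e. \<exists>f. \<phi> (\<lambda>i. if i \<in> V then f i else e i))"
  using assms
proof (induction V arbitrary: \<phi>)
  case empty
  then show ?case by simp
next
  case (insert k V)
  have eq: "(\<exists>f. \<phi> (\<lambda>i. if i \<in> insert k V then f i else e i)) \<longleftrightarrow>
    (\<exists>f. \<exists>y. \<phi> ((\<lambda>i. if i \<in> V then f i else e i)(k := y)))" for e
  proof
    assume "\<exists>f. \<phi> (\<lambda>i. if i \<in> insert k V then f i else e i)"
    then obtain f where f: "\<phi> (\<lambda>i. if i \<in> insert k V then f i else e i)" by blast
    have "(\<lambda>i. if i \<in> insert k V then f i else e i) = (\<lambda>i. if i \<in> V then f i else e i)(k := f k)" by auto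
    then show "\<exists>f. \<exists>y. \<phi> ((\<lambda>i. if i \<in> V then f i else e i)(k := y))" using f by metis
  next
    assume "\<exists>f. \<exists>y. \<phi> ((\<lambda>i. if i \<in> V then f i else e i)(k := y))"
    then obtain f y where f: "\<phi> ((\<lambda>i. if i \<in> V then f i else e i)(k := y))" by blast
    have "(\<lambda>i. if i \<in> V then f i else e i)(k := y) = (\<lambda>i. if i \<in> insert k V then (f(k := y)) i else e i)"
      using insert.hyps by auto
    then show "\<exists>f. \<phi> (\<lambda>i. if i \<in> insert k V then f i else e i)" using f by metis
  qed
  show ?case unfolding eq by (rule insert.IH[OF sgn_determined_ex[OF insert.prems]])
qed

section \<open>Semialgebraic sets\<close>

lemma mpoly_eval_superset:
  assumes "finite S" "Poly_Mapping.keys p \<subseteq> S"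
  shows "mpoly_eval p x = (\<Sum>k\<in>S. Poly_Mapping.lookup p k *
        (\<Prod>i\<in>Poly_Mapping.keys k. x $ i ^ Poly_Mapping.lookup k i))"
  unfolding mpoly_eval_def
  by (rule sum.mono_neutral_left[OF assms]) (auto simp: in_keys_iff)

lemma mpoly_eval_add: "mpoly_eval (p + q) x = mpoly_eval p x + mpoly_eval q x"
proof -
  let ?S = "Poly_Mapping.keys p \<union> Poly_Mapping.keys q"
  have "Poly_Mapping.keys (p + q) \<subseteq> ?S" by (rule Poly_Mapping.keys_add)
  then show ?thesis
    using mpoly_eval_superset[of ?S "p + q" x] mpoly_eval_superset[of ?S p x] mpoly_eval_superset[of ?S q x]
    by (simp add: lookup_add distrib_right sum.distrib)
qed

definition mon_eval :: "monom \<Rightarrow> real Matrix.vec \<Rightarrow> real" where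
  "mon_eval k x = (\<Prod>i\<in>Poly_Mapping.keys k. x $ i ^ Poly_Mapping.lookup k i)"

lemma mon_eval_add: "mon_eval (k + l) x = mon_eval k x * mon_eval l x"
proof -
  let ?S = "Poly_Mapping.keys k \<union> Poly_Mapping.keys l"
  have sup: "mon_eval j x = (\<Prod>i\<in>?S. x $ i ^ Poly_Mapping.lookup j i)"
    if "Poly_Mapping.keys j \<subseteq> ?S" for j
    unfolding mon_eval_def by (rule prod.mono_neutral_left) (use that in \<open>auto simp: in_keys_iff\<close>)
  have "Poly_Mapping.keys (k + l) \<subseteq> ?S" by (rule Poly_Mapping.keys_add)
  then show ?thesis using sup[of k] sup[of l] sup[of "k + l"]
    by (simp add: lookup_add power_add prod.distrib)
qed

lemma mpoly_eval_single: "mpoly_eval (Poly_Mapping.single k c) x = c * mon_eval k x"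
  unfolding mpoly_eval_def mon_eval_def by simp

definition mpoly_funs :: "nat \<Rightarrow> (real Matrix.vec \<Rightarrow> real) set" where
  "mpoly_funs d = mpoly_eval ` mpolys d"

lemma mpoly_funs_single: "Poly_Mapping.keys k \<subseteq> {..<d} \<Longrightarrow> (\<lambda>x. c * mon_eval k x) \<in> mpoly_funs d"
  unfolding mpoly_funs_def
  by (rule image_eqI[of _ _ "Poly_Mapping.single k c"]) (auto simp: mpoly_eval_single mpolys_def fun_eq_iff)

lemma mpoly_funs_add:
  assumes "f \<in> mpoly_funs d" "g \<in> mpoly_funs d"
  shows "(\<lambda>x. f x + g x) \<in> mpoly_funs d"
proof -
  obtain p q where pq: "p \<in> mpolys d" "f = mpoly_eval p" "q \<in> mpolys d" "g = mpoly_eval q"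
    using assms unfolding mpoly_funs_def by auto
  have "p + q \<in> mpolys d" using pq(1,3) keys_add[of p q] unfolding mpolys_def by blast
  moreover have "(\<lambda>x. f x + g x) = mpoly_eval (p + q)" using pq by (auto simp: mpoly_eval_add)
  ultimately show ?thesis unfolding mpoly_funs_def by blast
qed

lemma mpoly_funs_const: "(\<lambda>x. c) \<in> mpoly_funs d"
  using mpoly_funs_single[of 0 d c] by (simp add: mon_eval_def)

lemma mpoly_funs_sum:
  "(\<And>i. i \<in> I \<Longrightarrow> f i \<in> mpoly_funs d) \<Longrightarrow> (\<lambda>x. \<Sum>i\<in>I. f i x) \<in> mpoly_funs d"
  by (induction I rule: infinite_finite_induct) (auto intro: mpoly_funs_add mpoly_funs_const)

lemma mpoly_funs_mult:
  assumes "f \<in> mpoly_funs d" "g \<in> mpoly_funs d"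
  shows "(\<lambda>x. f x * g x) \<in> mpoly_funs d"
proof -
  obtain p q where pq: "p \<in> mpolys d" "f = mpoly_eval p" "q \<in> mpolys d" "g = mpoly_eval q"
    using assms unfolding mpoly_funs_def by auto
  have "f x * g x = (\<Sum>k\<in>Poly_Mapping.keys p. \<Sum>l\<in>Poly_Mapping.keys q.
      (Poly_Mapping.lookup p k * Poly_Mapping.lookup q l) * mon_eval (k + l) x)" for x
    unfolding pq mpoly_eval_def sum_product mon_eval_add by (simp add: mon_eval_def algebra_simps)
  moreover have "(\<lambda>x. \<Sum>k\<in>Poly_Mapping.keys p. \<Sum>l\<in>Poly_Mapping.keys q.
      (Poly_Mapping.lookup p k * Poly_Mapping.lookup q l) * mon_eval (k + l) x) \<in> mpoly_funs d"
  proof (intro mpoly_funs_sum mpoly_funs_single)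
    fix k l assume "k \<in> Poly_Mapping.keys p" "l \<in> Poly_Mapping.keys q"
    then have "Poly_Mapping.keys k \<subseteq> {..<d}" "Poly_Mapping.keys l \<subseteq> {..<d}" using pq unfolding mpolys_def by auto
    then show "Poly_Mapping.keys (k + l) \<subseteq> {..<d}" using keys_add[of k l] by blast
  qed
  ultimately show ?thesis by simp
qed

lemma mpoly_funs_var: "i < d \<Longrightarrow> (\<lambda>x. x $ i) \<in> mpoly_funs d"
  using mpoly_funs_single[of "Poly_Mapping.single i 1" d 1] by (simp add: mon_eval_def)

text \<open>Vector entries are unspecified from index \<open>d\<close> on, so the environment takes
  the default 0 there.\<close>

definition env_of :: "nat \<Rightarrow> real Matrix.vec \<Rightarrow> env" where
  "env_of d x = (\<lambda>i. if i < d then x $ i else 0)"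

lemma polyfuns_mpoly_funs: "f \<in> polyfuns \<Longrightarrow> (\<lambda>x. f (env_of d x)) \<in> mpoly_funs d"
proof (induction rule: polyfuns.induct)
  case (var i)
  then show ?case
    by (cases "i < d") (simp_all add: env_of_def mpoly_funs_var mpoly_funs_const)
qed (auto intro: mpoly_funs_const mpoly_funs_add mpoly_funs_mult)

section \<open>Sign cells as basic semialgebraic sets\<close>

lemma sgn_eq_iff:
  "sgn a = sgn b \<longleftrightarrow> (b = 0 \<longrightarrow> a = 0) \<and> (b > 0 \<longrightarrow> a > 0) \<and> (b < 0 \<longrightarrow> a < 0)" for a b :: real
  by (cases a "0::real" rule: linorder_cases; cases b "0::real" rule: linorder_cases) simp_all

text \<open>Fixing the signs of all members of \<open>D\<close> is a conjunction of polynomial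
  equations and strict inequalities, and the set is the union of those cells whose sign pattern
  satisfies \<open>\<phi>\<close>.\<close>

lemma semialgebraic_sgn_determined:
  assumes "sgn_determined \<phi>"
  shows "semialgebraic d {x \<in> carrier_vec d. \<phi> (env_of d x)}"
proof -
  obtain D where D: "finite D" "D \<subseteq> polyfuns" "\<forall>e e'. same_signs D e e' \<longrightarrow> \<phi> e = \<phi> e'"
    by (rule sgn_determinedE[OF assms]) (rule that)
  have ex: "\<exists>p\<in>mpolys d. \<forall>x. mpoly_eval p x = f (env_of d x)" if "f \<in> polyfuns" for f
  proof -
    have "(\<lambda>x. f (env_of d x)) \<in> mpoly_eval ` mpolys d"
      using polyfuns_mpoly_funs[OF that] unfolding mpoly_funs_def .
    then obtain p where "p \<in> mpolys d" "(\<lambda>x. f (env_of d x)) = mpoly_eval p" by (rule imageE)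
    then show ?thesis by (metis)
  qed
  have "\<forall>f\<in>polyfuns. \<exists>p. p \<in> mpolys d \<and> (\<forall>x. mpoly_eval p x = f (env_of d x))" using ex by blast
  then obtain M where "\<forall>f\<in>polyfuns. M f \<in> mpolys d \<and> (\<forall>x. mpoly_eval (M f) x = f (env_of d x))"
    by (rule bchoice[THEN exE])
  note M = bspec[OF this]
  define cell where "cell e = {x \<in> carrier_vec d. same_signs D (env_of d x) e}" for e
  have basic: "basic_semialgebraic d (cell e)" for e
  proof -
    let ?E = "M ` {f \<in> D. f e = 0}"
    \<comment> \<open>Negative signs become strict positivity of \<open>- f\<close>.\<close>
    let ?G = "M ` {f \<in> D. f e > 0} \<union> (\<lambda>f. M (\<lambda>e. - f e)) ` {f \<in> D. f e < 0}"
    have sub: "f \<in> polyfuns" "(\<lambda>e. - f e) \<in> polyfuns" if "f \<in> D" for f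
      using D(2) that polyfuns_uminus by blast+
    have "x \<in> cell e \<longleftrightarrow> x \<in> carrier_vec d \<and> (\<forall>p\<in>?E. mpoly_eval p x = 0) \<and>
        (\<forall>p\<in>{}. mpoly_eval p x \<ge> 0) \<and> (\<forall>p\<in>?G. mpoly_eval p x > 0)" for x
    proof -
      have "(\<forall>p\<in>?E. mpoly_eval p x = 0) \<longleftrightarrow> (\<forall>f\<in>D. f e = 0 \<longrightarrow> f (env_of d x) = 0)"
        using M[OF sub(1)] by auto
      moreover have "(\<forall>p\<in>?G. mpoly_eval p x > 0) \<longleftrightarrow>
          (\<forall>f\<in>D. (f e > 0 \<longrightarrow> f (env_of d x) > 0) \<and> (f e < 0 \<longrightarrow> f (env_of d x) < 0))"
        using M[OF sub(1)] M[OF sub(2)] by (auto simp: ball_Un)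
      moreover have "sgn (f (env_of d x)) = sgn (f e) \<longleftrightarrow> (f e = 0 \<longrightarrow> f (env_of d x) = 0) \<and>
          (f e > 0 \<longrightarrow> f (env_of d x) > 0) \<and> (f e < 0 \<longrightarrow> f (env_of d x) < 0)" for f :: "env \<Rightarrow> real"
        by (rule sgn_eq_iff)
      ultimately show ?thesis unfolding cell_def same_signs_def mem_Collect_eq by (simp only: ball_simps) blast
    qed
    then have eq: "cell e = {x \<in> carrier_vec d. (\<forall>p\<in>?E. mpoly_eval p x = 0) \<and>
        (\<forall>p\<in>{}. mpoly_eval p x \<ge> 0) \<and> (\<forall>p\<in>?G. mpoly_eval p x > 0)}" by blast
    have fin: "finite ?E" "finite ?G" using D(1) by simp_all
    have polys: "?E \<subseteq> mpolys d" "?G \<subseteq> mpolys d" using M[OF sub(1)] M[OF sub(2)] by auto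
    show ?thesis unfolding basic_semialgebraic_def
      by (rule exI[of _ ?E], rule exI[of _ "{}"], rule exI[of _ ?G])
        (intro conjI finite.emptyI empty_subsetI fin polys eq)
  qed
  define \<C> where "\<C> = {cell e | e. \<phi> e}"
  \<comment> \<open>Although \<open>e\<close> ranges over infinitely many environments, a cell
    depends only on its sign pattern on the finite \<open>D\<close>.\<close>
  have sub: "\<C> \<subseteq> (\<lambda>\<sigma>. {x \<in> carrier_vec d. \<forall>f\<in>D. sgn (f (env_of d x)) = \<sigma> f}) ` (D \<rightarrow>\<^sub>E {-1, 0, 1})"
  proof
    fix C assume "C \<in> \<C>"
    then obtain e where e: "C = cell e" unfolding \<C>_def by blast
    have 1: "restrict (\<lambda>f. sgn (f e)) D \<in> D \<rightarrow>\<^sub>E {-1, 0, 1}" by (auto simp: sgn_if)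
    have 2: "C = {x \<in> carrier_vec d. \<forall>f\<in>D. sgn (f (env_of d x)) = restrict (\<lambda>f. sgn (f e)) D f}"
      unfolding e cell_def same_signs_def by simp
    show "C \<in> (\<lambda>\<sigma>. {x \<in> carrier_vec d. \<forall>f\<in>D. sgn (f (env_of d x)) = \<sigma> f}) ` (D \<rightarrow>\<^sub>E {-1, 0, 1})"
      unfolding 2 by (rule imageI[OF 1])
  qed
  have "finite (D \<rightarrow>\<^sub>E {-1, 0, 1::real})" using D(1) by (intro finite_PiE) simp_all
  from finite_subset[OF sub finite_imageI[OF this]] have "finite \<C>" .
  moreover have "{x \<in> carrier_vec d. \<phi> (env_of d x)} = \<Union>\<C>"
  proof (rule Set.set_eqI, rule iffI)
    fix x assume x: "x \<in> {x \<in> carrier_vec d. \<phi> (env_of d x)}"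
    have "same_signs D (env_of d x) (env_of d x)" unfolding same_signs_def by simp
    then have "x \<in> cell (env_of d x)" "cell (env_of d x) \<in> \<C>"
      using x unfolding cell_def \<C>_def by blast+
    then show "x \<in> \<Union>\<C>" by (intro UnionI)
  next
    fix x assume "x \<in> \<Union>\<C>"
    then obtain e where e: "\<phi> e" "x \<in> carrier_vec d" "same_signs D (env_of d x) e" unfolding \<C>_def cell_def by blast
    from D(3)[rule_format, OF e(3)] show "x \<in> {x \<in> carrier_vec d. \<phi> (env_of d x)}" using e by simp
  qed
  moreover have "\<forall>C\<in>\<C>. basic_semialgebraic d C" using basic unfolding \<C>_def by blast
  ultimately show ?thesis unfolding semialgebraic_def by blast
qed

section \<open>Weak separation of convex sets\<close>

text \<open>Tychonoff's theorem; it serves both for functionals, indexed by coordinates, and for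
  convex weights, indexed by points.\<close>

lemma compact_cube: "compact {f :: 'a \<Rightarrow> real. \<forall>i. a \<le> f i \<and> f i \<le> b}"
proof -
  have "compactin (product_topology (\<lambda>_. euclidean) UNIV) (PiE UNIV (\<lambda>_::'a. {a..b}))"
    unfolding compactin_PiE by simp
  moreover have "PiE UNIV (\<lambda>_::'a. {a..b}) = {f. \<forall>i. a \<le> f i \<and> f i \<le> b}"
    by (auto simp: PiE_def Pi_def)
  ultimately show ?thesis by (simp add: euclidean_product_topology)
qed

definition dot :: "nat \<Rightarrow> (nat \<Rightarrow> real) \<Rightarrow> (nat \<Rightarrow> real) \<Rightarrow> real" where
  "dot n p q = (\<Sum>k<n. p k * q k)"

text \<open>Pinning the coordinates from \<open>n\<close> on to 0 makes this copy of the unit sphere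
  compact in the product topology.\<close>

definition unit_vectors :: "nat \<Rightarrow> (nat \<Rightarrow> real) set" where
  "unit_vectors n = {p. (\<forall>k\<ge>n. p k = 0) \<and> dot n p p = 1}"

lemma compact_unit_vectors: "compact (unit_vectors n)"
proof -
  have "closed (\<Inter>k\<in>{n..}. {p. p k = (0::real)})"
    by (intro closed_INT ballI closed_Collect_eq) simp_all
  moreover have "closed {p. dot n p p = 1}"
    unfolding dot_def by (intro closed_Collect_eq continuous_intros continuous_on_product_coordinates) 
  ultimately have "closed ((\<Inter>k\<in>{n..}. {p. p k = (0::real)}) \<inter> {p. dot n p p = 1})" by (rule closed_Int)
  then have "compact ({f. \<forall>i. -1 \<le> f i \<and> f i \<le> 1} \<inter> ((\<Inter>k\<in>{n..}. {p. p k = (0::real)}) \<inter> {p. dot n p p = 1}))"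
    by (intro compact_Int_closed compact_cube)
  moreover have "{f. \<forall>i. -1 \<le> f i \<and> f i \<le> 1} \<inter> ((\<Inter>k\<in>{n..}. {p. p k = (0::real)}) \<inter> {p. dot n p p = 1}) = unit_vectors n"
  proof -
    have "-1 \<le> p i \<and> p i \<le> 1" if "p \<in> unit_vectors n" for p i
    proof (cases "i < n")
      case True
      have "p i * p i \<le> dot n p p"
        unfolding dot_def by (rule member_le_sum) (use True in auto)
      then have "(p i)\<^sup>2 \<le> 1" using that unfolding unit_vectors_def by (simp add: power2_eq_square)
      then show ?thesis by (simp add: abs_square_le_1 abs_le_iff)
    next
      case False
      then show ?thesis using that unfolding unit_vectors_def by simp
    qed
    then show ?thesis unfolding unit_vectors_def by auto
  qed
  ultimately show ?thesis by simp
qed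

text \<open>Points are infinite sequences of which only the first \<open>n\<close> entries count, so
  convexity is asked for up to agreement below \<open>n\<close>.\<close>

definition convex_coords :: "nat \<Rightarrow> (nat \<Rightarrow> real) set \<Rightarrow> bool" where
  "convex_coords n S \<longleftrightarrow> (\<forall>y\<in>S. \<forall>z\<in>S. \<forall>l\<in>{0..1}. \<exists>w\<in>S. \<forall>k<n. w k = (1 - l) * y k + l * z k)"

lemma convex_coords_sum:
  assumes "convex_coords n S" "finite F" "F \<subseteq> S" "\<And>v. v \<in> F \<Longrightarrow> 0 \<le> w v" "(\<Sum>v\<in>F. w v) = 1"
  shows "\<exists>y\<in>S. \<forall>k<n. y k = (\<Sum>v\<in>F. w v * v k)"
  using assms(2-)
proof (induction F arbitrary: w)
  case empty
  then show ?case by simp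
next
  case (insert a F)
  show ?case
  \<comment> \<open>Otherwise the weights on \<open>F\<close> can be renormalised by dividing by
    \<open>1 - w a\<close>.\<close>
  proof (cases "w a = 1")
    case True
    then have "sum w F = 0" using insert by simp
    then have "\<forall>v\<in>F. w v = 0" using insert sum_nonneg_eq_0_iff[of F w] by simp
    then show ?thesis using True insert by (intro bexI[of _ a]) auto
  next
    case False
    have nn: "0 \<le> sum w F" using insert by (intro sum_nonneg) auto
    then have a: "0 \<le> w a" "w a < 1" using insert False by auto
    have "(\<Sum>v\<in>F. w v / (1 - w a)) = 1" using insert a by (simp flip: sum_divide_distrib)
    then obtain y where y: "y \<in> S" "\<forall>k<n. y k = (\<Sum>v\<in>F. w v / (1 - w a) * v k)"
      using insert.IH[of "\<lambda>v. w v / (1 - w a)"] insert.prems a by auto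
    obtain z where z: "z \<in> S" "\<forall>k<n. z k = (1 - w a) * y k + w a * a k"
      using assms(1)[unfolded convex_coords_def, rule_format, of y a "w a"] y(1) insert.prems a by auto
    have "z k = (\<Sum>v\<in>insert a F. w v * v k)" if "k < n" for k
    proof -
      have "(1 - w a) * y k = (\<Sum>v\<in>F. w v * v k)"
        using y that a by (simp add: sum_distrib_left)
      then show ?thesis using z that insert.hyps by simp
    qed
    then show ?thesis using z by blast
  qed
qed

lemma dot_diff: "dot n p (\<lambda>k. q k - r k) = dot n p q - dot n p r"
  unfolding dot_def by (simp add: algebra_simps sum_subtractf)

text \<open>The point of the hull of \<open>F\<close> nearest to \<open>x\<close> yields the separating functional.\<close>

lemma separation_finite:
  assumes S: "convex_coords n S" and F: "finite F" "F \<subseteq> S" and n: "0 < n"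
    and x: "\<not> (\<exists>y\<in>S. \<forall>k<n. y k = x k)"
  shows "\<exists>p\<in>unit_vectors n. \<forall>v\<in>F. dot n p v \<le> dot n p x"
proof (cases "F = {}")
  case True
  have "(\<lambda>k. if k = 0 then 1 else 0) \<in> unit_vectors n"
    using n unfolding unit_vectors_def dot_def by (auto simp: if_distrib cong: if_cong)
  then show ?thesis using True by blast
next
  case False
  define W where "W = {w. (\<forall>v. 0 \<le> w v \<and> w v \<le> 1) \<and> (\<Sum>v\<in>F. w v) = (1::real)}"
  define q where "q w k = (\<Sum>v\<in>F. w v * v k) - x k" for w and k :: nat
  have "closed {w. (\<Sum>v\<in>F. w v) = (1::real)}"
    by (intro closed_Collect_eq continuous_intros continuous_on_product_coordinates)
  then have "compact ({w. \<forall>v. 0 \<le> w v \<and> w v \<le> 1} \<inter> {w. (\<Sum>v\<in>F. w v) = (1::real)})"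
    by (intro compact_Int_closed compact_cube)
  moreover have "{w. \<forall>v. 0 \<le> w v \<and> w v \<le> 1} \<inter> {w. (\<Sum>v\<in>F. w v) = (1::real)} = W"
    unfolding W_def by auto
  ultimately have c1: "compact W" by simp
  obtain v0 where v0: "v0 \<in> F" using False by blast
  have "(\<lambda>v. if v = v0 then 1 else 0) \<in> W" unfolding W_def using v0 F(1) by simp
  then have c2: "W \<noteq> {}" by blast
  have c3: "continuous_on W (\<lambda>w. dot n (q w) (q w))"
    unfolding dot_def q_def
    by (intro continuous_intros continuous_on_subset[OF continuous_on_product_coordinates subset_UNIV])
  obtain w0 where w0: "w0 \<in> W" "\<forall>w\<in>W. dot n (q w0) (q w0) \<le> dot n (q w) (q w)"
    by (rule bexE[OF continuous_attains_inf[OF c1 c2 c3]]) (rule that)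
  have w0': "\<And>v. 0 \<le> w0 v" "\<And>v. w0 v \<le> 1" "(\<Sum>v\<in>F. w0 v) = 1" using w0(1) unfolding W_def by auto
  define Q where "Q = q w0"
  obtain y where y: "y \<in> S" "\<forall>k<n. y k = (\<Sum>v\<in>F. w0 v * v k)"
    using convex_coords_sum[OF S F, of w0] w0' by blast
  \<comment> \<open>The nearest hull point agrees below \<open>n\<close> with a point of
    \<open>S\<close>, hence differs from \<open>x\<close> there.\<close>
  obtain k0 where k0: "k0 < n" "Q k0 \<noteq> 0" using x y unfolding Q_def q_def by force
  have QQ: "0 < dot n Q Q"
    unfolding dot_def by (rule sum_pos2[of _ k0]) (use k0 in \<open>auto simp: zero_less_mult_iff\<close>)
  have key: "0 \<le> dot n Q (\<lambda>k. v k - x k - Q k)" if v: "v \<in> F" for v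
  proof -
    \<comment> \<open>\<open>D\<close> points from the nearest hull point \<open>x + Q\<close> to
      \<open>v\<close>. A fraction \<open>l\<close> of the way stays in the hull, so the squared
      distance to \<open>x\<close> cannot drop; its change divided by \<open>l\<close> is the
      quantity in \<open>ge\<close>.\<close>
    define D where "D = (\<lambda>k. v k - x k - Q k)"
    have ge: "0 \<le> 2 * dot n Q D + l * dot n D D" if l: "0 < l" "l \<le> 1" for l
    proof -
      define w where "w = (\<lambda>u. (1 - l) * w0 u + l * (if u = v then 1 else 0))"
      have "w \<in> W" unfolding W_def w_def
      proof (intro CollectI conjI allI)
        fix u
        show "0 \<le> (1 - l) * w0 u + l * (if u = v then 1 else 0)" using l w0' by simp
        have "(1 - l) * w0 u \<le> (1 - l) * 1" by (rule mult_left_mono) (use l w0' in auto)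
        then show "(1 - l) * w0 u + l * (if u = v then 1 else 0) \<le> 1" using l by auto
      next
        show "(\<Sum>u\<in>F. (1 - l) * w0 u + l * (if u = v then 1 else 0)) = 1"
          using v F(1) w0' by (simp add: sum.distrib flip: sum_distrib_left)
      qed
      have qw: "q w k = Q k + l * D k" for k
      proof -
        have "(\<Sum>u\<in>F. w u * u k) = (1 - l) * (\<Sum>u\<in>F. w0 u * u k) + l * v k"
        proof -
          have "(\<Sum>u\<in>F. w u * u k) = (\<Sum>u\<in>F. (1 - l) * (w0 u * u k) + l * (if u = v then v k else 0))"
            unfolding w_def by (rule sum.cong) (auto simp: algebra_simps)
          also have "\<dots> = (1 - l) * (\<Sum>u\<in>F. w0 u * u k) + l * (\<Sum>u\<in>F. if u = v then v k else 0)"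
            by (simp only: sum.distrib sum_distrib_left)
          also have "(\<Sum>u\<in>F. if u = v then v k else 0) = v k" using v F(1) by simp
          finally show ?thesis .
        qed
        then show ?thesis unfolding Q_def q_def D_def by (simp add: algebra_simps)
      qed
      have "dot n (q w) (q w) = dot n Q Q + l * (2 * dot n Q D + l * dot n D D)"
        unfolding dot_def qw by (simp add: algebra_simps sum.distrib sum_distrib_left)
      then have "0 \<le> l * (2 * dot n Q D + l * dot n D D)"
        using w0(2) \<open>w \<in> W\<close> unfolding Q_def by force
      then show ?thesis using l by (simp add: zero_le_mult_iff)
    qed
    have DD: "0 \<le> dot n D D" unfolding dot_def by (intro sum_nonneg) simp
    have "0 \<le> dot n Q D"
    proof (rule ccontr)
      assume neg: "\<not> 0 \<le> dot n Q D"
      \<comment> \<open>Small enough for the linear term to dominate the quadratic one; the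
        \<open>+ 1\<close> keeps the denominator positive.\<close>
      define l where "l = min 1 (- dot n Q D / (dot n D D + 1))"
      have "dot n Q D / (dot n D D + 1) < 0" by (rule divide_neg_pos) (use neg DD in linarith)+
      then have l: "0 < l" "l \<le> 1" unfolding l_def by simp_all
      have "l \<le> - dot n Q D / (dot n D D + 1)" unfolding l_def by simp
      then have "l * (dot n D D + 1) \<le> - dot n Q D"
        using DD pos_le_divide_eq[of "dot n D D + 1" l "- dot n Q D"] by linarith
      then show False using ge[OF l] l neg by (simp add: distrib_left)
    qed
    then show ?thesis unfolding D_def .
  qed
  define N where "N = sqrt (dot n Q Q)"
  have N: "N > 0" "N * N = dot n Q Q" using QQ unfolding N_def by auto
  \<comment> \<open>The normalised direction from the nearest hull point to \<open>x\<close>, cut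
    off at \<open>n\<close> to lie in \<open>unit_vectors n\<close>.\<close>
  define p where "p = (\<lambda>k. if k < n then - Q k / N else 0)"
  have dp: "dot n p r = - dot n Q r / N" for r
    unfolding dot_def p_def by (simp add: sum_negf sum_divide_distrib)
  have "dot n p p = 1"
  proof -
    have "dot n Q p = - dot n Q Q / N"
      unfolding dot_def p_def by (simp add: sum_negf sum_divide_distrib)
    also have "\<dots> = - N" using N(1) unfolding N(2)[symmetric] by simp
    finally show ?thesis unfolding dp using N(1) by simp
  qed
  then have "p \<in> unit_vectors n" unfolding unit_vectors_def by (simp add: p_def)
  moreover have "dot n p v \<le> dot n p x" if "v \<in> F" for v
  proof -
    have "dot n Q (\<lambda>k. v k - x k - Q k) = dot n Q v - dot n Q x - dot n Q Q"
      by (simp only: dot_diff)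
    then have "dot n Q x \<le> dot n Q v" using key[OF that] QQ by simp
    then show ?thesis unfolding dp using N by (simp add: divide_right_mono)
  qed
  ultimately show ?thesis by blast
qed

text \<open>No closedness is assumed, so the separation is only weak.\<close>

lemma weak_separation:
  assumes S: "convex_coords n S" and n: "0 < n" and x: "\<not> (\<exists>y\<in>S. \<forall>k<n. y k = x k)"
  shows "\<exists>p. (\<exists>k<n. p k \<noteq> 0) \<and> (\<forall>y\<in>S. dot n p y \<le> dot n p x)"
proof -
  let ?H = "\<lambda>y. {p. dot n p y \<le> dot n p x}"
  \<comment> \<open>Each point of \<open>S\<close> leaves a closed set of admissible unit
    functionals; any finitely many of these sets have a common member, and compactness of the sphere
    yields one for all of \<open>S\<close>.\<close>
  have "unit_vectors n \<inter> \<Inter> (?H ` S) \<noteq> {}"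
  proof (rule compact_imp_fip[OF compact_unit_vectors])
    fix T assume "T \<in> ?H ` S"
    moreover have "closed (?H y)" for y
      unfolding dot_def by (intro closed_Collect_le continuous_intros continuous_on_product_coordinates)
    ultimately show "closed T" by blast
  next
    fix F' assume "finite F'" "F' \<subseteq> ?H ` S"
    then obtain F where F: "F \<subseteq> S" "finite F" "F' = ?H ` F" using finite_subset_image[of F' ?H S] by auto
    obtain p where "p \<in> unit_vectors n" "\<forall>v\<in>F. dot n p v \<le> dot n p x"
      by (rule bexE[OF separation_finite[OF S F(2,1) n x]]) (rule that)
    then have "p \<in> unit_vectors n \<inter> \<Inter> F'" unfolding F(3) by simp
    then show "unit_vectors n \<inter> \<Inter> F' \<noteq> {}" by blast
  qed
  then obtain p where p: "p \<in> unit_vectors n" "\<forall>y\<in>S. dot n p y \<le> dot n p x" by blast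
  have "\<exists>k<n. p k \<noteq> 0"
  proof (rule ccontr)
    assume "\<not> ?thesis"
    then have "dot n p p = 0" unfolding dot_def by simp
    then show False using p(1) unfolding unit_vectors_def by simp
  qed
  then show ?thesis using p(2) by blast
qed

section \<open>Moments of bounded densities\<close>

text \<open>The \<open>k\<close>-th moment, with weight \<open>(t - x)\<^sup>k\<close>, of the step function with value \<open>\<epsilon> i\<close> on
  \<open>(s i, s (i + 1))\<close>.\<close>

definition step_moment :: "nat \<Rightarrow> real \<Rightarrow> (nat \<Rightarrow> real) \<Rightarrow> (nat \<Rightarrow> real) \<Rightarrow> nat \<Rightarrow> real" where
  "step_moment n t s \<epsilon> k = (\<Sum>i<n. \<epsilon> i * (((t - s i) ^ Suc k - (t - s (Suc i)) ^ Suc k) / Suc k))"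

lemma power_has_integral:
  assumes "a \<le> b"
  shows "((\<lambda>x. (t - x) ^ k) has_integral (((t - a) ^ Suc k - (t - b) ^ Suc k) / Suc k)) {a..b :: real}"
proof -
  have "((\<lambda>x. (t - x) ^ k) has_integral (- ((t - b) ^ Suc k / Suc k) - - ((t - a) ^ Suc k / Suc k))) {a..b}"
  proof (rule fundamental_theorem_of_calculus[OF assms])
    fix x assume "x \<in> {a..b}"
    have "((\<lambda>x. - ((t - x) ^ Suc k / Suc k)) has_real_derivative (t - x) ^ k) (at x within {a..b})"
      by (rule derivative_eq_intros refl | simp del: power_Suc of_nat_Suc)+
    then show "((\<lambda>x. - ((t - x) ^ Suc k / Suc k)) has_vector_derivative (t - x) ^ k) (at x within {a..b})"
      by (simp only: has_real_derivative_iff_has_vector_derivative)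
  qed
  then show ?thesis by (simp add: diff_divide_distrib del: power_Suc of_nat_Suc)
qed

text \<open>The values of \<open>f\<close> at the breakpoints stay free, since finite sets do not
  affect the integral. The inequality \<open>s 0 \<le> s n\<close> is carried along for joining
  adjacent intervals.\<close>

lemma step_has_integral:
  assumes "\<And>i. i < n \<Longrightarrow> s i \<le> s (Suc i)"
    and "\<And>i x. i < n \<Longrightarrow> s i < x \<Longrightarrow> x < s (Suc i) \<Longrightarrow> f x = \<epsilon> i"
  shows "s 0 \<le> s n \<and> ((\<lambda>x. (t - x) ^ k * f x) has_integral step_moment n t s \<epsilon> k) {s 0..s n}"
  using assms
proof (induction n)
  case 0
  then show ?case using has_integral_refl(2) by (simp add: step_moment_def)
next
  case (Suc n)
  then have IH: "s 0 \<le> s n" "((\<lambda>x. (t - x) ^ k * f x) has_integral step_moment n t s \<epsilon> k) {s 0..s n}"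
    by auto
  have le: "s n \<le> s (Suc n)" using Suc.prems by simp
  have "((\<lambda>x. (t - x) ^ k * \<epsilon> n) has_integral
      ((((t - s n) ^ Suc k - (t - s (Suc n)) ^ Suc k) / Suc k) * \<epsilon> n)) {s n..s (Suc n)}"
    by (rule has_integral_mult_left[OF power_has_integral[OF le]])
  then have "((\<lambda>x. (t - x) ^ k * f x) has_integral
      ((((t - s n) ^ Suc k - (t - s (Suc n)) ^ Suc k) / Suc k) * \<epsilon> n)) {s n..s (Suc n)}"
    by (rule has_integral_spike_finite[where S = "{s n, s (Suc n)}", rotated 2])
      (use Suc.prems(2)[of n] in auto)
  from has_integral_combine[OF IH(1) le IH(2) this] IH(1) le show ?case
    by (simp add: step_moment_def mult.commute del: power_Suc of_nat_Suc)
qed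

text \<open>The base value \<open>\<epsilon> 0\<close> keeps the range among the
  \<open>\<epsilon> i\<close> even to the left of \<open>s 0\<close>.\<close>

fun step_fun :: "(nat \<Rightarrow> real) \<Rightarrow> (nat \<Rightarrow> real) \<Rightarrow> nat \<Rightarrow> real \<Rightarrow> real" where
  "step_fun s \<epsilon> 0 x = \<epsilon> 0"
| "step_fun s \<epsilon> (Suc n) x = (if s n \<le> x then \<epsilon> n else step_fun s \<epsilon> n x)"

lemma step_fun_in: "0 < n \<Longrightarrow> \<exists>i<n. step_fun s \<epsilon> n x = \<epsilon> i"
proof (induction n)
  case (Suc n)
  then show ?case by (cases "n = 0") (auto intro: less_SucI)
qed simp

lemma step_fun_measurable: "step_fun s \<epsilon> n \<in> borel_measurable borel"
  by (induction n) (simp_all add: fun_eq_iff[symmetric] cong: measurable_cong)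

lemma le_last_of_chain:
  assumes "\<And>j. j < n \<Longrightarrow> s j \<le> s (Suc j)" "i \<le> n"
  shows "s i \<le> (s n :: real)"
  using assms(2)
proof (induction rule: inc_induct)
  case (step j)
  then show ?case using assms(1)[of j] by linarith
qed simp

lemma step_fun_eq:
  assumes "\<And>i. i < n \<Longrightarrow> s i \<le> s (Suc i)" "i < n" "s i < x" "x < s (Suc i)"
  shows "step_fun s \<epsilon> n x = \<epsilon> i"
  using assms
proof (induction n)
  case (Suc n)
  show ?case
  proof (cases "i = n")
    case True
    then show ?thesis using Suc.prems by simp
  next
    case False
    then have "i < n" using Suc.prems by simp
    have "s (Suc i) \<le> s n"
      by (rule le_last_of_chain) (use Suc.prems(1) \<open>i < n\<close> in auto)
    then have "\<not> s n \<le> x" using Suc.prems by simp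
    then show ?thesis using Suc.IH \<open>i < n\<close> Suc.prems by simp
  qed
qed simp

text \<open>Exactly \<open>n\<close> pieces are produced, degenerate ones filling up the number,
  because the final formula needs a fixed number of switching times.\<close>

lemma poly_partition:
  fixes Q :: "real poly"
  assumes "Q \<noteq> 0" "a \<le> b" "card {x. a < x \<and> x < b \<and> poly Q x = 0} < n"
  shows "\<exists>s. s 0 = a \<and> s n = b \<and> (\<forall>i<n. s i \<le> s (Suc i)) \<and>
    (\<forall>i<n. \<forall>x. s i < x \<longrightarrow> x < s (Suc i) \<longrightarrow> poly Q x \<noteq> 0)"
  using assms(2-)
proof (induction n arbitrary: a)
  case 0
  then show ?case by simp
next
  case (Suc n)
  let ?R = "\<lambda>a. {x. a < x \<and> x < b \<and> poly Q x = 0}"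
  have fin: "finite (?R a)" for a
    by (rule finite_subset[OF _ poly_roots_finite[OF assms(1)]]) auto
  show ?case
  proof (cases "?R a = {}")
    \<comment> \<open>Without roots one piece suffices; the others shrink to the point
      \<open>b\<close>.\<close>
    case True
    then show ?thesis using Suc.prems(1)
      by (intro exI[of _ "\<lambda>i. if i = 0 then a else b"]) auto
  next
    case False
    define z where "z = Min (?R a)"
    have z: "a < z" "z < b" "poly Q z = 0" using Min_in[OF fin False] unfolding z_def by auto
    have min: "\<not> (a < x \<and> x < z \<and> poly Q x = 0)" for x
      using Min_le[OF fin, of x a] z unfolding z_def[symmetric] by force
    have "?R z \<subset> ?R a" using z by auto
    then have "card (?R z) < card (?R a)" using fin by (intro psubset_card_mono)
    then obtain s where s: "s 0 = z" "s n = b" "\<forall>i<n. s i \<le> s (Suc i)"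
      "\<forall>i<n. \<forall>x. s i < x \<longrightarrow> x < s (Suc i) \<longrightarrow> poly Q x \<noteq> 0"
      using Suc.IH[of z] Suc.prems z by auto
    let ?s = "case_nat a s"
    have "?s i \<le> ?s (Suc i)" if "i < Suc n" for i
      using that s z by (cases i) auto
    moreover have "poly Q x \<noteq> 0" if "i < Suc n" "?s i < x" "x < ?s (Suc i)" for i x
      using that s min by (cases i) auto
    ultimately show ?thesis using s by (intro exI[of _ ?s]) auto
  qed
qed

section \<open>Controls and their moment vectors\<close>

definition controls :: "real \<Rightarrow> real \<Rightarrow> real \<Rightarrow> (real \<Rightarrow> real) set" where
  "controls t a b = {u \<in> borel_measurable (lebesgue_on {0..t}). \<forall>x\<in>{0..t}. a \<le> u x \<and> u x \<le> b}"

lemma controlsD: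
  assumes "u \<in> controls t a b"
  shows "u \<in> borel_measurable (lebesgue_on {0..t})" "x \<in> {0..t} \<Longrightarrow> a \<le> u x" "x \<in> {0..t} \<Longrightarrow> u x \<le> b"
  using assms unfolding controls_def by blast+

lemma controls_integrable:
  assumes "u \<in> controls t a b"
  shows "(\<lambda>x. (t - x) ^ k * u x) integrable_on {0..t}"
proof (rule measurable_bounded_by_integrable_imp_integrable[where g = "\<lambda>_. t ^ k * (\<bar>a\<bar> + \<bar>b\<bar>)"])
  have "(\<lambda>x. (t - x) ^ k) \<in> borel_measurable (lebesgue_on {0..t})"
    by (intro continuous_imp_measurable_on_sets_lebesgue continuous_intros) simp
  then show "(\<lambda>x. (t - x) ^ k * u x) \<in> borel_measurable (lebesgue_on {0..t})"
    using assms unfolding controls_def by (intro borel_measurable_times) auto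
  show "(\<lambda>_. t ^ k * (\<bar>a\<bar> + \<bar>b\<bar>)) integrable_on {0..t}"
    using integrable_const_ivl by blast
  fix x assume x: "x \<in> {0..t}"
  then have "\<bar>u x\<bar> \<le> \<bar>a\<bar> + \<bar>b\<bar>" using assms unfolding controls_def by force
  moreover have "\<bar>(t - x) ^ k\<bar> \<le> t ^ k" using x by (simp add: power_mono)
  ultimately show "norm ((t - x) ^ k * u x) \<le> t ^ k * (\<bar>a\<bar> + \<bar>b\<bar>)"
    using x by (auto simp: abs_mult intro!: mult_mono)
qed simp

text \<open>Entries of \<open>c\<close> from \<open>n\<close> on are unconstrained, so a whole
  environment can stand for \<open>c\<close>.\<close>

definition moment_set :: "nat \<Rightarrow> real \<Rightarrow> real \<Rightarrow> real \<Rightarrow> (nat \<Rightarrow> real) set" where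
  "moment_set n t a b = {c. \<exists>u\<in>controls t a b. \<forall>k<n. c k = integral {0..t} (\<lambda>x. (t - x) ^ k * u x)}"

lemma moment_set_cong:
  assumes "y \<in> moment_set n t a b" "\<forall>k<n. c k = y k"
  shows "c \<in> moment_set n t a b"
  using assms unfolding moment_set_def by simp

lemma convex_coords_moment_set: "convex_coords n (moment_set n t a b)"
  unfolding convex_coords_def
proof (intro ballI)
  fix y z l assume "y \<in> moment_set n t a b" "z \<in> moment_set n t a b" and l: "l \<in> {0..1::real}"
  then obtain u v where u: "u \<in> controls t a b" "\<forall>k<n. y k = integral {0..t} (\<lambda>x. (t - x) ^ k * u x)"
    and v: "v \<in> controls t a b" "\<forall>k<n. z k = integral {0..t} (\<lambda>x. (t - x) ^ k * v x)"
    unfolding moment_set_def by blast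
  let ?w = "\<lambda>x. (1 - l) * u x + l * v x"
  have bd: "a \<le> (1 - l) * p + l * q \<and> (1 - l) * p + l * q \<le> b" if "a \<le> p \<and> p \<le> b" "a \<le> q \<and> q \<le> b" for p q
  proof -
    have "(1 - l) * a \<le> (1 - l) * p" "l * a \<le> l * q" "(1 - l) * p \<le> (1 - l) * b" "l * q \<le> l * b"
      using that l by (auto intro: mult_left_mono)
    then show ?thesis by (simp add: algebra_simps)
  qed
  have w: "?w \<in> controls t a b"
    using u(1) v(1) bd unfolding controls_def by auto
  define c where "c = (\<lambda>k. integral {0..t} (\<lambda>x. (t - x) ^ k * ?w x))"
  have "c \<in> moment_set n t a b" unfolding moment_set_def c_def by (intro CollectI bexI[OF _ w]) simp
  moreover have "\<forall>k<n. c k = (1 - l) * y k + l * z k"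
  proof (intro allI impI)
    fix k assume k: "k < n"
    have "c k = integral {0..t} (\<lambda>x. (1 - l) * ((t - x) ^ k * u x) + l * ((t - x) ^ k * v x))"
      unfolding c_def by (rule integral_cong) (simp add: algebra_simps)
    also have "\<dots> = (1 - l) * integral {0..t} (\<lambda>x. (t - x) ^ k * u x) + l * integral {0..t} (\<lambda>x. (t - x) ^ k * v x)"
      by (intro integral_unique has_integral_add has_integral_mult_right integrable_integral
          controls_integrable[OF u(1)] controls_integrable[OF v(1)])
    finally show "c k = (1 - l) * y k + l * z k" using u v k by simp
  qed
  ultimately show "\<exists>w\<in>moment_set n t a b. \<forall>k<n. w k = (1 - l) * y k + l * z k"
    by (intro bexI[of _ c])
qed

text \<open>Repeated times and repeated values are allowed, so inputs with fewer switches and either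
  initial value fit one pattern.\<close>

definition switching :: "nat \<Rightarrow> real \<Rightarrow> real \<Rightarrow> real \<Rightarrow> (nat \<Rightarrow> real) \<Rightarrow> (nat \<Rightarrow> real) \<Rightarrow> bool" where
  "switching n t a b s \<epsilon> \<longleftrightarrow> s 0 = 0 \<and> s n = t \<and> (\<forall>i<n. s i \<le> s (Suc i)) \<and> (\<forall>i<n. \<epsilon> i = a \<or> \<epsilon> i = b)"

lemma step_moment_in_moment_set:
  assumes "0 < n" "a \<le> b" "switching n t a b s \<epsilon>"
  shows "step_moment n t s \<epsilon> \<in> moment_set n t a b"
proof -
  let ?u = "step_fun s \<epsilon> n"
  have "?u \<in> borel_measurable (lebesgue_on {0..t})"
    by (intro measurable_restrict_space1 measurable_completion) (simp add: step_fun_measurable)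
  moreover have "a \<le> ?u x \<and> ?u x \<le> b" for x
    using step_fun_in[OF assms(1), of s \<epsilon> x] assms(2,3) unfolding switching_def by auto
  ultimately have "?u \<in> controls t a b" unfolding controls_def by blast
  moreover have "step_moment n t s \<epsilon> k = integral {0..t} (\<lambda>x. (t - x) ^ k * ?u x)" for k
  proof -
    have s: "s 0 = 0" "s n = t" "\<And>i. i < n \<Longrightarrow> s i \<le> s (Suc i)" using assms(3) unfolding switching_def by auto
    from step_has_integral[of n s ?u \<epsilon> t k, OF s(3) step_fun_eq[of n s, OF s(3)]] s(1,2)
    have "((\<lambda>x. (t - x) ^ k * ?u x) has_integral step_moment n t s \<epsilon> k) {0..t}" by simp
    then show ?thesis by (rule integral_unique[symmetric])
  qed
  ultimately show ?thesis unfolding moment_set_def by (intro CollectI rev_bexI) auto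
qed

text \<open>For nonnegative integrands the gauge integral is a Lebesgue integral, where integral
  zero forces vanishing almost everywhere.\<close>

lemma negligible_nonneg_has_integral_0:
  fixes f :: "real \<Rightarrow> real"
  assumes nonneg: "\<And>x. x \<in> S \<Longrightarrow> 0 \<le> f x" and int: "(f has_integral 0) S"
  shows "negligible {x \<in> S. f x \<noteq> 0}"
proof -
  have af: "f absolutely_integrable_on S"
    using absolutely_integrable_on_iff_nonneg[of S f] nonneg has_integral_integrable[OF int] by simp
  have "(LINT x:S|lebesgue. f x) = integral S f"
    by (rule set_lebesgue_integral_eq_integral(2)[OF af])
  also have "\<dots> = 0" by (rule integral_unique[OF int])
  finally have "(LINT x|lebesgue. indicat_real S x *\<^sub>R f x) = 0"
    unfolding set_lebesgue_integral_def .
  then have "AE x in lebesgue. indicat_real S x *\<^sub>R f x = 0"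
    by (subst (asm) integral_nonneg_eq_0_iff_AE)
      (use af nonneg in \<open>auto simp: set_integrable_def indicator_def\<close>)
  then obtain N where N: "negligible N" "{x. \<not> indicat_real S x *\<^sub>R f x = 0} \<subseteq> N"
    unfolding eventually_ae_filter_negligible by blast
  have "{x \<in> S. f x \<noteq> 0} \<subseteq> N" using N(2) by (auto simp: indicator_def)
  then show ?thesis by (rule negligible_subset[OF N(1)])
qed

text \<open>The maximiser of a nonzero linear functional over the controls is bang-bang and unique
  up to null sets, since the corresponding polynomial has finitely many zeros.\<close>

lemma moment_maximiser:
  assumes n: "0 < n" and t: "0 \<le> t" and ab: "a \<le> b" and c: "c \<in> moment_set n t a b" and p: "\<exists>k<n. p k \<noteq> 0"
  shows "\<exists>s \<epsilon>. switching n t a b s \<epsilon> \<and>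
    (dot n p c < dot n p (step_moment n t s \<epsilon>) \<or> (\<forall>k<n. c k = step_moment n t s \<epsilon> k))"
proof -
  obtain u where u: "u \<in> controls t a b" "\<And>k. k < n \<Longrightarrow> c k = integral {0..t} (\<lambda>x. (t - x) ^ k * u x)"
    using c unfolding moment_set_def by blast
  define P where "P = (\<Sum>k<n. monom (p k) k)"
  \<comment> \<open>With \<open>Q x = P (t - x)\<close>, the functional \<open>p\<close> on moments
    is integration of the control against \<open>Q\<close>.\<close>
  define Q where "Q = pcompose P [:t, -1:]"
  have Pc: "coeff P k = (if k < n then p k else 0)" for k
    unfolding P_def by (simp add: coeff_sum sum.delta if_distrib cong: if_cong)
  have Qx: "poly Q x = (\<Sum>k<n. p k * (t - x) ^ k)" for x
    unfolding Q_def P_def by (simp add: poly_pcompose poly_sum poly_monom)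
  have "P \<noteq> 0" using p Pc by (metis coeff_0)
  then have Q0: "Q \<noteq> 0" unfolding Q_def by (simp add: pcompose_eq_0_iff)
  have "degree P \<le> n - 1" by (rule degree_le) (use Pc in auto)
  then have "degree Q \<le> n - 1" unfolding Q_def by (simp add: degree_pcompose)
  then have "card {x. poly Q x = 0} < n" using card_poly_roots_bound[OF Q0] n by simp
  then have "card {x. 0 < x \<and> x < t \<and> poly Q x = 0} < n"
    by (rule le_less_trans[rotated]) (intro card_mono poly_roots_finite[OF Q0], auto)
  from poly_partition[OF Q0 t this] obtain s where s: "s 0 = 0" "s n = t" "\<forall>i<n. s i \<le> s (Suc i)"
    "\<forall>i<n. \<forall>x. s i < x \<longrightarrow> x < s (Suc i) \<longrightarrow> poly Q x \<noteq> 0"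
    by (elim exE conjE) (rule that)
  \<comment> \<open>Pointwise maximiser of \<open>poly Q x * v\<close> over \<open>v\<close> in
    \<open>[a, b]\<close>.\<close>
  define w where "w x = (if poly Q x > 0 then b else a)" for x
  \<comment> \<open>The sign of \<open>Q\<close> is constant on each piece, so the midpoint
    represents it; degenerate pieces also receive \<open>a\<close> or \<open>b\<close>, as
    \<open>switching\<close> demands.\<close>
  define \<epsilon> where "\<epsilon> i = w ((s i + s (Suc i)) / 2)" for i
  have w\<epsilon>: "w x = \<epsilon> i" if i: "i < n" and x: "s i < x" "x < s (Suc i)" for i x
  proof -
    have nz: "poly Q y \<noteq> 0" if "s i < y" "y < s (Suc i)" for y using s(4) i that by blast
    let ?m = "(s i + s (Suc i)) / 2"
    have m: "s i < ?m" "?m < s (Suc i)" using x by auto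
    have "sgn (poly Q x) = sgn (poly Q ?m)"
    proof (rule sgn_poly_cell[where Z = "{z. poly Q z = 0}"])
      fix z assume "z \<in> {z. poly Q z = 0}"
      then have "z \<le> s i \<or> s (Suc i) \<le> z" using nz[of z] not_le by blast
      then show "sgn (x - z) = sgn (?m - z)" using x m by (auto simp: sgn_diff_real simp del: less_divide_eq_numeral1 divide_less_eq_numeral1)
    qed simp
    then have "(poly Q x > 0) = (poly Q ?m > 0)" by (metis sgn_1_pos)
    then show ?thesis unfolding w_def \<epsilon>_def by simp
  qed
  have sw: "switching n t a b s \<epsilon>"
    using s unfolding switching_def \<epsilon>_def w_def by auto
  have wint: "((\<lambda>x. (t - x) ^ k * w x) has_integral step_moment n t s \<epsilon> k) {0..t}" for k
    using step_has_integral[of n s w \<epsilon> t k] w\<epsilon> s by auto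
  have uint: "((\<lambda>x. (t - x) ^ k * u x) has_integral c k) {0..t}" if "k < n" for k
    using integrable_integral[OF controls_integrable[OF u(1)]] u(2)[OF that] by simp
  have diff: "((\<lambda>x. poly Q x * (w x - u x)) has_integral
      (dot n p (step_moment n t s \<epsilon>) - dot n p c)) {0..t}"
  proof -
    have "((\<lambda>x. \<Sum>k<n. p k * ((t - x) ^ k * w x - (t - x) ^ k * u x)) has_integral
        (\<Sum>k<n. p k * (step_moment n t s \<epsilon> k - c k))) {0..t}"
      by (intro has_integral_sum has_integral_mult_right has_integral_diff wint uint) auto
    moreover have "(\<Sum>k<n. p k * ((t - x) ^ k * w x - (t - x) ^ k * u x)) = poly Q x * (w x - u x)" for x
      unfolding Qx by (simp add: algebra_simps sum_subtractf sum_distrib_left)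
    moreover have "(\<Sum>k<n. p k * (step_moment n t s \<epsilon> k - c k)) = dot n p (step_moment n t s \<epsilon>) - dot n p c"
      unfolding dot_def by (simp add: algebra_simps sum_subtractf)
    ultimately show ?thesis by simp
  qed
  have nonneg: "0 \<le> poly Q x * (w x - u x)" if "x \<in> {0..t}" for x
    using u(1) that unfolding controls_def w_def
    by (auto simp: zero_le_mult_iff)
  have "0 \<le> dot n p (step_moment n t s \<epsilon>) - dot n p c"
    by (rule has_integral_nonneg[OF diff nonneg])
  moreover have "\<forall>k<n. c k = step_moment n t s \<epsilon> k" if eq: "dot n p (step_moment n t s \<epsilon>) - dot n p c = 0"
  proof -
    have "negligible {x \<in> {0..t}. poly Q x * (w x - u x) \<noteq> 0}"
      by (rule negligible_nonneg_has_integral_0[OF nonneg]) (use diff eq in auto)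
    \<comment> \<open>Within \<open>[0, t]\<close> and off this null set, \<open>Q\<close> is
      nonzero and the product vanishes, so \<open>u\<close> equals \<open>w\<close>; hence all
      moments agree, not only their combination along \<open>p\<close>.\<close>
    then have neg: "negligible ({x \<in> {0..t}. poly Q x * (w x - u x) \<noteq> 0} \<union> {x. poly Q x = 0})"
      by (rule negligible_Un) (intro negligible_finite poly_roots_finite[OF Q0])
    have ck: "((\<lambda>x. (t - x) ^ k * w x) has_integral c k) {0..t}" if "k < n" for k
      by (rule has_integral_spike[OF neg _ uint[OF that]]) auto
    show ?thesis by (intro allI impI has_integral_unique[OF ck wint])
  qed
  ultimately have "dot n p c < dot n p (step_moment n t s \<epsilon>) \<or> (\<forall>k<n. c k = step_moment n t s \<epsilon> k)"
    by (cases "dot n p c < dot n p (step_moment n t s \<epsilon>)") simp_all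
  then show ?thesis using sw by (intro exI conjI)
qed

text \<open>Only initial segments of \<open>p\<close>, \<open>s\<close> and
  \<open>\<epsilon>\<close> matter, so the quantifier over measurable functions has been replaced by
  quantifiers over finitely many reals.\<close>

theorem moment_set_iff:
  assumes n: "0 < n" and t: "0 \<le> t" and ab: "a \<le> b"
  shows "c \<in> moment_set n t a b \<longleftrightarrow> (\<forall>p. (\<exists>k<n. p k \<noteq> 0) \<longrightarrow> (\<exists>s \<epsilon>. switching n t a b s \<epsilon> \<and>
    (dot n p c < dot n p (step_moment n t s \<epsilon>) \<or> (\<forall>k<n. c k = step_moment n t s \<epsilon> k))))"
    (is "_ \<longleftrightarrow> ?R")
proof
  assume "c \<in> moment_set n t a b"
  then show ?R by (intro allI impI moment_maximiser[OF n t ab])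
next
  assume R: ?R
  show "c \<in> moment_set n t a b"
  proof (rule ccontr)
    assume not: "c \<notin> moment_set n t a b"
    then have away: "\<not> (\<exists>y\<in>moment_set n t a b. \<forall>k<n. y k = c k)"
      using moment_set_cong[of _ n t a b c] by (metis (no_types))
    obtain p where sep: "(\<exists>k<n. p k \<noteq> 0) \<and> (\<forall>y\<in>moment_set n t a b. dot n p y \<le> dot n p c)"
      using weak_separation[OF convex_coords_moment_set n away] by (rule exE)
    note p = conjunct1[OF sep] conjunct2[OF sep]
    obtain s \<epsilon> where s: "switching n t a b s \<epsilon>"
      "dot n p c < dot n p (step_moment n t s \<epsilon>) \<or> (\<forall>k<n. c k = step_moment n t s \<epsilon> k)"
      using R[rule_format, OF p(1)] by (elim exE conjE) (rule that)
    have m: "step_moment n t s \<epsilon> \<in> moment_set n t a b" by (rule step_moment_in_moment_set[OF n ab s(1)])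
    from leD[OF bspec[OF p(2) m]] s(2) have "\<forall>k<n. c k = step_moment n t s \<epsilon> k" by (simp only: simp_thms)
    from not moment_set_cong[OF m this] show False by (rule notE)
  qed
qed

section \<open>Chains of integrators\<close>

lemma has_integral_power_div_fact:
  assumes "x \<le> s"
  shows "((\<lambda>\<tau>. (\<tau> - x) ^ k / fact k) has_integral ((s - x) ^ Suc k / fact (Suc k))) {x..s :: real}"
proof -
  have "((\<lambda>\<tau>. (\<tau> - x) ^ k / fact k) has_integral
      ((s - x) ^ Suc k / fact (Suc k) - (x - x) ^ Suc k / fact (Suc k))) {x..s}"
  proof (rule fundamental_theorem_of_calculus[OF assms])
    fix y
    have "((\<lambda>\<tau>. (\<tau> - x) ^ Suc k / fact (Suc k)) has_real_derivative
        (real (Suc k) * (y - x) ^ k / fact (Suc k))) (at y within {x..s})"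
      by (rule derivative_eq_intros refl | simp del: power_Suc of_nat_Suc fact_Suc)+
    then show "((\<lambda>\<tau>. (\<tau> - x) ^ Suc k / fact (Suc k)) has_vector_derivative (y - x) ^ k / fact k) (at y within {x..s})"
      by (simp add: has_real_derivative_iff_has_vector_derivative del: power_Suc of_nat_Suc)
  qed
  then show ?thesis by simp
qed

text \<open>Fubini on the triangle \<open>0 \<le> x \<le> \<tau> \<le> s\<close>: integrating first
  over \<open>\<tau>\<close> raises the power of \<open>s - x\<close> by one. Taking
  \<open>v\<close> Borel gives joint measurability on the product.\<close>

lemma iterated_integral_borel:
  fixes v :: "real \<Rightarrow> real"
  assumes v[measurable]: "v \<in> borel_measurable borel" and bd: "\<And>x. \<bar>v x\<bar> \<le> C" and s: "0 \<le> s"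
  shows "((\<lambda>\<tau>. integral {0..\<tau>} (\<lambda>x. (\<tau> - x) ^ k / fact k * v x)) has_integral
    integral {0..s} (\<lambda>x. (s - x) ^ Suc k / fact (Suc k) * v x)) {0..s}"
proof -
  \<comment> \<open>Extension by 0 off the triangle lets both orders of integration run over the
    whole plane.\<close>
  define F where "F \<tau> x = (if 0 \<le> x \<and> x \<le> \<tau> \<and> \<tau> \<le> s then (\<tau> - x) ^ k / fact k * v x else 0)" for \<tau> x
  have C: "0 \<le> C" using bd[of 0] by linarith
  have F_bd: "\<bar>F \<tau> x\<bar> \<le> s ^ k * C" for \<tau> x
  proof (cases "0 \<le> x \<and> x \<le> \<tau> \<and> \<tau> \<le> s")
    case True
    have "\<bar>(\<tau> - x) ^ k / fact k\<bar> \<le> (\<tau> - x) ^ k / 1"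
      using True by (simp add: frac_le abs_mult del: div_by_1)
    also have "\<dots> \<le> s ^ k" using True by (simp add: power_mono)
    finally have "\<bar>(\<tau> - x) ^ k / fact k\<bar> * \<bar>v x\<bar> \<le> s ^ k * C"
      by (intro mult_mono bd) (use s in auto)
    then show ?thesis unfolding F_def if_P[OF True] abs_mult .
  next
    case False
    show ?thesis unfolding F_def if_not_P[OF False] using C s by simp
  qed
  have F_meas: "(\<lambda>(\<tau>, x). F \<tau> x) \<in> borel_measurable (lborel \<Otimes>\<^sub>M lborel)"
    unfolding F_def split_beta by measurable
  have int: "integrable (lborel \<Otimes>\<^sub>M lborel) (\<lambda>(\<tau>, x). F \<tau> x)"
  proof (rule integrableI_bounded_set[where A = "{0..s} \<times> {0..s}" and B = "s ^ k * C"])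
    show "emeasure (lborel \<Otimes>\<^sub>M lborel) ({0..s} \<times> {0..s}) < \<infinity>"
      by (subst lborel.emeasure_pair_measure_Times) (simp_all add: emeasure_lborel_Icc[OF s] ennreal_mult_less_top)
    show "AE x\<in>{0..s} \<times> {0..s} in lborel \<Otimes>\<^sub>M lborel. norm (case x of (\<tau>, x) \<Rightarrow> F \<tau> x) \<le> s ^ k * C"
      by (rule AE_I2) (auto simp: F_bd)
    show "AE x in lborel \<Otimes>\<^sub>M lborel. x \<notin> {0..s} \<times> {0..s} \<longrightarrow> (case x of (\<tau>, x) \<Rightarrow> F \<tau> x) = 0"
      by (rule AE_I2) (auto simp: F_def split: if_splits)
  qed (use F_meas in simp_all)
  have inner1: "(\<integral>x. F \<tau> x \<partial>lborel) = indicator {0..s} \<tau> *\<^sub>R integral {0..\<tau>} (\<lambda>x. (\<tau> - x) ^ k / fact k * v x)" for \<tau>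
  proof (cases "\<tau> \<in> {0..s}")
    case True
    have eq: "F \<tau> x = indicator {0..\<tau>} x *\<^sub>R ((\<tau> - x) ^ k / fact k * v x)" for x
      using True unfolding F_def by (auto simp: indicator_def)
    have "set_integrable lborel {0..\<tau>} (\<lambda>x. (\<tau> - x) ^ k / fact k * v x)"
      unfolding set_integrable_def
    proof (rule integrableI_bounded_set[where A = "{0..\<tau>}" and B = "s ^ k * C"])
      show "AE x\<in>{0..\<tau>} in lborel. norm (indicat_real {0..\<tau>} x *\<^sub>R ((\<tau> - x) ^ k / fact k * v x)) \<le> s ^ k * C"
        by (rule AE_I2, rule impI, subst eq[symmetric], unfold real_norm_def, rule F_bd)
    qed (auto simp: emeasure_lborel_Icc_eq)
    from set_borel_integral_eq_integral(2)[OF this] show ?thesis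
      using True unfolding eq set_lebesgue_integral_def by simp
  next
    case False
    then have "F \<tau> x = 0" for x unfolding F_def by auto
    then show ?thesis using False by simp
  qed
  have inner2: "(\<integral>\<tau>. F \<tau> x \<partial>lborel) = indicator {0..s} x *\<^sub>R ((s - x) ^ Suc k / fact (Suc k) * v x)" for x
  proof (cases "x \<in> {0..s}")
    case True
    have eq: "F \<tau> x = (indicator {x..s} \<tau> *\<^sub>R ((\<tau> - x) ^ k / fact k)) * v x" for \<tau>
      using True unfolding F_def by (auto simp: indicator_def)
    have "set_integrable lborel {x..s} (\<lambda>\<tau>. (\<tau> - x) ^ k / fact k)"
      by (intro borel_integrable_atLeastAtMost' continuous_intros) auto
    from set_borel_integral_eq_integral(2)[OF this]
    have "(LINT \<tau>:{x..s}|lborel. (\<tau> - x) ^ k / fact k) = (s - x) ^ Suc k / fact (Suc k)"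
      using integral_unique[OF has_integral_power_div_fact[of x s k]] True by simp
    then show ?thesis
      using True unfolding eq set_lebesgue_integral_def
      by (simp only: integral_mult_left_zero indicator_simps) simp
  next
    case False
    then have "F \<tau> x = 0" for \<tau> unfolding F_def by auto
    then show ?thesis using False by simp
  qed
  have i1: "set_integrable lborel {0..s} (\<lambda>\<tau>. integral {0..\<tau>} (\<lambda>x. (\<tau> - x) ^ k / fact k * v x))"
    using lborel_pair.integrable_fst[of F, OF int] unfolding set_integrable_def inner1 .
  have i2: "set_integrable lborel {0..s} (\<lambda>x. (s - x) ^ Suc k / fact (Suc k) * v x)"
    using lborel_pair.integrable_snd[of F, OF int] unfolding set_integrable_def inner2 .
  have "(\<integral>x. (\<integral>\<tau>. F \<tau> x \<partial>lborel) \<partial>lborel) = (\<integral>\<tau>. (\<integral>x. F \<tau> x \<partial>lborel) \<partial>lborel)"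
    by (rule lborel_pair.Fubini_integral[OF int])
  then have fub: "(LINT x:{0..s}|lborel. (s - x) ^ Suc k / fact (Suc k) * v x) =
      (LINT \<tau>:{0..s}|lborel. integral {0..\<tau>} (\<lambda>x. (\<tau> - x) ^ k / fact k * v x))"
    unfolding inner1 inner2 set_lebesgue_integral_def .
  note a1 = set_borel_integral_eq_integral[OF i1] and a2 = set_borel_integral_eq_integral[OF i2]
  show ?thesis
    using integrable_integral[OF a1(1)] unfolding a1(2)[symmetric] a2(2)[symmetric] fub .
qed

text \<open>By Cauchy's formula, the (k+1)-fold iterated integral of \<open>u\<close> from
  0.\<close>

definition iter_int :: "nat \<Rightarrow> (real \<Rightarrow> real) \<Rightarrow> real \<Rightarrow> real" where
  "iter_int k u s = integral {0..s} (\<lambda>x. (s - x) ^ k / fact k * u x)"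

text \<open>A Lebesgue measurable function agrees almost everywhere with a Borel one; clipping at
  \<open>C\<close> makes the bound hold everywhere without changing values that a control can
  take.\<close>

lemma controls_borel_version:
  assumes u: "u \<in> controls t a b"
  shows "\<exists>v C N. v \<in> borel_measurable borel \<and> (\<forall>x. \<bar>v x\<bar> \<le> C) \<and> negligible N \<and> (\<forall>x\<in>{0..t} - N. u x = v x)"
proof -
  define C where "C = \<bar>a\<bar> + \<bar>b\<bar>"
  let ?f = "\<lambda>x. if x \<in> {0..t} then u x else 0"
  have "?f \<in> borel_measurable lebesgue"
    by (rule borel_measurable_if_I[OF controlsD(1)[OF u]]) simp
  from completion_ex_borel_measurable_real[OF this]
  obtain v where v: "v \<in> borel_measurable lborel" "AE x in lborel. ?f x = v x"
    by (rule bexE)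
  define w where "w x = max (- C) (min C (v x))" for x
  have "w \<in> borel_measurable borel" unfolding w_def using v(1) by measurable
  moreover have "\<forall>x. \<bar>w x\<bar> \<le> C"
  proof
    have "C \<ge> 0" unfolding C_def by simp
    then show "\<bar>w x\<bar> \<le> C" for x unfolding w_def by linarith
  qed
  moreover have "AE x in lebesgue. ?f x = v x" using v(2) by (rule AE_completion)
  then obtain N where N: "negligible N" "{x. \<not> ?f x = v x} \<subseteq> N"
    unfolding eventually_ae_filter_negligible by (elim exE conjE)
  moreover have "\<forall>x\<in>{0..t} - N. u x = w x"
  proof
    fix x assume x: "x \<in> {0..t} - N"
    then have "?f x = v x" using N(2) by blast
    then have "u x = v x" using x by simp
    moreover have "a \<le> u x" "u x \<le> b" using controlsD(2,3)[OF u] x by blast+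
    ultimately show "u x = w x" unfolding w_def C_def by linarith
  qed
  ultimately show ?thesis by blast
qed

lemma iter_int_has_integral:
  assumes u: "u \<in> controls t a b" and s: "0 \<le> s" "s \<le> t"
  shows "(iter_int k u has_integral iter_int (Suc k) u s) {0..s}"
proof -
  obtain v C N where v: "v \<in> borel_measurable borel" "\<forall>x. \<bar>v x\<bar> \<le> C"
    and N: "negligible N" "\<forall>x\<in>{0..t} - N. u x = v x"
    using controls_borel_version[OF u] by blast
  have eq: "iter_int j u \<tau> = iter_int j v \<tau>" if "\<tau> \<le> t" for j \<tau>
    unfolding iter_int_def by (rule integral_spike[OF N(1)]) (use N(2) that in auto)
  have "((\<lambda>\<tau>. iter_int k v \<tau>) has_integral iter_int (Suc k) v s) {0..s}"
    unfolding iter_int_def by (rule iterated_integral_borel[of v C s k]) (use v s in auto)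
  then show ?thesis
    by (subst eq[OF s(2)], subst has_integral_cong[where g = "iter_int k v"]) (use eq s in auto)
qed

lemma iter_int_0:
  "iter_int 0 u s = integral {0..s} u"
  unfolding iter_int_def by simp

lemma controls_integrable_on: "u \<in> controls t a b \<Longrightarrow> u integrable_on {0..t}"
  using controls_integrable[of u t a b 0] by simp

lemma iter_int_continuous:
  assumes u: "u \<in> controls t a b"
  shows "continuous_on {0..t} (iter_int k u)"
proof (cases k)
  case 0
  then show ?thesis
    using indefinite_integral_continuous_1[OF controls_integrable_on[OF u]] by (simp add: iter_int_0[abs_def])
next
  case (Suc j)
  show ?thesis
  proof (cases "0 \<le> t")
    case True
    have "(iter_int j u) integrable_on {0..t}"
      using iter_int_has_integral[OF u True] by blast
    then have "continuous_on {0..t} (\<lambda>s. integral {0..s} (iter_int j u))"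
      by (rule indefinite_integral_continuous_1)
    then show ?thesis
      by (rule continuous_on_eq) (use iter_int_has_integral[OF u, of _ j] Suc in \<open>auto simp: integral_unique\<close>)
  qed simp
qed

text \<open>Variation of constants for one chain: the Taylor polynomial of the free motion plus the
  (n-i)-fold iterated integral of the input.\<close>

definition chain_sol :: "nat \<Rightarrow> (nat \<Rightarrow> real) \<Rightarrow> (real \<Rightarrow> real) \<Rightarrow> nat \<Rightarrow> real \<Rightarrow> real" where
  "chain_sol n a u i s = (\<Sum>l<n - i. a (i + l) * (s ^ l / fact l)) + iter_int (n - 1 - i) u s"

lemma chain_sol_last: "0 < n \<Longrightarrow> chain_sol n a u (n - 1) s = a (n - 1) + integral {0..s} u"
  unfolding chain_sol_def by (simp add: iter_int_0)

lemma chain_sol_step: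
  assumes u: "u \<in> controls t l b" and s: "0 \<le> s" "s \<le> t" and i: "Suc i < n"
  shows "(chain_sol n a u (Suc i) has_integral (chain_sol n a u i s - a i)) {0..s}"
proof -
  have pw: "((\<lambda>\<tau>. \<tau> ^ l / fact l) has_integral (s ^ Suc l / fact (Suc l))) {0..s}" for l
    using has_integral_power_div_fact[OF s(1), of l] by simp
  have it: "(iter_int (n - 1 - Suc i) u has_integral iter_int (Suc (n - 1 - Suc i)) u s) {0..s}"
    by (rule iter_int_has_integral[OF u s])
  have "((\<lambda>\<tau>. (\<Sum>l<n - Suc i. a (Suc i + l) * (\<tau> ^ l / fact l)) + iter_int (n - 1 - Suc i) u \<tau>) has_integral
    ((\<Sum>l<n - Suc i. a (Suc i + l) * (s ^ Suc l / fact (Suc l))) + iter_int (Suc (n - 1 - Suc i)) u s)) {0..s}"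
    by (intro has_integral_add has_integral_sum has_integral_mult_right pw it) simp
  moreover have "chain_sol n a u i s - a i =
    (\<Sum>l<n - Suc i. a (Suc i + l) * (s ^ Suc l / fact (Suc l))) + iter_int (Suc (n - 1 - Suc i)) u s"
  proof -
    have n: "n - i = Suc (n - Suc i)" "n - 1 - i = Suc (n - 1 - Suc i)" using i by auto
    have "(\<Sum>l<n - i. a (i + l) * (s ^ l / fact l)) =
        a i + (\<Sum>l<n - Suc i. a (i + Suc l) * (s ^ Suc l / fact (Suc l)))"
      unfolding n(1) sum.lessThan_Suc_shift by simp
    then show ?thesis unfolding chain_sol_def n(2) by simp
  qed
  ultimately show ?thesis unfolding chain_sol_def[abs_def] by simp
qed

text \<open>Only the last component is driven directly by the input; going down from it, each
  component is determined by integrating the next one.\<close>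

lemma chain_sol_unique:
  assumes u: "u \<in> controls t l b" and n: "0 < n"
    and step: "\<And>i s. Suc i < n \<Longrightarrow> s \<in> {0..t} \<Longrightarrow> f i s = a i + integral {0..s} (f (Suc i))"
    and last: "\<And>s. s \<in> {0..t} \<Longrightarrow> f (n - 1) s = a (n - 1) + integral {0..s} u"
    and i: "i < n" and s: "s \<in> {0..t}"
  shows "f i s = chain_sol n a u i s"
proof -
  have "i \<le> n - 1" using i by simp
  then show ?thesis using s
  proof (induction arbitrary: s rule: inc_induct)
    case base
    then show ?case using last chain_sol_last[OF n] by simp
  next
    case (step j)
    then have j: "Suc j < n" by simp
    have "integral {0..s} (f (Suc j)) = integral {0..s} (chain_sol n a u (Suc j))"
      by (rule integral_cong) (use step in auto)
    also have "\<dots> = chain_sol n a u j s - a j"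
      by (rule integral_unique[OF chain_sol_step[OF u _ _ j]]) (use step in auto)
    finally show ?case using assms(3)[OF j step.prems] by simp
  qed
qed

lemma chain_sol_continuous:
  "u \<in> controls t l b \<Longrightarrow> continuous_on {0..t} (chain_sol n a u i)"
  unfolding chain_sol_def[abs_def] by (intro continuous_intros iter_int_continuous) auto

lemma iter_int_moment: "fact k * iter_int k u t = integral {0..t} (\<lambda>x. (t - x) ^ k * u x)"
  unfolding iter_int_def by (subst integral_mult_right[symmetric]) (rule integral_cong, simp)

section \<open>Block indices of the Brunovsky form\<close>

definition block_start :: "(nat \<Rightarrow> nat) \<Rightarrow> nat \<Rightarrow> nat" where
  "block_start r j = (\<Sum>i<j. r i)"

lemma block_start_Suc: "block_start r (Suc j) = block_start r j + r j"
  unfolding block_start_def by simp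

lemma block_start_mono: "i \<le> j \<Longrightarrow> block_start r i \<le> block_start r j"
  unfolding block_start_def by (intro sum_mono2) auto

lemma block_index_less:
  assumes "j < m" "k < r j"
  shows "block_start r j + k < block_start r m"
  using block_start_mono[of "Suc j" m r] assms by (simp add: block_start_Suc)

lemma block_index_inj:
  assumes "k < r j" "k' < r j'" "block_start r j + k = block_start r j' + k'"
  shows "j = j' \<and> k = k'"
proof -
  have "\<not> i < i'" if "l < r i" "block_start r i + l = block_start r i' + l'" for i i' l l'
    using block_start_mono[of "Suc i" i' r] that by (auto simp: block_start_Suc)
  from this[OF assms(1,3)] this[OF assms(2) assms(3)[symmetric]] have "j = j'" by simp
  then show ?thesis using assms(3) by simp
qed

lemma block_index_exists:
  "i < block_start r m \<Longrightarrow> \<exists>j<m. \<exists>k<r j. i = block_start r j + k"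
proof (induction m)
  case 0
  then show ?case by (simp add: block_start_def)
next
  case (Suc m)
  show ?case
  proof (cases "i < block_start r m")
    case True
    then show ?thesis using Suc.IH less_SucI by blast
  next
    case False
    then have "i = block_start r m + (i - block_start r m)" "i - block_start r m < r m"
      using Suc.prems by (auto simp: block_start_Suc)
    then show ?thesis by blast
  qed
qed

lemma sum_add_shift: "(\<Sum>l<a + b. g l) = (\<Sum>l<a. g l) + (\<Sum>l<b. g (a + l :: nat))" for g :: "nat \<Rightarrow> real"
  by (induction b) (simp_all add: add.assoc)

lemma sum_blocks: "(\<Sum>l<block_start r m. g l) = (\<Sum>j<m. \<Sum>k<r j. g (block_start r j + k))" for g :: "nat \<Rightarrow> real"
proof (induction m)
  case 0
  then show ?case by (simp add: block_start_def)
next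
  case (Suc m)
  then show ?case by (simp add: block_start_Suc sum_add_shift)
qed

lemma sum_nth_less_sum_list:
  "j < length xs \<Longrightarrow> k < (f (xs ! j) :: nat) \<Longrightarrow> (\<Sum>i<j. f (xs ! i)) + k < sum_list (map f xs)"
proof (induction xs arbitrary: j)
  case (Cons x xs)
  show ?case
  proof (cases j)
    case (Suc j')
    then show ?thesis using Cons.IH[of j'] Cons.prems by (simp add: sum.lessThan_Suc_shift del: sum.lessThan_Suc)
  qed (use Cons.prems in simp)
qed simp

text \<open>Indices are written as block offset plus local index, a form that is preserved when the
  first block is split off.\<close>

lemma diag_block_mat_entry:
  fixes As :: "'a :: zero mat list"
  assumes "j < length As" "k < dim_row (As ! j)" "j' < length As" "k' < dim_col (As ! j')"
  shows "diag_block_mat As $$ ((\<Sum>i<j. dim_row (As ! i)) + k, (\<Sum>i<j'. dim_col (As ! i)) + k') =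
    (if j = j' then As ! j $$ (k, k') else 0)"
  using assms
proof (induction As arbitrary: j j')
  case (Cons A As)
  let ?D = "diag_block_mat As"
  have D: "dim_row ?D = sum_list (map dim_row As)" "dim_col ?D = sum_list (map dim_col As)"
    by (simp_all add: dim_diag_block_mat)
  have shift: "(\<Sum>i<Suc n. f ((A # As) ! i)) = f A + (\<Sum>i<n. f (As ! i))" for n and f :: "'a mat \<Rightarrow> nat"
    by (simp add: sum.lessThan_Suc_shift del: sum.lessThan_Suc)
  have R: "(\<Sum>i<n. dim_row (As ! i)) + k < dim_row ?D" if "n < length As" "k < dim_row (As ! n)" for n
    unfolding D using that by (rule sum_nth_less_sum_list[where f = dim_row])
  have C: "(\<Sum>i<n. dim_col (As ! i)) + k' < dim_col ?D" if "n < length As" "k' < dim_col (As ! n)" for n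
    unfolding D using that by (rule sum_nth_less_sum_list[where f = dim_col])
  show ?case
  proof (cases j)
    case 0
    show ?thesis
    proof (cases j')
      case 0
      then show ?thesis using \<open>j = 0\<close> Cons.prems by (simp add: Let_def)
    next
      case (Suc i')
      then show ?thesis using \<open>j = 0\<close> Cons.prems C[of i'] by (simp add: Let_def shift del: sum.lessThan_Suc)
    qed
  next
    case (Suc i)
    show ?thesis
    proof (cases j')
      case 0
      then show ?thesis using Suc Cons.prems R[of i] by (simp add: Let_def shift del: sum.lessThan_Suc)
    next
      case (Suc i')
      then show ?thesis using \<open>j = Suc i\<close> Cons.prems R[of i] C[of i'] Cons.IH[of i i']
        by (simp add: Let_def shift add.assoc del: sum.lessThan_Suc)
    qed
  qed
qed simp

section \<open>Entries of the Brunovsky matrices\<close>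

lemma dim_chain_matrix [simp]: "dim_row (chain_matrix n) = n" "dim_col (chain_matrix n) = n"
  unfolding chain_matrix_def by simp_all

lemma chain_matrix_entry:
  "k < n \<Longrightarrow> k' < n \<Longrightarrow> chain_matrix n $$ (k, k') = (if k' = Suc k then 1 else 0)"
  unfolding chain_matrix_def by simp

lemma dim_chain_input [simp]: "dim_row (chain_input n) = n" "dim_col (chain_input n) = 1"
  unfolding chain_input_def by simp_all

lemma sum_list_map_upt: "sum_list (map f [0..<m]) = (\<Sum>j<m. f j)" for f :: "nat \<Rightarrow> nat"
  by (simp add: interv_sum_list_conv_sum_set_nat atLeast0LessThan)

lemma dim_brunovsky:
  "dim_row (brunovsky_A m r) = block_start r m" "dim_col (brunovsky_A m r) = block_start r m"
  "dim_row (brunovsky_B m r) = block_start r m" "dim_col (brunovsky_B m r) = m"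
  unfolding brunovsky_A_def brunovsky_B_def block_start_def dim_diag_block_mat map_map comp_def
  by (simp_all add: sum_list_map_upt sum_list_triv)

lemma brunovsky_A_entry:
  assumes "j < m" "k < r j" "j' < m" "k' < r j'"
  shows "brunovsky_A m r $$ (block_start r j + k, block_start r j' + k') = (if j = j' \<and> k' = Suc k then 1 else 0)"
  using diag_block_mat_entry[of j "map (\<lambda>j. chain_matrix (r j)) [0..<m]" k j' k'] assms
  unfolding brunovsky_A_def block_start_def by (auto simp: chain_matrix_entry)

lemma brunovsky_B_entry:
  assumes "j < m" "k < r j" "j' < m"
  shows "brunovsky_B m r $$ (block_start r j + k, j') = (if j = j' \<and> Suc k = r j then 1 else 0)"
  using diag_block_mat_entry[of j "map (\<lambda>j. chain_input (r j)) [0..<m]" k j' 0] assms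
  unfolding brunovsky_B_def block_start_def by (auto simp: chain_input_def mat_of_cols_index)

text \<open>Each row meets a single entry 1: the superdiagonal one of \<open>A\<close>, or, in the
  last row of a block, the one of \<open>B\<close>.\<close>

lemma brunovsky_field:
  assumes x: "x \<in> carrier_vec (block_start r m)" and u: "u \<in> carrier_vec m" and j: "j < m" and k: "k < r j"
  shows "(brunovsky_A m r *\<^sub>v x + brunovsky_B m r *\<^sub>v u) $ (block_start r j + k) =
    (if Suc k < r j then x $ (block_start r j + Suc k) else u $ j)"
proof -
  let ?i = "block_start r j + k"
  have i: "?i < block_start r m" by (rule block_index_less[where r = r, OF j k])
  have "(brunovsky_A m r *\<^sub>v x) $ ?i = (\<Sum>l<block_start r m. brunovsky_A m r $$ (?i, l) * x $ l)"
    using i x by (simp add: dim_brunovsky scalar_prod_def atLeast0LessThan)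
  also have "\<dots> = (\<Sum>j'<m. \<Sum>k'<r j'. (if j = j' \<and> k' = Suc k then 1 else 0) * x $ (block_start r j' + k'))"
    unfolding sum_blocks by (intro sum.cong refl) (simp add: brunovsky_A_entry j k)
  also have "\<dots> = (\<Sum>j'<m. if j' = j then (if Suc k < r j then x $ (block_start r j + Suc k) else 0) else 0)"
  proof (rule sum.cong[OF refl])
    fix j'
    show "(\<Sum>k'<r j'. (if j = j' \<and> k' = Suc k then 1 else 0) * x $ (block_start r j' + k')) =
      (if j' = j then (if Suc k < r j then x $ (block_start r j + Suc k) else 0) else 0)"
    proof (cases "j' = j")
      case True
      have "(\<Sum>k'<r j. (if k' = Suc k then 1 else 0) * x $ (block_start r j + k')) =
        (\<Sum>k'<r j. if k' = Suc k then x $ (block_start r j + Suc k) else 0)"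
        by (rule sum.cong[OF refl]) simp
      then show ?thesis using True by simp
    qed simp
  qed
  also have "\<dots> = (if Suc k < r j then x $ (block_start r j + Suc k) else 0)"
    using j by simp
  finally have A: "(brunovsky_A m r *\<^sub>v x) $ ?i = (if Suc k < r j then x $ (block_start r j + Suc k) else 0)" .
  have "(brunovsky_B m r *\<^sub>v u) $ ?i = (\<Sum>l<m. brunovsky_B m r $$ (?i, l) * u $ l)"
    using i u by (simp add: dim_brunovsky scalar_prod_def atLeast0LessThan)
  also have "\<dots> = (\<Sum>l<m. if l = j then (if Suc k = r j then u $ j else 0) else 0)"
    by (intro sum.cong refl) (auto simp: brunovsky_B_entry j k)
  also have "\<dots> = (if Suc k = r j then u $ j else 0)" using j by simp
  finally have B: "(brunovsky_B m r *\<^sub>v u) $ ?i = (if Suc k = r j then u $ j else 0)" .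
  have "(brunovsky_A m r *\<^sub>v x + brunovsky_B m r *\<^sub>v u) $ ?i = (brunovsky_A m r *\<^sub>v x) $ ?i + (brunovsky_B m r *\<^sub>v u) $ ?i"
    using i by (simp add: dim_brunovsky)
  then show ?thesis unfolding A B using k by auto
qed

section \<open>Reach sets\<close>

definition bang_bang ::
  "nat \<Rightarrow> real \<Rightarrow> real \<Rightarrow> real \<Rightarrow> (nat \<Rightarrow> real) \<Rightarrow> (nat \<Rightarrow> real) \<Rightarrow> (nat \<Rightarrow> real) \<Rightarrow> (nat \<Rightarrow> real) \<Rightarrow> bool" where
  "bang_bang n t a b c p s \<epsilon> \<longleftrightarrow> switching n t a b s \<epsilon> \<and>
    (dot n p c < dot n p (step_moment n t s \<epsilon>) \<or> (\<forall>k<n. c k = step_moment n t s \<epsilon> k))"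

text \<open>Allows the arguments to be read off finite segments of an environment.\<close>

lemma bang_bang_cong:
  assumes "\<And>k. k < n \<Longrightarrow> c k = c' k" "\<And>k. k < n \<Longrightarrow> p k = p' k" "\<And>k. k < n \<Longrightarrow> \<epsilon> k = \<epsilon>' k"
    "\<And>k. k \<le> n \<Longrightarrow> s k = s' k"
  shows "bang_bang n t a b c p s \<epsilon> = bang_bang n t a b c' p' s' \<epsilon>'"
proof -
  have "step_moment n t s \<epsilon> k = step_moment n t s' \<epsilon>' k" for k
    unfolding step_moment_def by (intro sum.cong refl) (simp add: assms)
  then have m: "step_moment n t s \<epsilon> = step_moment n t s' \<epsilon>'" by (rule ext)
  have d: "dot n p q = dot n p' q'" if "\<And>k. k < n \<Longrightarrow> q k = q' k" for q q'
    unfolding dot_def by (intro sum.cong refl) (simp add: assms that)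
  have "switching n t a b s \<epsilon> = switching n t a b s' \<epsilon>'"
    unfolding switching_def using assms by simp
  then show ?thesis
    unfolding bang_bang_def m using d[of c c'] d[of "step_moment n t s' \<epsilon>'" "step_moment n t s' \<epsilon>'"] assms(1) by simp
qed

lemma sgn_determined_all_less:
  "(\<And>i. i < n \<Longrightarrow> sgn_determined (\<phi> i)) \<Longrightarrow> sgn_determined (\<lambda>e. \<forall>i<n. \<phi> i e)" for n :: nat
  using sgn_determined_ball[of "{..<n}" \<phi>] by (simp add: Ball_def)

text \<open>In the environment, \<open>c\<close>, \<open>p\<close>, \<open>s\<close>, \<open>\<epsilon>\<close> occupy consecutive segments of lengths
  \<open>n\<close>, \<open>n\<close>, \<open>n + 1\<close>, \<open>n\<close>.\<close>

lemma sgn_determined_bang_bang: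
  "sgn_determined (\<lambda>e. bang_bang n t a b e (\<lambda>k. e (n + k)) (\<lambda>i. e (2 * n + i)) (\<lambda>i. e (3 * n + 1 + i)))"
proof -
  have step: "(\<lambda>e. step_moment n t (\<lambda>i. e (2 * n + i)) (\<lambda>i. e (3 * n + 1 + i)) k) \<in> polyfuns" for k
    unfolding step_moment_def divide_inverse by (intro polyfuns_intros)
  have d1: "(\<lambda>e. dot n (\<lambda>k. e (n + k)) e) \<in> polyfuns"
    unfolding dot_def by (intro polyfuns_intros)
  have d2: "(\<lambda>e. dot n (\<lambda>k. e (n + k)) (step_moment n t (\<lambda>i. e (2 * n + i)) (\<lambda>i. e (3 * n + 1 + i)))) \<in> polyfuns"
    unfolding dot_def by (intro polyfuns_sum polyfuns.mult polyfuns.var step)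
  show ?thesis
    unfolding bang_bang_def switching_def
    by (intro sgn_determined_conj sgn_determined_disj sgn_determined_all_less sgn_determined_atom
        polyfuns.var polyfuns.const step d1 d2)
qed

text \<open>Two block eliminations: \<open>s\<close> and \<open>\<epsilon>\<close> are projected
  away over \<open>?S\<close>, then the universal quantifier over \<open>p\<close> is treated as a
  negated projection over \<open>?P\<close>.\<close>

lemma sgn_determined_moment_set:
  assumes n: "0 < n" and t: "0 \<le> t" and ab: "a \<le> b"
  shows "sgn_determined (\<lambda>e. e \<in> moment_set n t a b)"
proof -
  define \<psi> where "\<psi> e = bang_bang n t a b e (\<lambda>k. e (n + k)) (\<lambda>i. e (2 * n + i)) (\<lambda>i. e (3 * n + 1 + i))" for e
  let ?S = "{2 * n..<4 * n + 1}"
  let ?P = "{n..<2 * n}"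
  define \<eta> where "\<eta> e = (\<exists>f. \<psi> (\<lambda>i. if i \<in> ?S then f i else e i))" for e
  have chi: "\<eta> e \<longleftrightarrow> (\<exists>s \<epsilon>. bang_bang n t a b e (\<lambda>k. e (n + k)) s \<epsilon>)" for e
  proof
    assume "\<eta> e"
    then obtain f where f: "\<psi> (\<lambda>i. if i \<in> ?S then f i else e i)" unfolding \<eta>_def by (rule exE)
    have "bang_bang n t a b e (\<lambda>k. e (n + k)) (\<lambda>i. f (2 * n + i)) (\<lambda>i. f (3 * n + 1 + i))"
      by (rule bang_bang_cong[THEN iffD1, OF _ _ _ _ f[unfolded \<psi>_def]]) auto
    then show "\<exists>s \<epsilon>. bang_bang n t a b e (\<lambda>k. e (n + k)) s \<epsilon>" by (intro exI)
  next
    assume "\<exists>s \<epsilon>. bang_bang n t a b e (\<lambda>k. e (n + k)) s \<epsilon>"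
    then obtain s \<epsilon> where s: "bang_bang n t a b e (\<lambda>k. e (n + k)) s \<epsilon>" by (elim exE)
    \<comment> \<open>Packs \<open>s\<close>, with \<open>n + 1\<close> entries from
      \<open>2 * n\<close> on, and then \<open>\<epsilon>\<close> into one block.\<close>
    define f where "f i = (if i < 3 * n + 1 then s (i - 2 * n) else \<epsilon> (i - (3 * n + 1)))" for i
    have "\<psi> (\<lambda>i. if i \<in> ?S then f i else e i)"
      unfolding \<psi>_def by (rule bang_bang_cong[THEN iffD1, OF _ _ _ _ s]) (auto simp: f_def)
    then show "\<eta> e" unfolding \<eta>_def by (rule exI[of _ f])
  qed
  define \<xi> where "\<xi> e = ((\<exists>k\<in>{..<n}. e (n + k) \<noteq> 0) \<and> \<not> \<eta> e)" for e
  have "sgn_determined \<psi>" unfolding \<psi>_def by (rule sgn_determined_bang_bang)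
  then have chi_det: "sgn_determined \<eta>" unfolding \<eta>_def by (intro sgn_determined_ex_finite) simp_all
  have "sgn_determined (\<lambda>e. \<forall>k\<in>{..<n}. e (n + k) = 0)"
    by (intro sgn_determined_ball sgn_determined_atom polyfuns.var polyfuns.const) simp
  from sgn_determined_not[OF this] have "sgn_determined (\<lambda>e. \<exists>k\<in>{..<n}. e (n + k) \<noteq> 0)" by simp
  then have "sgn_determined \<xi>" unfolding \<xi>_def by (intro sgn_determined_conj sgn_determined_not chi_det)
  then have det: "sgn_determined (\<lambda>e. \<not> (\<exists>f. \<xi> (\<lambda>i. if i \<in> ?P then f i else e i)))"
    by (intro sgn_determined_not sgn_determined_ex_finite) simp_all
  have xi: "\<xi> (\<lambda>i. if i \<in> ?P then f i else e i) \<longleftrightarrow>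
    (\<exists>k<n. f (n + k) \<noteq> 0) \<and> \<not> (\<exists>s \<epsilon>. bang_bang n t a b e (\<lambda>k. f (n + k)) s \<epsilon>)" for f e
  proof -
    have "bang_bang n t a b (\<lambda>i. if i \<in> ?P then f i else e i) (\<lambda>k. if n + k \<in> ?P then f (n + k) else e (n + k)) s \<epsilon>
      = bang_bang n t a b e (\<lambda>k. f (n + k)) s \<epsilon>" for s \<epsilon>
      by (rule bang_bang_cong) auto
    then show ?thesis unfolding \<xi>_def chi by (simp add: Bex_def cong: conj_cong)
  qed
  have "e \<in> moment_set n t a b \<longleftrightarrow> \<not> (\<exists>f. \<xi> (\<lambda>i. if i \<in> ?P then f i else e i))" for e
  proof -
    have "(\<exists>f. (\<exists>k<n. f (n + k) \<noteq> 0) \<and> \<not> (\<exists>s \<epsilon>. bang_bang n t a b e (\<lambda>k. f (n + k)) s \<epsilon>)) \<longleftrightarrow>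
      (\<exists>p. (\<exists>k<n. p k \<noteq> 0) \<and> \<not> (\<exists>s \<epsilon>. bang_bang n t a b e p s \<epsilon>))" (is "?L \<longleftrightarrow> ?R")
    proof
      assume ?L
      then obtain f where "(\<exists>k<n. f (n + k) \<noteq> 0) \<and> \<not> (\<exists>s \<epsilon>. bang_bang n t a b e (\<lambda>k. f (n + k)) s \<epsilon>)" by (rule exE)
      then show ?R by (rule exI[of _ "\<lambda>k. f (n + k)"])
    next
      assume ?R
      then obtain p where "(\<exists>k<n. p k \<noteq> 0) \<and> \<not> (\<exists>s \<epsilon>. bang_bang n t a b e p s \<epsilon>)" by (rule exE)
      then show ?L by (intro exI[of _ "\<lambda>k. p (k - n)"]) simp
    qed
    then show ?thesis
      unfolding xi moment_set_iff[OF n t ab] bang_bang_def[symmetric] by blast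
  qed
  then show ?thesis using det by simp
qed

text \<open>After subtraction of the free motion, component \<open>n - 1 - k\<close> is the k-th
  moment divided by \<open>fact k\<close>; the order is reversed because earlier components are
  integrated more often.\<close>

lemma chain_sol_moment_iff:
  assumes n: "0 < n"
  shows "(\<exists>v\<in>controls t l b. \<forall>i<n. z i = chain_sol n a v i t) \<longleftrightarrow>
    (\<lambda>k. fact k * (z (n - 1 - k) - (\<Sum>j<Suc k. a (n - 1 - k + j) * (t ^ j / fact j)))) \<in> moment_set n t l b"
proof -
  have "(\<forall>i<n. z i = chain_sol n a v i t) \<longleftrightarrow>
    (\<forall>k<n. fact k * (z (n - 1 - k) - (\<Sum>j<Suc k. a (n - 1 - k + j) * (t ^ j / fact j))) =
      integral {0..t} (\<lambda>x. (t - x) ^ k * v x))" for v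
  proof -
    have eq: "fact k * (z (n - 1 - k) - (\<Sum>j<Suc k. a (n - 1 - k + j) * (t ^ j / fact j))) =
        integral {0..t} (\<lambda>x. (t - x) ^ k * v x) \<longleftrightarrow> z (n - 1 - k) = chain_sol n a v (n - 1 - k) t" if "k < n" for k
    proof -
      have k: "n - (n - 1 - k) = Suc k" "n - 1 - (n - 1 - k) = k" using that by auto
      have "fact k * (p - q) = fact k * w \<longleftrightarrow> p = q + w" for p q w :: real
        by (simp add: diff_eq_eq add.commute)
      then show ?thesis unfolding iter_int_moment[symmetric] chain_sol_def k .
    qed
    show ?thesis
    proof (intro iffI allI impI)
      fix k assume L: "\<forall>i<n. z i = chain_sol n a v i t" and k: "k < n"
      have "n - 1 - k < n" using n by simp
      then show "fact k * (z (n - 1 - k) - (\<Sum>j<Suc k. a (n - 1 - k + j) * (t ^ j / fact j))) =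
        integral {0..t} (\<lambda>x. (t - x) ^ k * v x)"
        using L eq[OF k] by blast
    next
      fix i assume R: "\<forall>k<n. fact k * (z (n - 1 - k) - (\<Sum>j<Suc k. a (n - 1 - k + j) * (t ^ j / fact j))) =
        integral {0..t} (\<lambda>x. (t - x) ^ k * v x)" and i: "i < n"
      have k: "n - 1 - i < n" "n - 1 - (n - 1 - i) = i" using i by auto
      from R k(1) have "z (n - 1 - (n - 1 - i)) = chain_sol n a v (n - 1 - (n - 1 - i)) t"
        using eq[OF k(1)] by blast
      then show "z i = chain_sol n a v i t" unfolding k(2) .
    qed
  qed
  then show ?thesis unfolding moment_set_def by simp
qed

section \<open>Decoupling the reach set into chains\<close>

lemma controls_set_integrable:
  assumes "u \<in> controls t a b"
  shows "set_integrable lebesgue {0..t} u"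
proof (rule measurable_bounded_by_integrable_imp_absolutely_integrable[where g = "\<lambda>_. \<bar>a\<bar> + \<bar>b\<bar>"])
  show "norm (u x) \<le> \<bar>a\<bar> + \<bar>b\<bar>" if "x \<in> {0..t}" for x using controlsD(2,3)[OF assms that] by simp
qed (use controlsD(1)[OF assms] integrable_const_ivl in auto)

text \<open>Forward, each block of a trajectory solves the integral equations of its chain, whose
  solution is unique. Backward, inputs chosen separately for the chains are stacked, which the box
  shape of the input set permits.\<close>

lemma reach_set_iff:
  assumes t: "0 \<le> t" and r: "\<And>j. j < m \<Longrightarrow> 0 < r j"
  shows "z \<in> integrator_reach_set m r \<alpha> \<beta> x0 t \<longleftrightarrow> z \<in> carrier_vec (block_start r m) \<and>
    (\<forall>j<m. \<exists>v\<in>controls t (\<alpha> j) (\<beta> j). \<forall>k<r j. z $ (block_start r j + k) =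
      chain_sol (r j) (\<lambda>l. x0 $ (block_start r j + l)) v k t)"
    (is "_ \<longleftrightarrow> _ \<and> ?R")
proof
  assume "z \<in> integrator_reach_set m r \<alpha> \<beta> x0 t"
  then obtain x u where z: "z = x t"
    and adm: "admissible_input (box_inputs m \<alpha> \<beta>) m t u"
    and tr: "trajectory (brunovsky_A m r) (brunovsky_B m r) u x0 t x"
    unfolding integrator_reach_set_def reach_set_def dim_brunovsky by (elim CollectE exE conjE)
  let ?d = "block_start r m"
  let ?F = "\<lambda>\<tau>. brunovsky_A m r *\<^sub>v x \<tau> + brunovsky_B m r *\<^sub>v u \<tau>"
  have xc: "x s \<in> carrier_vec ?d" if "s \<in> {0..t}" for s
    using tr that unfolding trajectory_def dim_brunovsky by simp
  have si: "set_integrable lebesgue {0..t} (\<lambda>\<tau>. ?F \<tau> $ i)" if "i < ?d" for i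
    using tr that unfolding trajectory_def dim_brunovsky by simp
  have eqn: "x s $ i = x0 $ i + (LINT \<tau>:{0..s}|lebesgue. ?F \<tau> $ i)" if "i < ?d" "s \<in> {0..t}" for i s
    using tr that unfolding trajectory_def dim_brunovsky by simp
  have ub: "u s \<in> carrier_vec m" "j < m \<Longrightarrow> \<alpha> j \<le> u s $ j" "j < m \<Longrightarrow> u s $ j \<le> \<beta> j" if "s \<in> {0..t}" for s j
    using adm that unfolding admissible_input_def box_inputs_def by auto
  have "\<exists>v\<in>controls t (\<alpha> j) (\<beta> j). \<forall>k<r j. z $ (block_start r j + k) =
      chain_sol (r j) (\<lambda>l. x0 $ (block_start r j + l)) v k t" if j: "j < m" for j
  proof -
    have v: "(\<lambda>s. u s $ j) \<in> controls t (\<alpha> j) (\<beta> j)"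
      using adm ub j unfolding controls_def admissible_input_def by simp
    have eqn': "x s $ (block_start r j + k) = x0 $ (block_start r j + k) +
        integral {0..s} (\<lambda>\<tau>. if Suc k < r j then x \<tau> $ (block_start r j + Suc k) else u \<tau> $ j)"
      if k: "k < r j" and s: "s \<in> {0..t}" for k s
    proof -
      have i: "block_start r j + k < ?d" by (rule block_index_less[where r = r, OF j k])
      have "set_integrable lebesgue {0..s} (\<lambda>\<tau>. ?F \<tau> $ (block_start r j + k))"
        by (rule set_integrable_subset[OF si[OF i]]) (use s in auto)
      from set_lebesgue_integral_eq_integral(2)[OF this]
      have "(LINT \<tau>:{0..s}|lebesgue. ?F \<tau> $ (block_start r j + k)) =
          integral {0..s} (\<lambda>\<tau>. ?F \<tau> $ (block_start r j + k))" .
      also have "\<dots> = integral {0..s} (\<lambda>\<tau>. if Suc k < r j then x \<tau> $ (block_start r j + Suc k) else u \<tau> $ j)"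
      proof (rule integral_cong)
        fix \<tau> assume "\<tau> \<in> {0..s}"
        then have "\<tau> \<in> {0..t}" using s by simp
        then show "?F \<tau> $ (block_start r j + k) = (if Suc k < r j then x \<tau> $ (block_start r j + Suc k) else u \<tau> $ j)"
          by (intro brunovsky_field xc ub j k)
      qed
      finally show ?thesis using eqn[OF i s] by simp
    qed
    have "x t $ (block_start r j + k) = chain_sol (r j) (\<lambda>l. x0 $ (block_start r j + l)) (\<lambda>s. u s $ j) k t"
      if k: "k < r j" for k
    proof (rule chain_sol_unique[OF v r[OF j], where f = "\<lambda>k s. x s $ (block_start r j + k)"])
      show "x s $ (block_start r j + i) = x0 $ (block_start r j + i) + integral {0..s} (\<lambda>s. x s $ (block_start r j + Suc i))"
        if "Suc i < r j" "s \<in> {0..t}" for i s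
        using eqn'[OF Suc_lessD[OF that(1)] that(2)] that(1) by simp
      show "x s $ (block_start r j + (r j - 1)) = x0 $ (block_start r j + (r j - 1)) + integral {0..s} (\<lambda>s. u s $ j)"
        if "s \<in> {0..t}" for s
        using eqn'[of "r j - 1", OF _ that] r[OF j] by simp
    qed (use k t in simp_all)
    then show ?thesis unfolding z by (intro bexI[OF _ v]) simp
  qed
  then show "z \<in> carrier_vec ?d \<and> ?R" using xc[of t] t unfolding z by simp
next
  assume asm: "z \<in> carrier_vec (block_start r m) \<and> ?R"
  let ?d = "block_start r m"
  have "\<forall>j\<in>{..<m}. \<exists>v. v \<in> controls t (\<alpha> j) (\<beta> j) \<and> (\<forall>k<r j. z $ (block_start r j + k) =
      chain_sol (r j) (\<lambda>l. x0 $ (block_start r j + l)) v k t)" using asm by blast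
  then obtain v where "\<forall>j\<in>{..<m}. v j \<in> controls t (\<alpha> j) (\<beta> j) \<and> (\<forall>k<r j. z $ (block_start r j + k) =
      chain_sol (r j) (\<lambda>l. x0 $ (block_start r j + l)) (v j) k t)" by (rule bchoice[THEN exE])
  then have v: "v j \<in> controls t (\<alpha> j) (\<beta> j)" and
    zv: "k < r j \<Longrightarrow> z $ (block_start r j + k) = chain_sol (r j) (\<lambda>l. x0 $ (block_start r j + l)) (v j) k t"
    if "j < m" for j k using that by simp_all
  define X where "X j k s = chain_sol (r j) (\<lambda>l. x0 $ (block_start r j + l)) (v j) k s" for j k s
  \<comment> \<open>Inverse of the block indexing; \<open>block_index_inj\<close> makes the choice
    unique.\<close>
  define dec where "dec i = (SOME (j, k). j < m \<and> k < r j \<and> i = block_start r j + k)" for i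
  have dec: "dec (block_start r j + k) = (j, k)" if "j < m" "k < r j" for j k
    unfolding dec_def using that block_index_inj[where r = r]
    by (intro some_equality) auto
  define x where "x s = Matrix.vec ?d (\<lambda>i. case dec i of (j, k) \<Rightarrow> X j k s)" for s
  define u where "u s = Matrix.vec m (\<lambda>j. v j s)" for s
  have x: "x s $ (block_start r j + k) = X j k s" if "j < m" "k < r j" for j k s
    unfolding x_def using that block_index_less[where r = r, OF that] by (simp add: dec)
  have xc: "x s \<in> carrier_vec ?d" and uc: "u s \<in> carrier_vec m" for s unfolding x_def u_def by simp_all
  have u: "u s $ j = v j s" if "j < m" for s j using that unfolding u_def by simp
  have "admissible_input (box_inputs m \<alpha> \<beta>) m t u"
    unfolding admissible_input_def box_inputs_def using controlsD[OF v] uc by (auto simp: u)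
  moreover have "trajectory (brunovsky_A m r) (brunovsky_B m r) u x0 t x"
    unfolding trajectory_def dim_brunovsky
  proof (intro conjI ballI allI impI xc)
    fix i assume "i < ?d"
    then obtain j k where j: "j < m" and k: "k < r j" and i: "i = block_start r j + k"
      using block_index_exists by blast
    let ?F = "\<lambda>\<tau>. (brunovsky_A m r *\<^sub>v x \<tau> + brunovsky_B m r *\<^sub>v u \<tau>) $ i"
    have F: "?F = (if Suc k < r j then X j (Suc k) else v j)"
      unfolding i brunovsky_field[OF xc uc j k] using x[OF j, of "Suc k"] u[OF j] by (simp add: fun_eq_iff)
    show si: "set_integrable lebesgue {0..t} ?F"
      unfolding F X_def[abs_def]
      by (auto intro: absolutely_integrable_continuous_real chain_sol_continuous v j controls_set_integrable)
    fix s assume s: "s \<in> {0..t}"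
    have "set_integrable lebesgue {0..s} ?F"
      by (rule set_integrable_subset[OF si]) (use s in auto)
    from set_lebesgue_integral_eq_integral(2)[OF this]
    have "(LINT \<tau>:{0..s}|lebesgue. ?F \<tau>) = integral {0..s} ?F" .
    also have "\<dots> = X j k s - x0 $ i"
    proof (cases "Suc k < r j")
      case True
      have "(X j (Suc k) has_integral X j k s - x0 $ i) {0..s}"
        unfolding X_def[abs_def] i by (rule chain_sol_step[OF v[OF j] _ _ True]) (use s in auto)
      then show ?thesis unfolding F using True by (simp add: integral_unique)
    next
      case False
      then have "k = r j - 1" using k by simp
      then have "X j k s = x0 $ i + integral {0..s} (v j)"
        unfolding X_def i using chain_sol_last[OF r[OF j]] by simp
      moreover have "?F = v j" unfolding F using False by simp
      ultimately show ?thesis by simp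
    qed
    finally show "x s $ i = x0 $ i + (LINT \<tau>:{0..s}|lebesgue. ?F \<tau>)" unfolding i x[OF j k] by simp
  qed
  moreover have "z = x t"
  proof (rule eq_vecI)
    fix i assume "i < dim_vec (x t)"
    then have "i < ?d" unfolding x_def by simp
    then obtain j k where "j < m" "k < r j" "i = block_start r j + k"
      using block_index_exists by blast
    then show "z $ i = x t $ i" by (simp add: x zv X_def)
  qed (use asm in \<open>simp add: x_def\<close>)
  ultimately show "z \<in> integrator_reach_set m r \<alpha> \<beta> x0 t"
    unfolding integrator_reach_set_def reach_set_def dim_brunovsky by (intro CollectI exI conjI)
qed

theorem theorem5:
  fixes m d :: nat and r :: "nat \<Rightarrow> nat" and \<alpha> \<beta> :: "nat \<Rightarrow> real" and x0 :: "real Matrix.vec"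
  assumes "\<And>j. j < m \<Longrightarrow> r j > 0"
    and "(\<Sum>j<m. r j) = d"
    and "\<And>j. j < m \<Longrightarrow> \<alpha> j \<le> \<beta> j"
    and "x0 \<in> carrier_vec d"
  shows "\<forall>t\<ge>0. semialgebraic d (integrator_reach_set m r \<alpha> \<beta> x0 t)"
proof (intro allI impI)
  fix t :: real assume t: "0 \<le> t"
  have d: "block_start r m = d" using assms(2) unfolding block_start_def .
  \<comment> \<open>Affine map from the state to the moment vector of chain \<open>j\<close>;
    \<open>t\<close> and \<open>x0\<close> enter as constants only.\<close>
  define \<theta> where "\<theta> j e k = fact k * (e (block_start r j + (r j - 1 - k)) -
      (\<Sum>l<Suc k. x0 $ (block_start r j + (r j - 1 - k + l)) * (t ^ l / fact l)))" for j and e :: env and k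
  define \<phi> where "\<phi> e = (\<forall>j<m. \<theta> j e \<in> moment_set (r j) t (\<alpha> j) (\<beta> j))" for e
  have "(\<lambda>e. \<theta> j e k) \<in> polyfuns" for j k
    unfolding \<theta>_def by (intro polyfuns.mult polyfuns_diff polyfuns.var polyfuns.const)
  then have "sgn_determined \<phi>"
    unfolding \<phi>_def
    by (intro sgn_determined_all_less sgn_determined_subst[OF sgn_determined_moment_set] assms(1,3) t)
  then have "semialgebraic d {x \<in> carrier_vec d. \<phi> (env_of d x)}" by (rule semialgebraic_sgn_determined)
  moreover have "integrator_reach_set m r \<alpha> \<beta> x0 t = {x \<in> carrier_vec d. \<phi> (env_of d x)}"
  proof (rule Set.set_eqI)
    fix z
    have "(\<exists>v\<in>controls t (\<alpha> j) (\<beta> j). \<forall>k<r j. z $ (block_start r j + k) =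
        chain_sol (r j) (\<lambda>l. x0 $ (block_start r j + l)) v k t) \<longleftrightarrow>
      \<theta> j (env_of d z) \<in> moment_set (r j) t (\<alpha> j) (\<beta> j)" if j: "j < m" for j
    proof -
      \<comment> \<open>For large \<open>k\<close> truncated subtraction gives local index 0, so the
        entry stays in range and \<open>env_of\<close> never pads it.\<close>
      have "block_start r j + (r j - 1 - k) < d" for k
        using block_index_less[where r = r, OF j, of "r j - 1 - k"] assms(1)[OF j] unfolding d by simp
      then show ?thesis
        unfolding \<theta>_def by (subst chain_sol_moment_iff[OF assms(1)[OF j]]) (simp add: env_of_def)
    qed
    then show "z \<in> integrator_reach_set m r \<alpha> \<beta> x0 t \<longleftrightarrow> z \<in> {x \<in> carrier_vec d. \<phi> (env_of d x)}"
      using reach_set_iff[of t m r z \<alpha> \<beta> x0, OF t assms(1)] unfolding d \<phi>_def by simp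
  qed
  ultimately show "semialgebraic d (integrator_reach_set m r \<alpha> \<beta> x0 t)" by simp
qed

end
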